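(* Let $n\ge1$, let $\mathfrak p_0\in A=\mathbb F_q[T]$ be monic irreducible of degree $r$ with $\gcd(n,r)=1$, let $t\in\mathbb F_{q^r}$ be a root of $\mathfrak p_0$, let $\phi$ be the Drinfeld module with $\phi_T=t+\tau^n$, let $\mathfrak p\neq\mathfrak p_0$ be a monic irreducible element of $A$ of degree $d$, and let $m\mid n$. With $R$, $R_0$, $M$, $\kappa$, $Z$, $\operatorname{Ann}$ as defined in the context: (1) The maps $\operatorname{Ann}$ and $Z$ are anti-isomorphisms of lattices between the left ideals of $R$ and the $R_0$-submodules of $M$: for all left ideals $C_1,C_2$ of $R$ and all $R_0$-submodules $W_1,W_2$ of $M$, $$Z(C_1+C_2)=Z(C_1)\cap Z(C_2),\qquad Z(C_1\cap C_2)=Z(C_1)+Z(C_2),$$ $$\operatorname{Ann}(W_1+W_2)=\operatorname{Ann}(W_1)\cap\operatorname{Ann}(W_2),\qquad \operatorname{Ann}(W_1\cap W_2)=\operatorname{Ann}(W_1)+\operatorname{Ann}(W_2).$$ (2) For every $R_0$-submodule $W\subseteq M$, $\dim_\kappa\operatorname{Ann}(W)=m\,(n-\dim_\kappa W)$. If $\gcd(m,d)=1$ and $C=Rg$ is a nonzero left ideal with $g\in K[y;\sigma]$ its minimal monic generator (under the identification $R=K[y;\sigma]/(y^n-c)$), then $$\dim_\kappa Z(C)=\deg_yg=n-\dim_KC.$$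
   Context: $q$ is a prime power, $A=\mathbb F_q[T]$, $\overline{\mathbb F}_q$ a fixed algebraic closure, $[i]=q^i$, $\beta^{[i]}=\beta^{q^i}$. Twisted polynomials in $\tau$ satisfy $\tau a=a^q\tau$ and act on $\overline{\mathbb F}_q$ with $\tau$ acting as $x\mapsto x^q$ and constants by multiplication. $\phi\colon A\to\mathbb F_{q^r}\{\tau\}$, $a\mapsto\phi_a$, is the $\mathbb F_q$-algebra homomorphism with $\phi_T=t+\tau^n$. Put $\kappa=A/\mathfrak p\cong\mathbb F_{q^d}$ and $M=\phi[\mathfrak p]=\{v\in\overline{\mathbb F}_q:\phi_{\mathfrak p}(v)=0\}$, a $\kappa$-vector space of dimension $n$ via $a\cdot v=\phi_a(v)$; $E=\operatorname{End}_\kappa(M)$; $c=\mathfrak p_0\bmod\mathfrak p\in\kappa^\times$; $\pi=\tau^r$, acting on $M$ by $v\mapsto v^{[r]}$; $R_0=\kappa[\pi^m|_M]$; $R=\operatorname{Cent}_E(R_0)$ (centralizer). For a left ideal $C\subseteq R$ put $Z(C)=\{v\in M: f(v)=0\ \text{for all } f\in C\}$, and for an $R_0$-submodule $W\subseteq M$ put $\operatorname{Ann}(W)=\{f\in R: f(W)=0\}$. Let $L=\mathbb F_{q^m}\subseteq R$ act on $M$ by scalar multiplication, and let $K\subseteq R$ be the image of $L\otimes_{\mathbb F_q}\kappa$ under multiplication. When $\gcd(m,d)=1$, $K\cong\mathbb F_{q^{md}}$ is a field, conjugation by $\pi$ induces the automorphism $\sigma$ of $K$ that is the identity on $\kappa$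 and $\zeta\mapsto\zeta^{[r]}$ on $L$, and $y\mapsto\pi$ induces an isomorphism $K[y;\sigma]/(y^n-c)\cong R$, where $yx=\sigma(x)y$ for $x\in K$. For a nonzero left ideal $C$, its minimal monic generator is the unique monic $g\in K[y;\sigma]$ of minimal $y$-degree whose class lies in $C$; it satisfies $C=Rg$. *)

theory Defs
  imports
    "HOL-Algebra.UnivPoly"
    "HOL-Algebra.QuotRing"
    "HOL-Algebra.Generated_Rings"
    "HOL-Algebra.Algebraic_Closure_Type"
    "HOL-Library.Cardinality"
    "Jordan_Normal_Form.Missing_VectorSpace"
begin

section \<open>Skew polynomials, left ideals, endomorphism rings\<close>

text \<open>
  The skew polynomial ring \<open>S[y;\<sigma>]\<close> with the rule \<open>y x = \<sigma>(x) y\<close>. Its elements are the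
  coefficient sequences of \<^const>\<open>UP\<close>, with coefficients written on the left; only the
  multiplication differs from the commutative polynomial ring.
\<close>

definition skew_UP :: "('b, 'm) ring_scheme \<Rightarrow> ('b \<Rightarrow> 'b) \<Rightarrow> ('b, nat \<Rightarrow> 'b) up_ring" where
  "skew_UP S \<sigma> = (UP S)\<lparr>monoid.mult := (\<lambda>f\<in>up S. \<lambda>g\<in>up S. \<lambda>k.
      \<Oplus>\<^bsub>S\<^esub>i\<in>{..k}. f i \<otimes>\<^bsub>S\<^esub> (\<sigma> ^^ i) (g (k - i)))\<rparr>"

definition left_ideal :: "'b set \<Rightarrow> ('b, 'm) ring_scheme \<Rightarrow> bool" where
  "left_ideal C S \<longleftrightarrow> additive_subgroup C S \<and> (\<forall>s\<in>carrier S. \<forall>x\<in>C. s \<otimes>\<^bsub>S\<^esub> x \<in> C)"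

definition centralizer :: "('b, 'm) ring_scheme \<Rightarrow> 'b set \<Rightarrow> 'b set" where
  "centralizer S B = {f \<in> carrier S. \<forall>x\<in>B. f \<otimes>\<^bsub>S\<^esub> x = x \<otimes>\<^bsub>S\<^esub> f}"

text \<open>
  Endomorphisms of a module are represented by functions that are \<^const>\<open>undefined\<close> outside its
  carrier, so that equality of endomorphisms is equality of functions.
\<close>

definition endo_ring :: "('s, 'c) ring_scheme \<Rightarrow> ('s, 'v, 'e) module_scheme \<Rightarrow> ('v \<Rightarrow> 'v) ring" where
  "endo_ring F V = \<lparr>
     carrier = module_hom F V V \<inter> extensional (carrier V),
     monoid.mult = compose (carrier V),
     monoid.one = (\<lambda>v\<in>carrier V. v),
     ring.zero = (\<lambda>v\<in>carrier V. \<zero>\<^bsub>V\<^esub>),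
     ring.add = (\<lambda>f g. \<lambda>v\<in>carrier V. f v \<oplus>\<^bsub>V\<^esub> g v)\<rparr>"

text \<open>A subset \<open>C\<close> of a ring \<open>S\<close> as a left module over scalars that act through \<open>h\<close> into \<open>S\<close>.\<close>

definition left_mult_module :: "('b, 'm) ring_scheme \<Rightarrow> ('s \<Rightarrow> 'b) \<Rightarrow> 'b set \<Rightarrow> ('s, 'b) module" where
  "left_mult_module S h C = \<lparr>
     carrier = C, monoid.mult = monoid.mult S, monoid.one = monoid.one S,
     ring.zero = ring.zero S, ring.add = ring.add S,
     module.smult = (\<lambda>x f. h x \<otimes>\<^bsub>S\<^esub> f)\<rparr>"


section \<open>Twisted polynomials and Drinfeld modules over finite fields\<close>

text \<open>
  The type \<open>'a\<close> is the finite field with \<open>q = CARD('a)\<close> elements, \<open>'a alg_closure\<close> its algebraic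
  closure, and \<^const>\<open>to_ac\<close> the embedding of the former into the latter.
\<close>

definition frob_pow :: "nat \<Rightarrow> 'a::{finite,field} alg_closure \<Rightarrow> 'a alg_closure" where
  "frob_pow i x = x ^ (CARD('a) ^ i)"

definition Fq_ext :: "nat \<Rightarrow> 'a::{finite,field} alg_closure ring" where
  "Fq_ext k = ring_of_type_algebra\<lparr>carrier := {x. frob_pow k x = x}\<rparr>"

abbreviation twisted_polys :: "nat \<Rightarrow> ('a::{finite,field} alg_closure, nat \<Rightarrow> 'a alg_closure) up_ring" where
  "twisted_polys r \<equiv> skew_UP (Fq_ext r) (frob_pow 1)"

definition tau_act :: "(nat \<Rightarrow> 'a::{finite,field} alg_closure) \<Rightarrow> 'a alg_closure \<Rightarrow> 'a alg_closure" where
  "tau_act f v = (\<Sum>i | f i \<noteq> 0. f i * frob_pow i v)"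

text \<open>
  The homomorphism of algebras \<open>\<phi>\<close> from \<open>\<bbbF>\<^sub>q[T]\<close> to the twisted polynomials over the
  field with \<open>q\<^sup>r\<close> elements that sends \<open>T\<close> to \<open>t + \<tau>\<^sup>n\<close>.
\<close>

definition drinfeld_module ::
  "nat \<Rightarrow> nat \<Rightarrow> 'a::{finite,field} alg_closure \<Rightarrow> ('a poly \<Rightarrow> (nat \<Rightarrow> 'a alg_closure)) \<Rightarrow> bool" where
  "drinfeld_module r n t \<phi> \<longleftrightarrow>
     \<phi> \<in> ring_hom ring_of_type_algebra (twisted_polys r) \<and>
     (\<forall>a. \<phi> [:a:] = up_ring.monom (twisted_polys r) (to_ac a) 0) \<and>
     \<phi> [:0, 1:] = up_ring.monom (twisted_polys r) t 0 \<oplus>\<^bsub>twisted_polys r\<^esub>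
                  up_ring.monom (twisted_polys r) 1 n"


section \<open>Torsion and its endomorphisms\<close>

definition residue_field :: "'a::field poly \<Rightarrow> 'a poly set ring" where
  "residue_field p = ring_of_type_algebra Quot (PIdl\<^bsub>ring_of_type_algebra\<^esub> p)"

definition residue_class :: "'a::field poly \<Rightarrow> 'a poly \<Rightarrow> 'a poly set" where
  "residue_class p a = (PIdl\<^bsub>ring_of_type_algebra\<^esub> p) +>\<^bsub>ring_of_type_algebra\<^esub> a"

definition torsion ::
  "('a::{finite,field} poly \<Rightarrow> (nat \<Rightarrow> 'a alg_closure)) \<Rightarrow> 'a poly \<Rightarrow> 'a alg_closure set" where
  "torsion \<phi> p = {v. tau_act (\<phi> p) v = 0}"

text \<open>The scalar \<open>B\<close> is a residue class; all its members act on \<open>p\<close>-torsion in the same way.\<close>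

definition class_act ::
  "('a::{finite,field} poly \<Rightarrow> (nat \<Rightarrow> 'a alg_closure)) \<Rightarrow> 'a poly set \<Rightarrow> 'a alg_closure \<Rightarrow> 'a alg_closure" where
  "class_act \<phi> B v = the_elem ((\<lambda>a. tau_act (\<phi> a) v) ` B)"

text \<open>
  An additive subgroup \<open>W\<close> of the algebraic closure as a module with scalar action \<open>s\<close>. The ring
  multiplication that the record type requires is a dummy.
\<close>

definition ac_module :: "('s \<Rightarrow> 'a::{finite,field} alg_closure \<Rightarrow> 'a alg_closure) \<Rightarrow> 'a alg_closure set
    \<Rightarrow> ('s, 'a alg_closure) module" where
  "ac_module s W = \<lparr>
     carrier = W, monoid.mult = (\<lambda>_ _. 0), monoid.one = 0, ring.zero = 0, ring.add = (+), module.smult = s\<rparr>"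

definition torsion_endo ::
  "('a::{finite,field} poly \<Rightarrow> (nat \<Rightarrow> 'a alg_closure)) \<Rightarrow> 'a poly \<Rightarrow> ('a alg_closure \<Rightarrow> 'a alg_closure) ring" where
  "torsion_endo \<phi> p = endo_ring (residue_field p) (ac_module (class_act \<phi>) (torsion \<phi> p))"

definition residue_endo ::
  "('a::{finite,field} poly \<Rightarrow> (nat \<Rightarrow> 'a alg_closure)) \<Rightarrow> 'a poly \<Rightarrow> 'a poly set
    \<Rightarrow> 'a alg_closure \<Rightarrow> 'a alg_closure" where
  "residue_endo \<phi> p B = (\<lambda>v\<in>torsion \<phi> p. class_act \<phi> B v)"

definition scalar_endo ::
  "('a::{finite,field} poly \<Rightarrow> (nat \<Rightarrow> 'a alg_closure)) \<Rightarrow> 'a poly \<Rightarrow> 'a alg_closure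
    \<Rightarrow> 'a alg_closure \<Rightarrow> 'a alg_closure" where
  "scalar_endo \<phi> p \<zeta> = (\<lambda>v\<in>torsion \<phi> p. \<zeta> * v)"

definition frob_endo ::
  "('a::{finite,field} poly \<Rightarrow> (nat \<Rightarrow> 'a alg_closure)) \<Rightarrow> 'a poly \<Rightarrow> nat
    \<Rightarrow> 'a alg_closure \<Rightarrow> 'a alg_closure" where
  "frob_endo \<phi> p r = (\<lambda>v\<in>torsion \<phi> p. frob_pow r v)"

text \<open>\<open>R\<^sub>0 = \<kappa>[\<pi>\<^sup>m]\<close> and its centralizer \<open>R\<close>.\<close>

definition R0_ring ::
  "('a::{finite,field} poly \<Rightarrow> (nat \<Rightarrow> 'a alg_closure)) \<Rightarrow> 'a poly \<Rightarrow> nat \<Rightarrow> nat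
    \<Rightarrow> ('a alg_closure \<Rightarrow> 'a alg_closure) ring" where
  "R0_ring \<phi> p r m = (torsion_endo \<phi> p)\<lparr>carrier := generate_ring (torsion_endo \<phi> p)
     (residue_endo \<phi> p ` carrier (residue_field p) \<union>
      {frob_endo \<phi> p r [^]\<^bsub>torsion_endo \<phi> p\<^esub> m})\<rparr>"

definition R_ring ::
  "('a::{finite,field} poly \<Rightarrow> (nat \<Rightarrow> 'a alg_closure)) \<Rightarrow> 'a poly \<Rightarrow> nat \<Rightarrow> nat
    \<Rightarrow> ('a alg_closure \<Rightarrow> 'a alg_closure) ring" where
  "R_ring \<phi> p r m = (torsion_endo \<phi> p)\<lparr>carrier :=
     centralizer (torsion_endo \<phi> p) (carrier (R0_ring \<phi> p r m))\<rparr>"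

definition R0_submodule ::
  "('a::{finite,field} poly \<Rightarrow> (nat \<Rightarrow> 'a alg_closure)) \<Rightarrow> 'a poly \<Rightarrow> nat \<Rightarrow> nat
    \<Rightarrow> 'a alg_closure set \<Rightarrow> bool" where
  "R0_submodule \<phi> p r m W \<longleftrightarrow>
     Module.submodule W (R0_ring \<phi> p r m) (ac_module (\<lambda>f v. f v) (torsion \<phi> p))"

definition zero_set ::
  "('a::{finite,field} poly \<Rightarrow> (nat \<Rightarrow> 'a alg_closure)) \<Rightarrow> 'a poly
    \<Rightarrow> ('a alg_closure \<Rightarrow> 'a alg_closure) set \<Rightarrow> 'a alg_closure set" where
  "zero_set \<phi> p C = {v \<in> torsion \<phi> p. \<forall>f\<in>C. f v = 0}"

definition annihilator ::
  "('a::{finite,field} poly \<Rightarrow> (nat \<Rightarrow> 'a alg_closure)) \<Rightarrow> 'a poly \<Rightarrow> nat \<Rightarrow> nat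
    \<Rightarrow> 'a alg_closure set \<Rightarrow> ('a alg_closure \<Rightarrow> 'a alg_closure) set" where
  "annihilator \<phi> p r m W = {f \<in> carrier (R_ring \<phi> p r m). \<forall>v\<in>W. f v = 0}"


section \<open>The skew polynomial presentation of \<open>R\<close>\<close>

text \<open>
  The field \<open>K\<close>: a tensor is a finite sum of pure tensors, so the image of \<open>L \<otimes> \<kappa>\<close> under
  multiplication consists of the finite sums of products.
\<close>

definition K_ring ::
  "('a::{finite,field} poly \<Rightarrow> (nat \<Rightarrow> 'a alg_closure)) \<Rightarrow> 'a poly \<Rightarrow> nat
    \<Rightarrow> ('a alg_closure \<Rightarrow> 'a alg_closure) ring" where
  "K_ring \<phi> p m = (torsion_endo \<phi> p)\<lparr>carrier :=
     {\<Oplus>\<^bsub>torsion_endo \<phi> p\<^esub>i\<in>{..<N}.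
        scalar_endo \<phi> p (\<zeta> i) \<otimes>\<^bsub>torsion_endo \<phi> p\<^esub> residue_endo \<phi> p (x i) | (N::nat) \<zeta> x.
        \<zeta> \<in> {..<N} \<rightarrow> carrier (Fq_ext m) \<and> x \<in> {..<N} \<rightarrow> carrier (residue_field p)}\<rparr>"

definition frob_conj ::
  "('a::{finite,field} poly \<Rightarrow> (nat \<Rightarrow> 'a alg_closure)) \<Rightarrow> 'a poly \<Rightarrow> nat
    \<Rightarrow> ('a alg_closure \<Rightarrow> 'a alg_closure) \<Rightarrow> ('a alg_closure \<Rightarrow> 'a alg_closure)" where
  "frob_conj \<phi> p r x =
     frob_endo \<phi> p r \<otimes>\<^bsub>torsion_endo \<phi> p\<^esub> x \<otimes>\<^bsub>torsion_endo \<phi> p\<^esub> inv\<^bsub>torsion_endo \<phi> p\<^esub> frob_endo \<phi> p r"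

abbreviation K_skew_polys ::
  "('a::{finite,field} poly \<Rightarrow> (nat \<Rightarrow> 'a alg_closure)) \<Rightarrow> 'a poly \<Rightarrow> nat \<Rightarrow> nat
    \<Rightarrow> ('a alg_closure \<Rightarrow> 'a alg_closure, nat \<Rightarrow> 'a alg_closure \<Rightarrow> 'a alg_closure) up_ring" where
  "K_skew_polys \<phi> p r m \<equiv> skew_UP (K_ring \<phi> p m) (frob_conj \<phi> p r)"

text \<open>The two-sided ideal \<open>(y\<^sup>n - c)\<close>, where \<open>c\<close> is the class of \<open>p\<^sub>0\<close> modulo \<open>p\<close>.\<close>

definition relation_ideal ::
  "('a::{finite,field} poly \<Rightarrow> (nat \<Rightarrow> 'a alg_closure)) \<Rightarrow> 'a poly \<Rightarrow> 'a poly \<Rightarrow> nat \<Rightarrow> nat \<Rightarrow> nat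
    \<Rightarrow> (nat \<Rightarrow> 'a alg_closure \<Rightarrow> 'a alg_closure) set" where
  "relation_ideal \<phi> p p0 r m n = Idl\<^bsub>K_skew_polys \<phi> p r m\<^esub>
     {up_ring.monom (K_skew_polys \<phi> p r m) \<one>\<^bsub>K_ring \<phi> p m\<^esub> n \<ominus>\<^bsub>K_skew_polys \<phi> p r m\<^esub>
      up_ring.monom (K_skew_polys \<phi> p r m) (residue_endo \<phi> p (residue_class p p0)) 0}"

definition eval_at_frob ::
  "('a::{finite,field} poly \<Rightarrow> (nat \<Rightarrow> 'a alg_closure)) \<Rightarrow> 'a poly \<Rightarrow> nat \<Rightarrow> nat
    \<Rightarrow> (nat \<Rightarrow> 'a alg_closure \<Rightarrow> 'a alg_closure) \<Rightarrow> ('a alg_closure \<Rightarrow> 'a alg_closure)" where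
  "eval_at_frob \<phi> p r m g = (\<Oplus>\<^bsub>torsion_endo \<phi> p\<^esub>i\<in>{..deg (K_ring \<phi> p m) g}.
     g i \<otimes>\<^bsub>torsion_endo \<phi> p\<^esub> (frob_endo \<phi> p r [^]\<^bsub>torsion_endo \<phi> p\<^esub> i))"

text \<open>The map from \<open>K[y;\<sigma>]/(y\<^sup>n - c)\<close> to \<open>R\<close> induced by \<open>y \<mapsto> \<pi>\<close>.\<close>

definition quotient_to_R ::
  "('a::{finite,field} poly \<Rightarrow> (nat \<Rightarrow> 'a alg_closure)) \<Rightarrow> 'a poly \<Rightarrow> nat \<Rightarrow> nat
    \<Rightarrow> (nat \<Rightarrow> 'a alg_closure \<Rightarrow> 'a alg_closure) set \<Rightarrow> ('a alg_closure \<Rightarrow> 'a alg_closure)" where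
  "quotient_to_R \<phi> p r m B = the_elem (eval_at_frob \<phi> p r m ` B)"

definition monic_with_class_in ::
  "('a::{finite,field} poly \<Rightarrow> (nat \<Rightarrow> 'a alg_closure)) \<Rightarrow> 'a poly \<Rightarrow> 'a poly \<Rightarrow> nat \<Rightarrow> nat \<Rightarrow> nat
    \<Rightarrow> ('a alg_closure \<Rightarrow> 'a alg_closure) set \<Rightarrow> (nat \<Rightarrow> 'a alg_closure \<Rightarrow> 'a alg_closure) \<Rightarrow> bool" where
  "monic_with_class_in \<phi> p p0 r m n C g \<longleftrightarrow>
     g \<in> carrier (K_skew_polys \<phi> p r m) \<and>
     g (deg (K_ring \<phi> p m) g) = \<one>\<^bsub>K_ring \<phi> p m\<^esub> \<and>
     quotient_to_R \<phi> p r m (relation_ideal \<phi> p p0 r m n +>\<^bsub>K_skew_polys \<phi> p r m\<^esub> g) \<in> C"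

definition minimal_monic_generator ::
  "('a::{finite,field} poly \<Rightarrow> (nat \<Rightarrow> 'a alg_closure)) \<Rightarrow> 'a poly \<Rightarrow> 'a poly \<Rightarrow> nat \<Rightarrow> nat \<Rightarrow> nat
    \<Rightarrow> ('a alg_closure \<Rightarrow> 'a alg_closure) set \<Rightarrow> (nat \<Rightarrow> 'a alg_closure \<Rightarrow> 'a alg_closure) \<Rightarrow> bool" where
  "minimal_monic_generator \<phi> p p0 r m n C g \<longleftrightarrow>
     monic_with_class_in \<phi> p p0 r m n C g \<and>
     (\<forall>h. monic_with_class_in \<phi> p p0 r m n C h \<longrightarrow> deg (K_ring \<phi> p m) g \<le> deg (K_ring \<phi> p m) h)"

text \<open>Dimensions over \<open>\<kappa>\<close> of subspaces of \<open>M\<close> and of \<open>R\<close>, and over \<open>K\<close> of left ideals of \<open>R\<close>.\<close>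

definition dim_kappa_M ::
  "('a::{finite,field} poly \<Rightarrow> (nat \<Rightarrow> 'a alg_closure)) \<Rightarrow> 'a poly \<Rightarrow> 'a alg_closure set \<Rightarrow> nat" where
  "dim_kappa_M \<phi> p W = vectorspace.dim (residue_field p) (ac_module (class_act \<phi>) W)"

definition dim_kappa_R ::
  "('a::{finite,field} poly \<Rightarrow> (nat \<Rightarrow> 'a alg_closure)) \<Rightarrow> 'a poly
    \<Rightarrow> ('a alg_closure \<Rightarrow> 'a alg_closure) set \<Rightarrow> nat" where
  "dim_kappa_R \<phi> p C =
     vectorspace.dim (residue_field p) (left_mult_module (torsion_endo \<phi> p) (residue_endo \<phi> p) C)"

definition dim_K_R ::
  "('a::{finite,field} poly \<Rightarrow> (nat \<Rightarrow> 'a alg_closure)) \<Rightarrow> 'a poly \<Rightarrow> nat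
    \<Rightarrow> ('a alg_closure \<Rightarrow> 'a alg_closure) set \<Rightarrow> nat" where
  "dim_K_R \<phi> p m C =
     vectorspace.dim (K_ring \<phi> p m) (left_mult_module (torsion_endo \<phi> p) (\<lambda>x. x) C)"

end

theory Submission
  imports Defs
begin

text \<open>
  Write \<open>\<gamma> = \<pi>\<^sup>m\<close> and \<open>s = n/m\<close>. All of \<open>E\<close> commutes with \<open>\<kappa>\<close>, so \<open>R\<close> is the centralizer of \<open>\<gamma>\<close>
  in \<open>E\<close>. Two facts make \<open>E\<close> over \<open>R\<close> behave like a cyclic Galois extension of degree \<open>s\<close>. First,
  the prime \<open>p\<^sub>0\<close> acts as \<open>\<tau>\<^sup>n\<^sup>r = \<gamma>\<^sup>s\<close> (\<open>act_p0\<close>), so \<open>\<gamma>\<^sup>s\<close> is the scalar \<open>c\<close> and conjugation by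
  \<open>\<gamma>\<close> has order dividing \<open>s\<close> on \<open>E\<close>. Second, the field with \<open>q\<^sup>n\<close> elements acts on \<open>M\<close> by
  multiplication, and \<open>\<gamma>\<close> conjugates these multiplications by an automorphism of exact order \<open>s\<close>,
  because \<open>n\<close> and \<open>r\<close> are coprime. Powers of a generator of that field and the coefficients of a
  Lagrange polynomial at its conjugates are dual bases (\<open>frobenius_dual_bases\<close>): endomorphisms \<open>a\<^sub>k\<close>,
  \<open>b\<^sub>k\<close> with \<open>\<Sum>\<^sub>k b\<^sub>k \<gamma>\<^sup>j a\<^sub>k = 0\<close> for \<open>0 < j < s\<close> and \<open>\<Sum>\<^sub>k b\<^sub>k a\<^sub>k = 1\<close>. With the trace
  \<open>Tr f = \<Sum>\<^sub>j\<^sub><\<^sub>s \<gamma>\<^sup>j f \<gamma>\<^sup>-\<^sup>j\<close> from \<open>E\<close> to \<open>R\<close> this gives \<open>f = \<Sum>\<^sub>k b\<^sub>k Tr(a\<^sub>k f)\<close> for all \<open>f \<in> E\<close>.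

  For \<open>E\<close> in place of \<open>R\<close> the correspondence is linear algebra: a vector outside a subspace is
  separated from it by an endomorphism, and a left ideal of \<open>E\<close> contains every endomorphism that
  vanishes on its common zeros (\<open>mem_left_ideal_of_common_zeros\<close>). The trace carries this to \<open>R\<close>. If
  \<open>v\<close> lies outside a submodule \<open>W\<close>, and \<open>f \<in> E\<close> kills \<open>W\<close> but not \<open>v\<close>, then some \<open>Tr(a\<^sub>k f)\<close> kills
  \<open>W\<close> but not \<open>v\<close>; hence \<open>Z(Ann W) = W\<close>. If \<open>C\<close> is a left ideal of \<open>R\<close>, the \<open>h \<in> E\<close> with
  \<open>Tr(g h) \<in> C\<close> for all \<open>g \<in> E\<close> form a left ideal of \<open>E\<close> that contains \<open>C\<close>. An \<open>f \<in> Ann(Z C)\<close>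
  belongs to it, and \<open>f = Tr(a\<^sub>0 b\<^sub>0 f) \<in> C\<close>; hence \<open>Ann(Z C) = C\<close>. The lattice identities follow
  formally from these two equalities.

  For the dimension, \<open>f \<mapsto> (Tr(a\<^sub>k f))\<^sub>k\<close> is a bijection from the annihilator of \<open>W\<close> in \<open>E\<close> to the \<open>s\<close>-th
  power of \<open>Ann W\<close>, so \<open>Ann W\<close> can be counted. Dimensions are read off from cardinalities throughout;
  \<open>M\<close> itself has \<open>q\<^sup>n\<^sup>d\<close> elements because \<open>p\<close> acts by a polynomial whose derivative is the nonzero
  constant \<open>p(t)\<close>.

  Let \<open>m\<close> and \<open>d\<close> be coprime. A finite group on which \<open>K\<close> acts is a vector space over \<open>L\<close> and over
  \<open>\<kappa>\<close>, so its order is a power of \<open>q\<^sup>m\<^sup>d\<close>. As \<open>K\<close> has at most \<open>q\<^sup>m\<^sup>d\<close> elements, it has no proper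
  nonzero ideal and is a field. The dual bases for \<open>\<pi>\<close> show that \<open>1, \<pi>, \<dots>, \<pi>\<^sup>n\<^sup>-\<^sup>1\<close> are linearly
  independent over \<open>K\<close> (\<open>frobenius_independent\<close>), and by counting they generate \<open>R\<close>. If \<open>g\<close> is the
  minimal monic generator of \<open>C\<close> and \<open>\<delta>\<close> its degree, then \<open>C\<close> contains no nonzero polynomial in \<open>\<pi>\<close>
  of degree less than \<open>\<delta>\<close>, while division by \<open>g\<close> reduces every element of \<open>R\<close> modulo \<open>C\<close> to such a
  polynomial. So \<open>C\<close> has \<open>q\<^sup>m\<^sup>d\<^sup>(\<^sup>n\<^sup>-\<^sup>\<delta>\<^sup>)\<close> elements, which determines \<open>dim\<^sub>K C\<close>, and \<open>dim\<^sub>\<kappa> Z(C)\<close>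
  through \<open>C = Ann(Z C)\<close>.
\<close>

section \<open>Finite vector spaces and their endomorphism rings\<close>

lemma (in vectorspace) card_carrier_eq_power_dim:
  assumes "finite (carrier V)"
  shows "card (carrier V) = card (carrier K) ^ dim"
proof -
  have "span (carrier V) = carrier V"
    using span_is_subset2[of "carrier V"] in_own_span[of "carrier V"] by auto
  then have "fin_dim" unfolding fin_dim_def using assms by blast
  then obtain B where B: "finite B" "basis B" using finite_basis_exists by blast
  have BV: "B \<subseteq> carrier V" using B(2) unfolding basis_def by blast
  have "bij_betw (\<lambda>a. lincomb a B) (B \<rightarrow>\<^sub>E carrier K) (carrier V)"
    unfolding bij_betw_def
  proof
    show "inj_on (\<lambda>a. lincomb a B) (B \<rightarrow>\<^sub>E carrier K)"
    proof (rule inj_onI)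
      fix a b assume ab: "a \<in> B \<rightarrow>\<^sub>E carrier K" "b \<in> B \<rightarrow>\<^sub>E carrier K"
        and eq: "lincomb a B = lincomb b B"
      have "lincomb a B \<in> carrier V" using ab BV by (intro lincomb_closed) auto
      then show "a = b"
        using basis_criterion[OF B(1) BV] B(2) ab eq by metis
    qed
    show "(\<lambda>a. lincomb a B) ` (B \<rightarrow>\<^sub>E carrier K) = carrier V"
    proof
      show "(\<lambda>a. lincomb a B) ` (B \<rightarrow>\<^sub>E carrier K) \<subseteq> carrier V"
        using BV by (auto intro!: lincomb_closed)
      show "carrier V \<subseteq> (\<lambda>a. lincomb a B) ` (B \<rightarrow>\<^sub>E carrier K)"
      proof
        fix v assume "v \<in> carrier V"
        then have "\<exists>!a. a \<in> B \<rightarrow>\<^sub>E carrier K \<and> lincomb a B = v"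
          using basis_criterion[OF B(1) BV] B(2) by blast
        then obtain a where "a \<in> B \<rightarrow>\<^sub>E carrier K" "lincomb a B = v" by blast
        then show "v \<in> (\<lambda>a. lincomb a B) ` (B \<rightarrow>\<^sub>E carrier K)" by blast
      qed
    qed
  qed
  then have "card (carrier V) = card (B \<rightarrow>\<^sub>E carrier K)" by (metis bij_betw_same_card)
  also have "\<dots> = card (carrier K) ^ card B" by (rule card_funcsetE[OF B(1)])
  also have "card B = dim" using dim_basis[OF B] by simp
  finally show ?thesis .
qed

text \<open>
  The addition and the zero of \<open>V\<close> are those of the type, so that class-based simplification and
  \<^const>\<open>sum\<close> apply to vectors.
\<close>

locale finite_linear_space = vectorspace F V
  for F :: "('k, 'c) ring_scheme" and V :: "('k, 'v::ab_group_add, 'e) module_scheme" +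
  assumes finite_scalars: "finite (carrier F)"
    and finite_vectors: "finite (carrier V)"
    and add_V [simp]: "add V = (+)"
    and zero_V [simp]: "zero V = 0"
begin

abbreviation M where "M \<equiv> carrier V"
abbreviation E where "E \<equiv> carrier (endo_ring F V)"

lemma zero_M: "0 \<in> M" using M.zero_closed by simp
lemma add_M: "u \<in> M \<Longrightarrow> v \<in> M \<Longrightarrow> u + v \<in> M" using M.a_closed by simp
lemma a_inv_V: "v \<in> M \<Longrightarrow> \<ominus>\<^bsub>V\<^esub> v = - v"
  using M.r_neg[of v] by (simp add: eq_neg_iff_add_eq_0 add.commute)
lemma minus_M: "v \<in> M \<Longrightarrow> - v \<in> M" using M.a_inv_closed[of v] by (simp add: a_inv_V)
lemma diff_M: "u \<in> M \<Longrightarrow> v \<in> M \<Longrightarrow> u - v \<in> M" using add_M[of u "-v"] minus_M by simp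
lemma sum_M: "(\<And>i. i \<in> I \<Longrightarrow> f i \<in> M) \<Longrightarrow> sum f I \<in> M"
  by (induction I rule: infinite_finite_induct) (auto simp: zero_M add_M)
lemma smult_add: "a \<in> carrier F \<Longrightarrow> u \<in> M \<Longrightarrow> v \<in> M \<Longrightarrow> a \<odot>\<^bsub>V\<^esub> (u + v) = a \<odot>\<^bsub>V\<^esub> u + a \<odot>\<^bsub>V\<^esub> v"
  using smult_r_distr[of a u v] by simp
lemma add_smult: "a \<in> carrier F \<Longrightarrow> b \<in> carrier F \<Longrightarrow> v \<in> M \<Longrightarrow>
    (a \<oplus>\<^bsub>F\<^esub> b) \<odot>\<^bsub>V\<^esub> v = a \<odot>\<^bsub>V\<^esub> v + b \<odot>\<^bsub>V\<^esub> v"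
  using smult_l_distr[of a b v] by simp
lemma smult_minus: "a \<in> carrier F \<Longrightarrow> v \<in> M \<Longrightarrow> a \<odot>\<^bsub>V\<^esub> (- v) = - (a \<odot>\<^bsub>V\<^esub> v)"
  using smult_r_minus[of a v] by (simp add: a_inv_V)
lemma smult_sum: "a \<in> carrier F \<Longrightarrow> (\<And>i. i \<in> I \<Longrightarrow> f i \<in> M) \<Longrightarrow>
    a \<odot>\<^bsub>V\<^esub> (sum f I) = (\<Sum>i\<in>I. a \<odot>\<^bsub>V\<^esub> f i)"
proof (induction I rule: infinite_finite_induct)
  case (insert x I)
  then show ?case by (simp add: smult_add sum_M)
qed (use smult_r_null[of a] in auto)

lemma endo_iff: "f \<in> E \<longleftrightarrow> f \<in> extensional M \<and> (\<forall>v\<in>M. f v \<in> M) \<and>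
    (\<forall>u\<in>M. \<forall>v\<in>M. f (u + v) = f u + f v) \<and> (\<forall>a\<in>carrier F. \<forall>v\<in>M. f (a \<odot>\<^bsub>V\<^esub> v) = a \<odot>\<^bsub>V\<^esub> f v)"
  by (auto simp: endo_ring_def module_hom_def)

lemma endoI:
  assumes "f \<in> extensional M" "\<And>v. v \<in> M \<Longrightarrow> f v \<in> M"
    "\<And>u v. u \<in> M \<Longrightarrow> v \<in> M \<Longrightarrow> f (u + v) = f u + f v"
    "\<And>a v. a \<in> carrier F \<Longrightarrow> v \<in> M \<Longrightarrow> f (a \<odot>\<^bsub>V\<^esub> v) = a \<odot>\<^bsub>V\<^esub> f v"
  shows "f \<in> E"
  using assms by (auto simp: endo_iff)

lemma endo_ext: "f \<in> E \<Longrightarrow> f \<in> extensional M" by (simp add: endo_iff)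
lemma endo_mem: "f \<in> E \<Longrightarrow> v \<in> M \<Longrightarrow> f v \<in> M" by (simp add: endo_iff)
lemma endo_add: "f \<in> E \<Longrightarrow> u \<in> M \<Longrightarrow> v \<in> M \<Longrightarrow> f (u + v) = f u + f v" by (simp add: endo_iff)
lemma endo_smult: "f \<in> E \<Longrightarrow> a \<in> carrier F \<Longrightarrow> v \<in> M \<Longrightarrow> f (a \<odot>\<^bsub>V\<^esub> v) = a \<odot>\<^bsub>V\<^esub> f v"
  by (simp add: endo_iff)
lemma endo_zero: "f \<in> E \<Longrightarrow> f 0 = 0"
  using endo_add[of f 0 0] zero_M by simp
lemma endo_minus: "f \<in> E \<Longrightarrow> v \<in> M \<Longrightarrow> f (- v) = - f v"
  using endo_add[of f v "- v"] minus_M[of v] endo_zero[of f] by (simp add: eq_neg_iff_add_eq_0 add.commute)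
lemma endo_diff: "f \<in> E \<Longrightarrow> u \<in> M \<Longrightarrow> v \<in> M \<Longrightarrow> f (u - v) = f u - f v"
  using endo_add[of f u "- v"] minus_M[of v] endo_minus[of f v] by simp
lemma endo_sum: "f \<in> E \<Longrightarrow> (\<And>i. i \<in> I \<Longrightarrow> g i \<in> M) \<Longrightarrow> f (sum g I) = (\<Sum>i\<in>I. f (g i))"
  by (induction I rule: infinite_finite_induct) (auto simp: endo_zero endo_add sum_M)
lemma endo_eqI: "f \<in> E \<Longrightarrow> g \<in> E \<Longrightarrow> (\<And>v. v \<in> M \<Longrightarrow> f v = g v) \<Longrightarrow> f = g"
  using extensionalityI[OF endo_ext endo_ext] by blast

lemma endo_ring_simps [simp]:
  "\<one>\<^bsub>endo_ring F V\<^esub> = (\<lambda>v\<in>M. v)" "\<zero>\<^bsub>endo_ring F V\<^esub> = (\<lambda>v\<in>M. 0)"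
  "f \<otimes>\<^bsub>endo_ring F V\<^esub> g = compose M f g"
  "f \<oplus>\<^bsub>endo_ring F V\<^esub> g = (\<lambda>v\<in>M. f v + g v)"
  by (auto simp: endo_ring_def)

lemma endo_compose: "f \<in> E \<Longrightarrow> g \<in> E \<Longrightarrow> compose M f g \<in> E"
  by (rule endoI) (auto simp: compose_def endo_mem endo_add endo_smult add_M)
lemma endo_plus: "f \<in> E \<Longrightarrow> g \<in> E \<Longrightarrow> (\<lambda>v\<in>M. f v + g v) \<in> E"
  by (rule endoI) (auto simp: endo_mem endo_add endo_smult add_M smult_add algebra_simps)
lemma endo_uminus: "f \<in> E \<Longrightarrow> (\<lambda>v\<in>M. - f v) \<in> E"
  by (rule endoI) (auto simp: endo_mem endo_add endo_smult add_M smult_minus minus_M)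
lemma endo_id: "(\<lambda>v\<in>M. v) \<in> E"
  by (rule endoI) (auto simp: add_M)
lemma endo_null: "(\<lambda>v\<in>M. 0) \<in> E"
  using smult_r_null by (intro endoI) (auto simp: add_M zero_M)
lemma endo_setsum:
  "(\<And>i. i \<in> I \<Longrightarrow> f i \<in> E) \<Longrightarrow> (\<lambda>v\<in>M. \<Sum>i\<in>I. f i v) \<in> E"
  by (rule endoI) (auto simp: endo_mem endo_add endo_smult add_M sum_M smult_sum sum.distrib)

lemma ring_endo: "ring (endo_ring F V)"
proof (rule ringI)
  show "abelian_group (endo_ring F V)"
  proof (rule abelian_groupI)
    fix f assume f: "f \<in> E"
    have "(\<lambda>v\<in>M. - f v) \<oplus>\<^bsub>endo_ring F V\<^esub> f = \<zero>\<^bsub>endo_ring F V\<^esub>"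
      by (auto simp: restrict_def)
    then show "\<exists>g\<in>E. g \<oplus>\<^bsub>endo_ring F V\<^esub> f = \<zero>\<^bsub>endo_ring F V\<^esub>"
      using endo_uminus[OF f] by blast
  next
    fix f assume f: "f \<in> E"
    show "\<zero>\<^bsub>endo_ring F V\<^esub> \<oplus>\<^bsub>endo_ring F V\<^esub> f = f"
      by (intro endo_eqI) (use f endo_plus[OF endo_null f] in \<open>auto simp: restrict_def\<close>)
  qed (auto simp: endo_plus endo_null add_M endo_mem add.assoc add.commute intro!: restrict_ext)
  show "Group.monoid (endo_ring F V)"
  proof (rule monoidI)
    fix f g h assume fgh: "f \<in> E" "g \<in> E" "h \<in> E"
    then show "f \<otimes>\<^bsub>endo_ring F V\<^esub> g \<otimes>\<^bsub>endo_ring F V\<^esub> h = f \<otimes>\<^bsub>endo_ring F V\<^esub> (g \<otimes>\<^bsub>endo_ring F V\<^esub> h)"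
      by (auto simp: compose_def restrict_def endo_mem)
  next
    fix f assume "f \<in> E"
    then have "f \<in> M \<rightarrow> M" "f \<in> extensional M" by (auto simp: endo_mem endo_ext)
    then show "\<one>\<^bsub>endo_ring F V\<^esub> \<otimes>\<^bsub>endo_ring F V\<^esub> f = f" "f \<otimes>\<^bsub>endo_ring F V\<^esub> \<one>\<^bsub>endo_ring F V\<^esub> = f"
      by (simp_all add: Id_compose compose_Id)
  qed (simp_all add: endo_compose endo_id)
qed (auto simp: compose_def restrict_def endo_mem endo_add)

lemma endo_a_inv: "f \<in> E \<Longrightarrow> \<ominus>\<^bsub>endo_ring F V\<^esub> f = (\<lambda>v\<in>M. - f v)"
  by (rule abelian_group.minus_equality[OF ring.is_abelian_group[OF ring_endo]])
    (auto simp: endo_uminus endo_uminus[unfolded restrict_def] restrict_def)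

lemma endo_finsum:
  "finite I \<Longrightarrow> (\<And>i. i \<in> I \<Longrightarrow> f i \<in> E) \<Longrightarrow>
    (\<Oplus>\<^bsub>endo_ring F V\<^esub>i\<in>I. f i) = (\<lambda>v\<in>M. \<Sum>i\<in>I. f i v)"
proof (induction I rule: finite_induct)
  case empty
  interpret E: ring "endo_ring F V" by (rule ring_endo)
  show ?case by simp
next
  case (insert i I)
  interpret E: ring "endo_ring F V" by (rule ring_endo)
  have "(\<Oplus>\<^bsub>endo_ring F V\<^esub>i\<in>insert i I. f i) = f i \<oplus>\<^bsub>endo_ring F V\<^esub> (\<Oplus>\<^bsub>endo_ring F V\<^esub>i\<in>I. f i)"
    using insert by (intro E.finsum_insert) auto
  with insert show ?case by (auto simp: restrict_def)
qed

lemma endo_nat_pow: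
  assumes "f \<in> E" shows "v \<in> M \<Longrightarrow> (f [^]\<^bsub>endo_ring F V\<^esub> (k::nat)) v = (f ^^ k) v"
proof (induction k arbitrary: v)
  case (Suc k)
  then show ?case using assms
    by (simp add: compose_def endo_mem funpow_swap1)
qed simp

lemma subspace_iff: "subspace F W V \<longleftrightarrow> W \<subseteq> M \<and> 0 \<in> W \<and> (\<forall>u\<in>W. \<forall>v\<in>W. u + v \<in> W) \<and>
    (\<forall>a\<in>carrier F. \<forall>v\<in>W. a \<odot>\<^bsub>V\<^esub> v \<in> W)"
  unfolding subspace_def LinearCombinations.submodule_def
  using vectorspace_axioms module_axioms by auto

lemma subspaceD:
  assumes "subspace F W V"
  shows "W \<subseteq> M" "0 \<in> W" "\<And>u v. u \<in> W \<Longrightarrow> v \<in> W \<Longrightarrow> u + v \<in> W"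
    "\<And>a v. a \<in> carrier F \<Longrightarrow> v \<in> W \<Longrightarrow> a \<odot>\<^bsub>V\<^esub> v \<in> W"
    "\<And>v. v \<in> W \<Longrightarrow> - v \<in> W" "\<And>u v. u \<in> W \<Longrightarrow> v \<in> W \<Longrightarrow> u - v \<in> W"
proof -
  show 1: "W \<subseteq> M" "0 \<in> W" "\<And>u v. u \<in> W \<Longrightarrow> v \<in> W \<Longrightarrow> u + v \<in> W"
    "\<And>a v. a \<in> carrier F \<Longrightarrow> v \<in> W \<Longrightarrow> a \<odot>\<^bsub>V\<^esub> v \<in> W"
    using assms by (auto simp: subspace_iff)
  show m: "- v \<in> W" if v: "v \<in> W" for v
  proof -
    have "(\<ominus>\<^bsub>F\<^esub> \<one>\<^bsub>F\<^esub>) \<odot>\<^bsub>V\<^esub> v = \<ominus>\<^bsub>V\<^esub> (\<one>\<^bsub>F\<^esub> \<odot>\<^bsub>V\<^esub> v)"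
      using v 1(1) by (intro smult_l_minus) auto
    then have "(\<ominus>\<^bsub>F\<^esub> \<one>\<^bsub>F\<^esub>) \<odot>\<^bsub>V\<^esub> v = - v" using v 1(1) by (auto simp: a_inv_V)
    then show ?thesis using 1(4)[of "\<ominus>\<^bsub>F\<^esub> \<one>\<^bsub>F\<^esub>" v] v by simp
  qed
  show "u - v \<in> W" if "u \<in> W" "v \<in> W" for u v
    using 1(3)[OF that(1) m[OF that(2)]] by simp
qed

text \<open>
  Every \<open>x\<close> in \<open>W + F v\<close> is \<open>w + a v\<close> for exactly one pair \<open>(w, a)\<close>, since a difference of two
  such expressions would make \<open>v\<close> a multiple of an element of \<open>W\<close>. Hence \<open>w + a v \<mapsto> g w + a u\<close> is
  well defined. The size and the shape of the extended space drive the counting arguments below.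
\<close>

lemma extend_step:
  assumes W: "subspace F W V" and N: "subspace F N V"
    and g: "g \<in> module_hom F (vs W) (vs N)" and v: "v \<in> M" "v \<notin> W" and u: "u \<in> N"
  obtains W' g' where "subspace F W' V" "W \<subseteq> W'" "v \<in> W'" "card W' = card W * card (carrier F)"
    "W' = (\<lambda>(w, a). w + a \<odot>\<^bsub>V\<^esub> v) ` (W \<times> carrier F)"
    "g' \<in> module_hom F (vs W') (vs N)" "\<forall>w\<in>W. g' w = g w" "g' v = u"
proof -
  note WD = subspaceD[OF W] and ND = subspaceD[OF N]
  have g_mem: "g w \<in> N" if "w \<in> W" for w using g that by (auto simp: module_hom_def)
  have g_add: "g (w + w') = g w + g w'" if "w \<in> W" "w' \<in> W" for w w'
    using g that by (auto simp: module_hom_def)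
  have g_smult: "g (a \<odot>\<^bsub>V\<^esub> w) = a \<odot>\<^bsub>V\<^esub> g w" if "a \<in> carrier F" "w \<in> W" for a w
    using g that by (auto simp: module_hom_def)
  have g_zero: "g 0 = 0" using g_add[of 0 0] WD(2) by simp
  define c where "c = (\<lambda>(w, a). w + a \<odot>\<^bsub>V\<^esub> v)"
  define D where "D = W \<times> carrier F"
  have inj: "inj_on c D"
  proof (rule inj_onI, clarsimp simp: c_def D_def)
    fix w a w' a' assume w: "w \<in> W" "w' \<in> W" and a: "a \<in> carrier F" "a' \<in> carrier F"
      and eq: "w + a \<odot>\<^bsub>V\<^esub> v = w' + a' \<odot>\<^bsub>V\<^esub> v"
    have d: "(a \<ominus>\<^bsub>F\<^esub> a') \<odot>\<^bsub>V\<^esub> v = a \<odot>\<^bsub>V\<^esub> v - a' \<odot>\<^bsub>V\<^esub> v"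
      using a v by (simp add: a_minus_def add_smult smult_l_minus a_inv_V)
    moreover have "a \<odot>\<^bsub>V\<^esub> v - a' \<odot>\<^bsub>V\<^esub> v = w' - w"
      using eq by (metis add_diff_cancel_right add_diff_eq diff_add_eq add.commute add_diff_cancel_left')
    ultimately have d': "(a \<ominus>\<^bsub>F\<^esub> a') \<odot>\<^bsub>V\<^esub> v = w' - w" by simp
    have "a = a'"
    proof (rule ccontr)
      assume ne: "a \<noteq> a'"
      define e where "e = a \<ominus>\<^bsub>F\<^esub> a'"
      have e: "e \<in> carrier F" "e \<noteq> \<zero>\<^bsub>F\<^esub>" using a ne unfolding e_def by auto
      then have i: "inv\<^bsub>F\<^esub> e \<in> carrier F" "inv\<^bsub>F\<^esub> e \<otimes>\<^bsub>F\<^esub> e = \<one>\<^bsub>F\<^esub>"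
        using field_Units by auto
      have "v = (inv\<^bsub>F\<^esub> e \<otimes>\<^bsub>F\<^esub> e) \<odot>\<^bsub>V\<^esub> v" using i v by simp
      also have "\<dots> = inv\<^bsub>F\<^esub> e \<odot>\<^bsub>V\<^esub> (w' - w)"
        using i(1) e(1) v d'[folded e_def] by (simp add: smult_assoc1)
      also have "\<dots> \<in> W" using WD(4)[OF i(1) WD(6)[OF w(2,1)]] .
      finally show False using v by simp
    qed
    then show "w = w' \<and> a = a'" using eq by simp
  qed
  define g' where "g' x = (case the_inv_into D c x of (w, a) \<Rightarrow> g w + a \<odot>\<^bsub>V\<^esub> u)" for x
  have g': "g' (w + a \<odot>\<^bsub>V\<^esub> v) = g w + a \<odot>\<^bsub>V\<^esub> u" if "w \<in> W" "a \<in> carrier F" for w a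
    using the_inv_into_f_f[OF inj, of "(w, a)"] that by (simp add: g'_def c_def D_def)
  have uM: "u \<in> M" using u ND by auto
  have wM: "\<And>w. w \<in> W \<Longrightarrow> w \<in> M" using WD by auto
  have gM: "\<And>w. w \<in> W \<Longrightarrow> g w \<in> M" using g_mem ND by auto
  have add_c: "w + a \<odot>\<^bsub>V\<^esub> v + (w' + a' \<odot>\<^bsub>V\<^esub> v) = (w + w') + (a \<oplus>\<^bsub>F\<^esub> a') \<odot>\<^bsub>V\<^esub> v"
    if "a \<in> carrier F" "a' \<in> carrier F" for w a w' a'
    using that v by (simp add: add_smult algebra_simps)
  have smult_c: "a' \<odot>\<^bsub>V\<^esub> (w + a \<odot>\<^bsub>V\<^esub> v) = a' \<odot>\<^bsub>V\<^esub> w + (a' \<otimes>\<^bsub>F\<^esub> a) \<odot>\<^bsub>V\<^esub> v"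
    if "w \<in> W" "a \<in> carrier F" "a' \<in> carrier F" for w a a'
    using that v wM by (simp add: smult_add smult_assoc1)
  have sub: "subspace F (c ` D) V"
    unfolding subspace_iff
  proof (intro conjI ballI)
    show "c ` D \<subseteq> M" using v wM by (auto simp: c_def D_def intro!: add_M)
    have "0 = 0 + \<zero>\<^bsub>F\<^esub> \<odot>\<^bsub>V\<^esub> v" using v smult_l_null[of v] by simp
    then show "0 \<in> c ` D" using WD unfolding c_def D_def by (intro image_eqI[of _ _ "(0, \<zero>\<^bsub>F\<^esub>)"]) auto
    show "x + y \<in> c ` D" if x: "x \<in> c ` D" and y: "y \<in> c ` D" for x y
    proof -
      obtain w a where wa: "w \<in> W" "a \<in> carrier F" "x = w + a \<odot>\<^bsub>V\<^esub> v"
        using x by (auto simp: c_def D_def)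
      obtain w' a' where wa': "w' \<in> W" "a' \<in> carrier F" "y = w' + a' \<odot>\<^bsub>V\<^esub> v"
        using y by (auto simp: c_def D_def)
      have "x + y = c (w + w', a \<oplus>\<^bsub>F\<^esub> a')" using wa wa' by (simp add: c_def add_c)
      moreover have "(w + w', a \<oplus>\<^bsub>F\<^esub> a') \<in> D" using wa wa' WD by (simp add: D_def)
      ultimately show ?thesis by blast
    qed
    show "b \<odot>\<^bsub>V\<^esub> x \<in> c ` D" if b: "b \<in> carrier F" and x: "x \<in> c ` D" for b x
    proof -
      obtain w a where wa: "w \<in> W" "a \<in> carrier F" "x = w + a \<odot>\<^bsub>V\<^esub> v"
        using x by (auto simp: c_def D_def)
      have "b \<odot>\<^bsub>V\<^esub> x = c (b \<odot>\<^bsub>V\<^esub> w, b \<otimes>\<^bsub>F\<^esub> a)" using wa b by (simp add: c_def smult_c)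
      moreover have "(b \<odot>\<^bsub>V\<^esub> w, b \<otimes>\<^bsub>F\<^esub> a) \<in> D" using wa b WD by (simp add: D_def)
      ultimately show ?thesis by blast
    qed
  qed
  have hom: "g' \<in> module_hom F (vs (c ` D)) (vs N)"
    unfolding module_hom_def
  proof (intro CollectI conjI allI impI; (elim conjE)?)
    show "g' \<in> carrier (vs (c ` D)) \<rightarrow> carrier (vs N)"
      using g' g_mem ND u by (auto simp: c_def D_def)
  next
    fix x y assume "x \<in> carrier (vs (c ` D))" "y \<in> carrier (vs (c ` D))"
    then obtain w a w' a' where wa: "w \<in> W" "a \<in> carrier F" "x = w + a \<odot>\<^bsub>V\<^esub> v"
      and wa': "w' \<in> W" "a' \<in> carrier F" "y = w' + a' \<odot>\<^bsub>V\<^esub> v"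
      by (auto simp: c_def D_def)
    show "g' (x \<oplus>\<^bsub>vs (c ` D)\<^esub> y) = g' x \<oplus>\<^bsub>vs N\<^esub> g' y"
    proof -
      have "g' (x + y) = g' ((w + w') + (a \<oplus>\<^bsub>F\<^esub> a') \<odot>\<^bsub>V\<^esub> v)" using wa wa' by (simp add: add_c)
      also have "\<dots> = g' x + g' y"
        using wa wa' WD(3) uM by (simp add: g' g_add add_smult)
      finally show ?thesis by simp
    qed
  next
    fix b x assume b: "b \<in> carrier F" and "x \<in> carrier (vs (c ` D))"
    then obtain w a where wa: "w \<in> W" "a \<in> carrier F" "x = w + a \<odot>\<^bsub>V\<^esub> v"
      by (auto simp: c_def D_def)
    show "g' (b \<odot>\<^bsub>vs (c ` D)\<^esub> x) = b \<odot>\<^bsub>vs N\<^esub> g' x"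
      using wa b WD(4) uM gM by (simp add: smult_c g' g_smult smult_add smult_assoc1)
  qed
  show thesis
  proof (rule that[OF sub _ _ _ _ hom])
    have "w = c (w, \<zero>\<^bsub>F\<^esub>)" for w using v smult_l_null[of v] by (simp add: c_def)
    then show "W \<subseteq> c ` D" by (force simp: D_def)
    have "v = c (0, \<one>\<^bsub>F\<^esub>)" using v by (simp add: c_def)
    then show "v \<in> c ` D" using WD by (force simp: D_def)
    show "card (c ` D) = card W * card (carrier F)"
      using card_image[OF inj] by (simp add: D_def card_cartesian_product)
    show "c ` D = (\<lambda>(w, a). w + a \<odot>\<^bsub>V\<^esub> v) ` (W \<times> carrier F)"
      by (simp add: c_def D_def)
    show "\<forall>w\<in>W. g' w = g w"
      using g'[OF _ R.zero_closed] v uM smult_l_null[of v] smult_l_null[of u] by simp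
    show "g' v = u" using g'[of 0 "\<one>\<^bsub>F\<^esub>"] WD v uM g_zero by simp
  qed
qed

text \<open>
  Repeated one-dimensional extension by zero. The values stay in \<open>N\<close> because the argument with a
  minimal kernel below needs endomorphisms with values in a given line.
\<close>

lemma extend_hom:
  assumes "subspace F W V" and N: "subspace F N V" and "g \<in> module_hom F (vs W) (vs N)"
  obtains f where "f \<in> E" "\<forall>w\<in>W. f w = g w" "\<forall>v\<in>M. f v \<in> N"
  using assms(1,3)
proof (induction "card M - card W" arbitrary: W g thesis rule: less_induct)
  case less
  note WD = subspaceD[OF less.prems(2)] and ND = subspaceD[OF N]
  show ?case
  proof (cases "W = M")
    case True
    show ?thesis
    proof (rule less.prems(1))
      show "restrict g M \<in> E"
        using less.prems(3) ND True
        by (intro endoI) (auto simp: module_hom_def add_M)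
      show "\<forall>w\<in>W. restrict g M w = g w" using True by simp
      show "\<forall>v\<in>M. restrict g M v \<in> N"
        using less.prems(3) True by (auto simp: module_hom_def)
    qed
  next
    case False
    then obtain v where v: "v \<in> M" "v \<notin> W" using WD by auto
    obtain W' g' where W': "subspace F W' V" "W \<subseteq> W'" "v \<in> W'"
        "card W' = card W * card (carrier F)"
        "W' = (\<lambda>(w, a). w + a \<odot>\<^bsub>V\<^esub> v) ` (W \<times> carrier F)"
        "g' \<in> module_hom F (vs W') (vs N)" "\<forall>w\<in>W. g' w = g w" "g' v = 0"
      by (rule extend_step[OF less.prems(2) N less.prems(3) v ND(2)])
    have W'M: "W' \<subseteq> M" using subspaceD(1)[OF W'(1)] .
    have "card W < card W'"
      using W'(2,3) v(2) finite_subset[OF W'M finite_vectors] by (intro psubset_card_mono) auto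
    moreover have "card W' \<le> card M" using W'M finite_vectors by (rule card_mono[rotated])
    ultimately have lt: "card M - card W' < card M - card W" by linarith
    show ?thesis
    proof (rule less.hyps[OF lt _ W'(1,6)])
      fix f assume f: "f \<in> E" "\<forall>w\<in>W'. f w = g' w" "\<forall>v\<in>M. f v \<in> N"
      have "\<forall>w\<in>W. f w = g w" using f(2) W'(2,7) by auto
      then show ?thesis using less.prems(1)[OF f(1)] f(3) by blast
    qed
  qed
qed

lemma subspace_zero: "subspace F {0} V" using smult_r_null by (auto simp: subspace_iff zero_M)
lemma subspace_M: "subspace F M V" by (auto simp: subspace_iff zero_M add_M)

lemma ex_endo_separating:
  assumes W: "subspace F W V" and N: "subspace F N V" and v: "v \<in> M" "v \<notin> W" and u: "u \<in> N"
  obtains g where "g \<in> E" "\<forall>w\<in>W. g w = 0" "g v = u" "\<forall>x\<in>M. g x \<in> N"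
proof -
  have "(\<lambda>_. 0) \<in> module_hom F (vs W) (vs N)"
    using subspaceD(2)[OF N] smult_r_null by (auto simp: module_hom_def)
  obtain W' g' where W': "subspace F W' V" "W \<subseteq> W'" "v \<in> W'" "card W' = card W * card (carrier F)"
      "W' = (\<lambda>(w, a). w + a \<odot>\<^bsub>V\<^esub> v) ` (W \<times> carrier F)"
      "g' \<in> module_hom F (vs W') (vs N)" "\<forall>w\<in>W. g' w = 0" "g' v = u"
    by (rule extend_step[OF W N \<open>(\<lambda>_. 0) \<in> module_hom F (vs W) (vs N)\<close> v u])
  obtain g where g: "g \<in> E" "\<forall>w\<in>W'. g w = g' w" "\<forall>x\<in>M. g x \<in> N"
    by (rule extend_hom[OF W'(1) N W'(6)])
  show thesis
  proof (rule that[OF g(1)])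
    show "\<forall>w\<in>W. g w = 0" using g(2) W'(2,7) by auto
    show "g v = u" using g(2) W'(3,8) by simp
  qed (rule g(3))
qed

lemma subspace_line: assumes u: "u \<in> M" shows "subspace F ((\<lambda>a. a \<odot>\<^bsub>V\<^esub> u) ` carrier F) V"
  unfolding subspace_iff
proof (intro conjI ballI)
  have "0 = \<zero>\<^bsub>F\<^esub> \<odot>\<^bsub>V\<^esub> u" using smult_l_null[OF u] by simp
  then show "0 \<in> (\<lambda>a. a \<odot>\<^bsub>V\<^esub> u) ` carrier F" by blast
  show "x + y \<in> (\<lambda>a. a \<odot>\<^bsub>V\<^esub> u) ` carrier F"
    if "x \<in> (\<lambda>a. a \<odot>\<^bsub>V\<^esub> u) ` carrier F" "y \<in> (\<lambda>a. a \<odot>\<^bsub>V\<^esub> u) ` carrier F" for x y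
    using that u by (auto simp flip: add_smult)
  show "b \<odot>\<^bsub>V\<^esub> x \<in> (\<lambda>a. a \<odot>\<^bsub>V\<^esub> u) ` carrier F"
    if "b \<in> carrier F" "x \<in> (\<lambda>a. a \<odot>\<^bsub>V\<^esub> u) ` carrier F" for b x
    using that u by (auto simp flip: smult_assoc1)
qed (use u in auto)

lemma image_subspace:
  assumes f: "f \<in> E" shows "subspace F (f ` M) V"
  unfolding subspace_iff
proof (intro conjI ballI)
  show "f ` M \<subseteq> M" using endo_mem[OF f] by blast
  show "0 \<in> f ` M" using endo_zero[OF f] zero_M by (metis imageI)
  show "x + y \<in> f ` M" if "x \<in> f ` M" "y \<in> f ` M" for x y
    using that endo_add[OF f] add_M by (metis (no_types, lifting) imageE imageI)
  show "a \<odot>\<^bsub>V\<^esub> x \<in> f ` M" if "a \<in> carrier F" "x \<in> f ` M" for a x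
    using that endo_smult[OF f] smult_closed by (metis (no_types, lifting) imageE imageI)
qed

text \<open>
  A member \<open>j\<close> of \<open>J\<close> with the smallest kernel vanishes only on the common zeros of \<open>J\<close>: if some
  \<open>j' \<in> J\<close> did not kill \<open>v \<in> ker j\<close>, then \<open>j\<close> would not be surjective, and adding to \<open>j\<close> a multiple
  \<open>h j'\<close> of \<open>j'\<close> with values in a line that meets the image of \<open>j\<close> only in \<open>0\<close> would shrink the kernel. So
  \<open>ker j \<subseteq> ker f\<close>, and \<open>f\<close> factors as \<open>h j\<close>.
\<close>

lemma mem_left_ideal_of_common_zeros:
  assumes zJ: "(\<lambda>v\<in>M. 0) \<in> J" and JE: "J \<subseteq> E"
    and addJ: "\<And>f g. f \<in> J \<Longrightarrow> g \<in> J \<Longrightarrow> (\<lambda>v\<in>M. f v + g v) \<in> J"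
    and multJ: "\<And>f g. f \<in> E \<Longrightarrow> g \<in> J \<Longrightarrow> compose M f g \<in> J"
    and f: "f \<in> E" "\<And>v. v \<in> M \<Longrightarrow> (\<And>j. j \<in> J \<Longrightarrow> j v = 0) \<Longrightarrow> f v = 0"
  shows "f \<in> J"
proof -
  let ?ker = "\<lambda>j. {v\<in>M. j v = 0}"
  obtain j where j: "j \<in> J" "\<And>j'. j' \<in> J \<Longrightarrow> card (?ker j) \<le> card (?ker j')"
    using ex_has_least_nat[of "\<lambda>j. j \<in> J", OF zJ, of "\<lambda>j. card (?ker j)"] by blast
  have jE: "j \<in> E" using j JE by blast
  have kerj: "j' v = 0" if v: "v \<in> M" "j v = 0" and j': "j' \<in> J" for j' v
  proof (rule ccontr)
    assume ne: "j' v \<noteq> 0"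
    have j'E: "j' \<in> E" using j' JE by blast
    have "j ` M \<noteq> M"
    proof
      assume "j ` M = M"
      then have "inj_on j M" using finite_vectors by (simp add: eq_card_imp_inj_on)
      then have "v = 0" using v zero_M endo_zero[OF jE] by (metis inj_onD)
      then show False using ne endo_zero[OF j'E] by simp
    qed
    then obtain u where u: "u \<in> M" "u \<notin> j ` M" using endo_mem[OF jE] by blast
    let ?N = "(\<lambda>a. a \<odot>\<^bsub>V\<^esub> u) ` carrier F"
    have "u \<in> ?N" using u by (metis imageI R.one_closed smult_one)
    moreover have "j' v \<notin> {0}" using ne by simp
    ultimately obtain h where h: "h \<in> E" "\<forall>w\<in>{0}. h w = 0" "h (j' v) = u" "\<forall>x\<in>M. h x \<in> ?N"
      using ex_endo_separating[OF subspace_zero subspace_line[OF u(1)] endo_mem[OF j'E v(1)]] by blast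
    define k where "k = (\<lambda>x\<in>M. j x + compose M h j' x)"
    have kJ: "k \<in> J" unfolding k_def by (rule addJ[OF j(1) multJ[OF h(1) j']])
    \<comment> \<open>\<open>k x = 0\<close> means \<open>j x = - h (j' x)\<close>, an element of the line through \<open>u\<close>;
      the line meets the image of \<open>j\<close> only in \<open>0\<close>, so both sides vanish\<close>
    have "?ker k \<subseteq> ?ker j - {v}"
    proof (clarsimp)
      fix x assume x: "x \<in> M" "k x = 0"
      then have eq: "j x + h (j' x) = 0" by (simp add: k_def compose_def)
      obtain a where a: "a \<in> carrier F" "h (j' x) = a \<odot>\<^bsub>V\<^esub> u"
        using h(4) endo_mem[OF j'E x(1)] by blast
      have "a = \<zero>\<^bsub>F\<^esub>"
      proof (rule ccontr)
        assume "a \<noteq> \<zero>\<^bsub>F\<^esub>"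
        then have i: "inv\<^bsub>F\<^esub> a \<in> carrier F" "inv\<^bsub>F\<^esub> a \<otimes>\<^bsub>F\<^esub> a = \<one>\<^bsub>F\<^esub>"
          using field_Units a by auto
        have "a \<odot>\<^bsub>V\<^esub> u = - j x" using eq a by (simp add: eq_neg_iff_add_eq_0 add.commute)
        then have "a \<odot>\<^bsub>V\<^esub> u = j (- x)" using endo_minus[OF jE x(1)] by simp
        then have "inv\<^bsub>F\<^esub> a \<odot>\<^bsub>V\<^esub> (a \<odot>\<^bsub>V\<^esub> u) = j (inv\<^bsub>F\<^esub> a \<odot>\<^bsub>V\<^esub> (- x))"
          using endo_smult[OF jE i(1)] minus_M[OF x(1)] by simp
        moreover have "inv\<^bsub>F\<^esub> a \<odot>\<^bsub>V\<^esub> (a \<odot>\<^bsub>V\<^esub> u) = u"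
          using smult_assoc1[of "inv\<^bsub>F\<^esub> a" a u] i a u by simp
        ultimately show False using u i minus_M[OF x(1)] by (metis imageI smult_closed)
      qed
      then have "h (j' x) = 0" using a u smult_l_null[OF u(1)] by simp
      moreover have "x \<noteq> v"
        using \<open>h (j' x) = 0\<close> h(3) u endo_zero[OF jE] zero_M by (metis imageI)
      ultimately show "j x = 0 \<and> x \<noteq> v" using eq by simp
    qed
    then have "card (?ker k) < card (?ker j)"
      using v finite_vectors by (intro psubset_card_mono) auto
    then show False using j(2)[OF kJ] by simp
  qed
  have fker: "f v = 0" if "v \<in> M" "j v = 0" for v
    using f(2)[OF that(1)] kerj[OF that] by blast
  \<comment> \<open>the value does not depend on the preimage, because \<open>ker j \<subseteq> ker f\<close>\<close>
  define g where "g y = f (SOME x. x \<in> M \<and> j x = y)" for y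
  have g: "g (j x) = f x" if x: "x \<in> M" for x
  proof -
    define x' where "x' = (SOME x'. x' \<in> M \<and> j x' = j x)"
    have x': "x' \<in> M" "j x' = j x"
      using someI_ex[of "\<lambda>x'. x' \<in> M \<and> j x' = j x"] x unfolding x'_def by blast+
    have "f (x' - x) = 0" using x x' by (intro fker) (auto simp: diff_M endo_diff[OF jE])
    then have "f x' = f x" using x x' by (simp add: endo_diff[OF f(1)])
    then show ?thesis by (simp add: g_def x'_def)
  qed
  have "g \<in> module_hom F (vs (j ` M)) (vs M)"
    unfolding module_hom_def
  proof (intro CollectI conjI allI impI; (elim conjE)?)
    show "g \<in> carrier (vs (j ` M)) \<rightarrow> carrier (vs M)" using g endo_mem[OF f(1)] by auto
  next
    fix y y' assume "y \<in> carrier (vs (j ` M))" "y' \<in> carrier (vs (j ` M))"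
    then obtain x x' where x: "x \<in> M" "y = j x" "x' \<in> M" "y' = j x'" by auto
    have "g (j (x + x')) = g (j x) + g (j x')"
      using x by (simp add: g add_M endo_add[OF f(1)] del: add_V)
    then show "g (y \<oplus>\<^bsub>vs (j ` M)\<^esub> y') = g y \<oplus>\<^bsub>vs M\<^esub> g y'" using x by (simp add: endo_add[OF jE])
  next
    fix a y assume a: "a \<in> carrier F" and "y \<in> carrier (vs (j ` M))"
    then obtain x where x: "x \<in> M" "y = j x" by auto
    have "g (j (a \<odot>\<^bsub>V\<^esub> x)) = a \<odot>\<^bsub>V\<^esub> g (j x)"
      using x a by (simp add: g endo_smult[OF f(1)])
    then show "g (a \<odot>\<^bsub>vs (j ` M)\<^esub> y) = a \<odot>\<^bsub>vs M\<^esub> g y" using x a by (simp add: endo_smult[OF jE])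
  qed
  then obtain h where h: "h \<in> E" "\<forall>w\<in>j ` M. h w = g w" "\<forall>v\<in>M. h v \<in> M"
    by (rule extend_hom[OF image_subspace[OF jE] subspace_M])
  have "f = compose M h j"
    by (rule endo_eqI[OF f(1) endo_compose[OF h(1) jE]]) (simp add: compose_def h(2) g)
  then show ?thesis using multJ[OF h(1) j(1)] by simp
qed

text \<open>
  Here \<open>k\<close> is the codimension of \<open>W\<close>. Induction on it: passing from \<open>W\<close> to \<open>W + F v\<close>, an
  endomorphism that kills \<open>W\<close> is determined by its value at \<open>v\<close>, which is arbitrary, and by an
  endomorphism that kills \<open>W + F v\<close>; this contributes one factor \<^term>\<open>card M\<close>.
\<close>

lemma card_endo_annihilator:
  assumes "subspace F W V"
  obtains k where "card M = card W * card (carrier F) ^ k"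
    "card {f \<in> E. \<forall>w\<in>W. f w = 0} = card M ^ k"
  using assms
proof (induction "card M - card W" arbitrary: W thesis rule: less_induct)
  case less
  note WD = subspaceD[OF less.prems(2)]
  show ?case
  proof (cases "W = M")
    case True
    have "{f \<in> E. \<forall>w\<in>W. f w = 0} = {\<lambda>v\<in>M. 0}"
      using True endo_null by (auto intro!: endo_eqI)
    then show ?thesis using less.prems(1)[of 0] True by simp
  next
    case False
    then obtain v where v: "v \<in> M" "v \<notin> W" using WD by auto
    have "(\<lambda>_. 0) \<in> module_hom F (vs W) (vs M)"
      using zero_M smult_r_null by (auto simp: module_hom_def)
    obtain W' g' where W': "subspace F W' V" "W \<subseteq> W'" "v \<in> W'" "card W' = card W * card (carrier F)"
      "W' = (\<lambda>(w, a). w + a \<odot>\<^bsub>V\<^esub> v) ` (W \<times> carrier F)"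
      "g' \<in> module_hom F (vs W') (vs M)" "\<forall>w\<in>W. g' w = 0" "g' v = 0"
      by (rule extend_step[OF less.prems(2) subspace_M \<open>(\<lambda>_. 0) \<in> module_hom F (vs W) (vs M)\<close> v zero_M])
    have W'M: "W' \<subseteq> M" using subspaceD(1)[OF W'(1)] .
    have "card W < card W'"
      using W'(2,3) v(2) finite_subset[OF W'M finite_vectors] by (intro psubset_card_mono) auto
    moreover have "card W' \<le> card M" using W'M finite_vectors by (rule card_mono[rotated])
    ultimately have lt: "card M - card W' < card M - card W" by linarith
    obtain k where k: "card M = card W' * card (carrier F) ^ k"
      "card {f \<in> E. \<forall>w\<in>W'. f w = 0} = card M ^ k"
      using less.hyps[OF lt _ W'(1)] by blast
    let ?A = "\<lambda>W. {f \<in> E. \<forall>w\<in>W. f w = 0}"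
    \<comment> \<open>the representative \<open>s u\<close> of the value \<open>u\<close> kills \<open>W\<close> and sends \<open>v\<close> to \<open>u\<close>\<close>
    have "\<forall>u\<in>M. \<exists>g. g \<in> ?A W \<and> g v = u"
    proof
      fix u assume uM: "u \<in> M"
      obtain g where "g \<in> E" "\<forall>w\<in>W. g w = 0" "g v = u" "\<forall>x\<in>M. g x \<in> M"
        by (rule ex_endo_separating[OF less.prems(2) subspace_M v uM])
      then show "\<exists>g. g \<in> ?A W \<and> g v = u" by blast
    qed
    then obtain s where "\<forall>u\<in>M. s u \<in> ?A W \<and> s u v = u" using bchoice[of M "\<lambda>u g. g \<in> ?A W \<and> g v = u"] by blast
    then have s: "\<And>u. u \<in> M \<Longrightarrow> s u \<in> ?A W \<and> s u v = u" by blast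
    have A0: "f w = 0" if h: "f \<in> ?A W" "f v = 0" "w \<in> W'" for f w
    proof -
      obtain x c where x: "x \<in> W" "c \<in> carrier F" "w = x + c \<odot>\<^bsub>V\<^esub> v" using h(3) W'(5) by auto
      have fE: "f \<in> E" "f x = 0" using h(1) x(1) by auto
      have "x \<in> M" using x(1) WD(1) by blast
      then have "f w = f x + f (c \<odot>\<^bsub>V\<^esub> v)"
        unfolding x(3) using x(2) v(1) by (intro endo_add[OF fE(1)]) auto
      also have "\<dots> = c \<odot>\<^bsub>V\<^esub> 0" using endo_smult[OF fE(1) x(2) v(1)] h(2) fE(2) by simp
      also have "\<dots> = 0" using smult_r_null[OF x(2)] by simp
      finally show ?thesis .
    qed
    have "bij_betw (\<lambda>(u, f). (\<lambda>x\<in>M. s u x + f x)) (M \<times> ?A W') (?A W)"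
    proof (rule bij_betw_byWitness[where f' = "\<lambda>f. (f v, \<lambda>x\<in>M. f x - s (f v) x)"])
      show "\<forall>a\<in>M \<times> ?A W'. (\<lambda>f. (f v, \<lambda>x\<in>M. f x - s (f v) x)) ((\<lambda>(u, f). \<lambda>x\<in>M. s u x + f x) a) = a"
        using s v W'(3) by (auto intro!: extensionalityI[of _ M] simp: endo_ext)
      show "\<forall>f\<in>?A W. (\<lambda>(u, f). \<lambda>x\<in>M. s u x + f x) (f v, \<lambda>x\<in>M. f x - s (f v) x) = f"
        by (auto intro!: extensionalityI[of _ M] simp: endo_ext)
      show "(\<lambda>(u, f). \<lambda>x\<in>M. s u x + f x) ` (M \<times> ?A W') \<subseteq> ?A W"
      proof (intro image_subsetI, clarify, intro conjI ballI)
        fix u f assume uf: "u \<in> M" "f \<in> E" "\<forall>w\<in>W'. f w = 0"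
        show "(\<lambda>x\<in>M. s u x + f x) \<in> E" using s[OF uf(1)] uf(2) by (intro endo_plus) auto
        fix w assume "w \<in> W"
        then show "(\<lambda>x\<in>M. s u x + f x) w = 0" using s[OF uf(1)] uf(3) W'(2) WD(1) by auto
      qed
      show "(\<lambda>f. (f v, \<lambda>x\<in>M. f x - s (f v) x)) ` ?A W \<subseteq> M \<times> ?A W'"
      proof (rule image_subsetI)
        fix f assume "f \<in> ?A W"
        then have f: "f \<in> E" "\<forall>w\<in>W. f w = 0" by auto
        have fv: "f v \<in> M" using endo_mem[OF f(1) v(1)] .
        have sE: "s (f v) \<in> E" using s[OF fv] by simp
        define h where "h = (\<lambda>x\<in>M. f x - s (f v) x)"
        have "h = (\<lambda>x\<in>M. f x + (\<lambda>v'\<in>M. - s (f v) v') x)" by (auto simp: h_def)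
        then have hE: "h \<in> E" using endo_plus[OF f(1) endo_uminus[OF sE]] by simp
        moreover have "h \<in> ?A W" using hE f s[OF fv] WD(1) by (auto simp: h_def)
        moreover have "h v = 0" using s[OF fv] v by (simp add: h_def)
        ultimately have "h \<in> ?A W'" using A0 by blast
        then show "(f v, \<lambda>x\<in>M. f x - s (f v) x) \<in> M \<times> ?A W'"
          using fv unfolding h_def by blast
      qed
    qed
    then have "card (?A W) = card M * card (?A W')"
      by (simp add: bij_betw_same_card[symmetric] card_cartesian_product)
    then show ?thesis using less.prems(1)[of "Suc k"] k W'(4) by (simp add: mult_ac)
  qed
qed

end

section \<open>Descent from endomorphisms to a centralizer\<close>

text \<open>
  The axioms describe \<open>E\<close> as a cyclic Galois extension of degree \<open>s\<close> of the centralizer of \<open>\<gamma>\<close>, the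
  group being generated by conjugation by \<open>\<gamma>\<close>. The map \<open>\<delta>\<close> is the inverse of \<open>\<gamma>\<close>, and \<open>a\<close>, \<open>b\<close> are
  dual bases: the matrix of the \<open>\<gamma>\<^sup>j a\<^sub>k \<gamma>\<^sup>-\<^sup>j\<close> and the matrix of the \<open>\<gamma>\<^sup>j b\<^sub>k \<gamma>\<^sup>-\<^sup>j\<close> are, up to
  transposition, inverse to each other, which gives one identity for each order of the factors.
\<close>

locale endo_descent = finite_linear_space F V
  for F :: "('k, 'c) ring_scheme" and V :: "('k, 'v::ab_group_add, 'e) module_scheme" (structure) +
  fixes \<gamma> \<delta> :: "'v \<Rightarrow> 'v" and s :: nat and a b :: "nat \<Rightarrow> 'v \<Rightarrow> 'v"
  assumes gamma_endo: "\<gamma> \<in> E" and delta_endo: "\<delta> \<in> E"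
    and gamma_delta: "\<And>v. v \<in> M \<Longrightarrow> \<gamma> (\<delta> v) = v" and delta_gamma: "\<And>v. v \<in> M \<Longrightarrow> \<delta> (\<gamma> v) = v"
    and s_pos: "s > 0"
    and gamma_pow_central: "\<And>f v. f \<in> E \<Longrightarrow> v \<in> M \<Longrightarrow> f ((\<gamma> ^^ s) v) = (\<gamma> ^^ s) (f v)"
    and a_endo: "\<And>k. a k \<in> E" and b_endo: "\<And>k. b k \<in> E"
    and dual_left: "\<And>j v. j < s \<Longrightarrow> v \<in> M \<Longrightarrow>
      (\<Sum>k<s. b k ((\<gamma> ^^ j) (a k v))) = (if j = 0 then v else 0)"
    and dual_right: "\<And>k l v. k < s \<Longrightarrow> l < s \<Longrightarrow> v \<in> M \<Longrightarrow>
      (\<Sum>j<s. (\<gamma> ^^ j) (a k (b l ((\<delta> ^^ j) v)))) = (if k = l then v else 0)"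
begin

definition commutant :: "('v \<Rightarrow> 'v) set" where
  "commutant = {f \<in> E. \<forall>v\<in>M. f (\<gamma> v) = \<gamma> (f v)}"

definition trace :: "('v \<Rightarrow> 'v) \<Rightarrow> 'v \<Rightarrow> 'v" where
  "trace f = (\<lambda>v\<in>M. \<Sum>j<s. (\<gamma> ^^ j) (f ((\<delta> ^^ j) v)))"

lemma gamma_pow_mem: "v \<in> M \<Longrightarrow> (\<gamma> ^^ j) v \<in> M" by (induction j) (auto simp: endo_mem[OF gamma_endo])
lemma delta_pow_mem: "v \<in> M \<Longrightarrow> (\<delta> ^^ j) v \<in> M" by (induction j) (auto simp: endo_mem[OF delta_endo])
lemma gamma_pow_add: "u \<in> M \<Longrightarrow> v \<in> M \<Longrightarrow> (\<gamma> ^^ j) (u + v) = (\<gamma> ^^ j) u + (\<gamma> ^^ j) v"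
  by (induction j) (auto simp: endo_add[OF gamma_endo] gamma_pow_mem)
lemma delta_pow_add: "u \<in> M \<Longrightarrow> v \<in> M \<Longrightarrow> (\<delta> ^^ j) (u + v) = (\<delta> ^^ j) u + (\<delta> ^^ j) v"
  by (induction j) (auto simp: endo_add[OF delta_endo] delta_pow_mem)
lemma gamma_pow_smult: "c \<in> carrier F \<Longrightarrow> v \<in> M \<Longrightarrow> (\<gamma> ^^ j) (c \<odot>\<^bsub>V\<^esub> v) = c \<odot>\<^bsub>V\<^esub> (\<gamma> ^^ j) v"
  by (induction j) (auto simp: endo_smult[OF gamma_endo] gamma_pow_mem)
lemma delta_pow_smult: "c \<in> carrier F \<Longrightarrow> v \<in> M \<Longrightarrow> (\<delta> ^^ j) (c \<odot>\<^bsub>V\<^esub> v) = c \<odot>\<^bsub>V\<^esub> (\<delta> ^^ j) v"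
  by (induction j) (auto simp: endo_smult[OF delta_endo] delta_pow_mem)

lemma commutant_endo: "f \<in> commutant \<Longrightarrow> f \<in> E" by (simp add: commutant_def)
lemma commutant_gamma: "f \<in> commutant \<Longrightarrow> v \<in> M \<Longrightarrow> f (\<gamma> v) = \<gamma> (f v)" by (simp add: commutant_def)
lemma commutant_gamma_pow: "f \<in> commutant \<Longrightarrow> v \<in> M \<Longrightarrow> f ((\<gamma> ^^ j) v) = (\<gamma> ^^ j) (f v)"
  by (induction j) (auto simp: commutant_gamma gamma_pow_mem)
lemma gamma_pow_delta_pow: "v \<in> M \<Longrightarrow> (\<gamma> ^^ j) ((\<delta> ^^ j) v) = v"
proof (induction j arbitrary: v)
  case (Suc j)
  then show ?case using Suc.IH[of "\<delta> v"]
    by (simp add: funpow_swap1[of \<delta>] gamma_delta endo_mem[OF delta_endo])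
qed simp
lemma commutant_delta_pow:
  assumes f: "f \<in> commutant" and v: "v \<in> M" shows "f ((\<delta> ^^ j) v) = (\<delta> ^^ j) (f v)"
proof -
  have YX: "(\<delta> ^^ j) ((\<gamma> ^^ j) u) = u" if "u \<in> M" for u
    using that by (induction j arbitrary: u) (simp_all add: funpow_swap1[of \<gamma>] delta_gamma endo_mem[OF gamma_endo])
  have "(\<delta> ^^ j) (f v) = (\<delta> ^^ j) (f ((\<gamma> ^^ j) ((\<delta> ^^ j) v)))" using v by (simp add: gamma_pow_delta_pow)
  also have "\<dots> = (\<delta> ^^ j) ((\<gamma> ^^ j) (f ((\<delta> ^^ j) v)))" using f v by (simp add: commutant_gamma_pow delta_pow_mem)
  also have "\<dots> = f ((\<delta> ^^ j) v)" using f v by (simp add: YX endo_mem[OF commutant_endo] delta_pow_mem)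
  finally show ?thesis by simp
qed

lemma trace_endo: "f \<in> E \<Longrightarrow> trace f \<in> E"
  unfolding trace_def
  by (rule endoI)
    (auto simp: endo_mem endo_add endo_smult add_M sum_M smult_sum gamma_pow_mem delta_pow_mem gamma_pow_add
      delta_pow_add gamma_pow_smult delta_pow_smult sum.distrib)

text \<open>
  Conjugation by \<open>\<gamma>\<close> shifts the index \<open>j\<close> in the trace by one. The term that leaves at \<open>j = s\<close> equals
  the one that enters at \<open>j = 0\<close>, since \<open>\<gamma>\<^sup>s\<close> commutes with \<open>f\<close>.
\<close>

lemma trace_commutant:
  assumes f: "f \<in> E" shows "trace f \<in> commutant"
proof -
  have "trace f (\<gamma> v) = \<gamma> (trace f v)" if v: "v \<in> M" for v
  proof -
    let ?t = "\<lambda>j. (\<gamma> ^^ j) (f ((\<delta> ^^ j) (\<gamma> v)))"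
    have Xv: "\<gamma> v \<in> M" using v by (simp add: endo_mem[OF gamma_endo])
    have t_Suc: "?t (Suc j) = \<gamma> ((\<gamma> ^^ j) (f ((\<delta> ^^ j) v)))" for j
      using v by (simp add: funpow_swap1[of \<delta>] delta_gamma)
    have "?t s = f ((\<gamma> ^^ s) ((\<delta> ^^ s) (\<gamma> v)))" using gamma_pow_central[OF f delta_pow_mem[OF Xv]] by simp
    also have "\<dots> = ?t 0" by (simp add: gamma_pow_delta_pow[OF Xv])
    finally have wrap: "?t s = ?t 0" .
    have "trace f (\<gamma> v) + ?t s = (\<Sum>j<Suc s. ?t j)" using Xv by (simp add: trace_def)
    also have "\<dots> = ?t 0 + (\<Sum>j<s. ?t (Suc j))" by (rule sum.lessThan_Suc_shift)
    also have "(\<Sum>j<s. ?t (Suc j)) = \<gamma> (\<Sum>j<s. (\<gamma> ^^ j) (f ((\<delta> ^^ j) v)))"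
      using v by (simp only: t_Suc) (simp add: endo_sum[OF gamma_endo] gamma_pow_mem delta_pow_mem endo_mem[OF f])
    also have "\<dots> = \<gamma> (trace f v)" using v by (simp add: trace_def)
    finally show ?thesis using wrap by (simp add: add.commute)
  qed
  then show ?thesis using trace_endo[OF f] by (simp add: commutant_def)
qed

text \<open>
  Exchange the two sums: the sum over \<open>k\<close> retains only the summand \<open>j = 0\<close> of the trace. This
  identity is what recovers a property of \<open>f\<close> from properties of elements of the centralizer.
\<close>

lemma sum_b_trace_a:
  assumes f: "f \<in> E" and v: "v \<in> M"
  shows "(\<Sum>k<s. b k (trace (compose M (a k) f) v)) = f v"
proof -
  have "b k (trace (compose M (a k) f) v) = (\<Sum>j<s. b k ((\<gamma> ^^ j) (a k (f ((\<delta> ^^ j) v)))))" for k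
    using v by (simp add: trace_def compose_def delta_pow_mem endo_sum[OF b_endo] gamma_pow_mem
        endo_mem[OF a_endo] endo_mem[OF f])
  then have "(\<Sum>k<s. b k (trace (compose M (a k) f) v)) =
      (\<Sum>k<s. \<Sum>j<s. b k ((\<gamma> ^^ j) (a k (f ((\<delta> ^^ j) v)))))" by simp
  also have "\<dots> = (\<Sum>j<s. \<Sum>k<s. b k ((\<gamma> ^^ j) (a k (f ((\<delta> ^^ j) v)))))" by (rule sum.swap)
  also have "\<dots> = (\<Sum>j<s. if j = 0 then f ((\<delta> ^^ j) v) else 0)"
    using v by (intro sum.cong refl dual_left) (auto simp: endo_mem[OF f] delta_pow_mem)
  also have "\<dots> = f v" using s_pos by (subst sum.delta) auto
  finally show ?thesis .
qed

lemma trace_compose: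
  assumes "f \<in> E" "g \<in> commutant"
  shows "trace (compose M f g) = compose M (trace f) g"
  by (rule extensionalityI[of _ M])
    (use assms in \<open>auto simp: trace_def compose_def delta_pow_mem commutant_delta_pow endo_mem[OF commutant_endo]\<close>)

lemma trace_a_b: "k < s \<Longrightarrow> l < s \<Longrightarrow> v \<in> M \<Longrightarrow>
    trace (compose M (a k) (b l)) v = (if k = l then v else 0)"
  by (simp add: trace_def compose_def delta_pow_mem dual_right)

text \<open>
  \<open>\<gamma>\<close> is injective, hence permutes the finite set \<open>W\<close>; so the powers of \<open>\<delta>\<close> preserve \<open>W\<close> too.
\<close>

lemma trace_vanishes:
  assumes f: "f \<in> E" "\<And>w. w \<in> W \<Longrightarrow> f w = 0" and W: "subspace F W V" "\<And>w. w \<in> W \<Longrightarrow> \<gamma> w \<in> W" and w: "w \<in> W"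
  shows "trace f w = 0"
proof -
  note WD = subspaceD[OF W(1)]
  have "finite W" using finite_subset[OF WD(1) finite_vectors] .
  moreover have "inj_on \<gamma> W" by (rule inj_on_inverseI[of _ \<delta>]) (use WD(1) delta_gamma in auto)
  ultimately have "\<gamma> ` W = W" using W(2) by (intro endo_inj_surj) auto
  then have \<delta>: "\<delta> u \<in> W" if "u \<in> W" for u
    using that WD(1) delta_gamma by (metis (no_types, lifting) image_iff subsetD)
  have Yp: "(\<delta> ^^ j) w \<in> W" for j by (induction j) (auto simp: \<delta> w)
  have "(\<gamma> ^^ j) 0 = 0" for j by (induction j) (auto simp: endo_zero[OF gamma_endo])
  then show ?thesis using w WD(1) f(2)[OF Yp] by (auto simp: trace_def)
qed

lemma trace_plus: "f \<in> E \<Longrightarrow> g \<in> E \<Longrightarrow>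
    trace (\<lambda>v\<in>M. f v + g v) = (\<lambda>v\<in>M. trace f v + trace g v)"
  by (rule extensionalityI[of _ M])
    (auto simp: trace_def delta_pow_mem gamma_pow_add endo_mem sum.distrib)

lemma trace_null: "trace (\<lambda>v\<in>M. 0) = (\<lambda>v\<in>M. 0)"
proof -
  have "(\<gamma> ^^ j) 0 = 0" for j by (induction j) (auto simp: endo_zero[OF gamma_endo])
  then show ?thesis by (intro extensionalityI[of _ M]) (auto simp: trace_def delta_pow_mem)
qed

text \<open>
  An endomorphism \<open>g\<close> that kills \<open>W\<close> and fixes \<open>v \<notin> W\<close> need not commute with \<open>\<gamma>\<close>, but the traces
  of the \<open>a\<^sub>k g\<close> do, and they cannot all kill \<open>v\<close>, because \<open>g v\<close> is a combination of their values.
\<close>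

lemma common_zeros_annihilator:
  assumes W: "subspace F W V" "\<And>w. w \<in> W \<Longrightarrow> \<gamma> w \<in> W"
  shows "{v \<in> M. \<forall>f\<in>{f \<in> commutant. \<forall>w\<in>W. f w = 0}. f v = 0} = W"
proof
  show "W \<subseteq> {v \<in> M. \<forall>f\<in>{f \<in> commutant. \<forall>w\<in>W. f w = 0}. f v = 0}"
    using subspaceD(1)[OF W(1)] by auto
  show "{v \<in> M. \<forall>f\<in>{f \<in> commutant. \<forall>w\<in>W. f w = 0}. f v = 0} \<subseteq> W"
  proof (clarsimp)
    fix v assume v: "v \<in> M" and all: "\<forall>f. f \<in> commutant \<and> (\<forall>w\<in>W. f w = 0) \<longrightarrow> f v = 0"
    show "v \<in> W"
    proof (rule ccontr)
      assume nW: "v \<notin> W"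
      obtain g where g: "g \<in> E" "\<forall>w\<in>W. g w = 0" "g v = v" "\<forall>x\<in>M. g x \<in> M"
        by (rule ex_endo_separating[OF W(1) subspace_M v nW v])
      have "trace (compose M (a k) g) v = 0" for k
      proof -
        have e: "compose M (a k) g \<in> E" by (rule endo_compose[OF a_endo g(1)])
        have "compose M (a k) g w = 0" if "w \<in> W" for w
          using that g(2) subspaceD(1)[OF W(1)] endo_zero[OF a_endo] by (auto simp: compose_def)
        then show ?thesis using trace_vanishes[OF e _ W] all trace_commutant[OF e] by blast
      qed
      then have "g v = 0" using sum_b_trace_a[OF g(1) v] by (simp add: endo_zero[OF b_endo])
      then show False using g(3) nW subspaceD(2)[OF W(1)] by simp
    qed
  qed
qed

text \<open>
  The set \<open>J\<close> of the \<open>h\<close> with \<open>Tr(g h) \<in> C\<close> for all \<open>g \<in> E\<close> is a left ideal of \<open>E\<close>. It contains \<open>C\<close>,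
  since \<open>Tr(g h) = Tr(g) h\<close> for \<open>h\<close> in the centralizer. So it contains each \<open>f\<close> that vanishes on the
  common zeros of \<open>C\<close>; taking \<open>g = a\<^sub>0 b\<^sub>0\<close>, of trace \<open>1\<close>, returns \<open>f \<in> C\<close>.
\<close>

lemma annihilator_common_zeros:
  assumes C0: "(\<lambda>v\<in>M. 0) \<in> C" and CR: "C \<subseteq> commutant"
    and addC: "\<And>f g. f \<in> C \<Longrightarrow> g \<in> C \<Longrightarrow> (\<lambda>v\<in>M. f v + g v) \<in> C"
    and multC: "\<And>f g. f \<in> commutant \<Longrightarrow> g \<in> C \<Longrightarrow> compose M f g \<in> C"
  shows "{f \<in> commutant. \<forall>v\<in>{v \<in> M. \<forall>g\<in>C. g v = 0}. f v = 0} = C"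
proof
  show "C \<subseteq> {f \<in> commutant. \<forall>v\<in>{v \<in> M. \<forall>g\<in>C. g v = 0}. f v = 0}" using CR by auto
  show "{f \<in> commutant. \<forall>v\<in>{v \<in> M. \<forall>g\<in>C. g v = 0}. f v = 0} \<subseteq> C"
  proof (clarify)
    fix f assume f: "f \<in> commutant" "\<forall>v\<in>{v \<in> M. \<forall>g\<in>C. g v = 0}. f v = 0"
    define J where "J = {h \<in> E. \<forall>g\<in>E. trace (compose M g h) \<in> C}"
    have "f \<in> J"
    proof (rule mem_left_ideal_of_common_zeros)
      show "(\<lambda>v\<in>M. 0) \<in> J"
      proof -
        have "compose M g (\<lambda>v\<in>M. 0) = (\<lambda>v\<in>M. 0)" if "g \<in> E" for g
          using endo_zero[OF that] by (auto simp: compose_def)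
        then show ?thesis using C0 by (auto simp: J_def endo_null trace_null)
      qed
      show "J \<subseteq> E" by (auto simp: J_def)
      show "(\<lambda>v\<in>M. h v + h' v) \<in> J" if h: "h \<in> J" "h' \<in> J" for h h'
      proof -
        have hE: "h \<in> E" "h' \<in> E" using h by (auto simp: J_def)
        have "trace (compose M g (\<lambda>v\<in>M. h v + h' v)) \<in> C" if g: "g \<in> E" for g
        proof -
          have "compose M g (\<lambda>v\<in>M. h v + h' v) = (\<lambda>v\<in>M. compose M g h v + compose M g h' v)"
            using hE g by (auto simp: compose_def endo_mem endo_add)
          then show ?thesis
            using h g addC trace_plus[OF endo_compose[OF g hE(1)] endo_compose[OF g hE(2)]]
            by (auto simp: J_def)
        qed
        then show ?thesis using endo_plus[OF hE] by (simp add: J_def)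
      qed
      show "compose M h' h \<in> J" if h: "h' \<in> E" "h \<in> J" for h' h
      proof -
        have hE: "h \<in> E" using h by (auto simp: J_def)
        have assoc: "compose M g (compose M h' h) = compose M (compose M g h') h" for g
          using hE h(1) by (auto simp: compose_def endo_mem)
        have "trace (compose M g (compose M h' h)) \<in> C" if "g \<in> E" for g
          unfolding assoc using h(2) endo_compose[OF that h(1)] by (simp add: J_def)
        then show ?thesis using endo_compose[OF h(1) hE] by (simp add: J_def)
      qed
      show "f \<in> E" using f by (simp add: commutant_endo)
      have CJ: "C \<subseteq> J"
      proof
        fix h assume h: "h \<in> C"
        then have hR: "h \<in> commutant" using CR by blast
        have "trace (compose M g h) \<in> C" if g: "g \<in> E" for g
          using multC[OF trace_commutant[OF g] h] trace_compose[OF g hR] by simp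
        then show "h \<in> J" using commutant_endo[OF hR] by (simp add: J_def)
      qed
      show "f v = 0" if "v \<in> M" "\<And>j. j \<in> J \<Longrightarrow> j v = 0" for v
        using f(2) that CJ by blast
    qed
    moreover have "compose M (a 0) (b 0) \<in> E" by (rule endo_compose[OF a_endo b_endo])
    ultimately have "trace (compose M (compose M (a 0) (b 0)) f) \<in> C" by (simp add: J_def)
    also have "trace (compose M (compose M (a 0) (b 0)) f) = compose M (trace (compose M (a 0) (b 0))) f"
      using f(1) by (intro trace_compose endo_compose a_endo b_endo)
    also have "\<dots> = f"
      using f(1) s_pos
      by (intro extensionalityI[of _ M]) (auto simp: compose_eq trace_a_b endo_mem[OF commutant_endo] endo_ext[OF commutant_endo])
    finally show "f \<in> C" .
  qed
qed

text \<open>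
  The bijection \<open>f \<mapsto> (Tr(a\<^sub>k f))\<^sub>k\<close> has the inverse \<open>(g\<^sub>k)\<^sub>k \<mapsto> \<Sum>\<^sub>k b\<^sub>k g\<^sub>k\<close>. The first dual basis identity gives
  one composition, the second gives the other.
\<close>

lemma card_annihilator_commutant:
  assumes W: "subspace F W V" "\<And>w. w \<in> W \<Longrightarrow> \<gamma> w \<in> W"
  shows "card {f \<in> E. \<forall>w\<in>W. f w = 0} = card {f \<in> commutant. \<forall>w\<in>W. f w = 0} ^ s"
proof -
  let ?A = "{f \<in> E. \<forall>w\<in>W. f w = 0}" and ?R = "{f \<in> commutant. \<forall>w\<in>W. f w = 0}"
  let ?to = "\<lambda>f. \<lambda>k\<in>{..<s}. trace (compose M (a k) f)"
  let ?from = "\<lambda>g. \<lambda>v\<in>M. \<Sum>k<s. compose M (b k) (g k) v"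
  have "bij_betw ?to ?A ({..<s} \<rightarrow>\<^sub>E ?R)"
  proof (rule bij_betw_byWitness[where f' = ?from])
    show "\<forall>f\<in>?A. ?from (?to f) = f"
    proof
      fix f assume f: "f \<in> ?A"
      show "?from (?to f) = f"
        using f sum_b_trace_a[of f] by (intro extensionalityI[of _ M]) (auto simp: compose_def endo_ext)
    qed
    show "\<forall>g\<in>{..<s} \<rightarrow>\<^sub>E ?R. ?to (?from g) = g"
    proof
      fix g assume g: "g \<in> {..<s} \<rightarrow>\<^sub>E ?R"
      then have gR: "g k \<in> commutant" if "k < s" for k using that by (auto simp: PiE_iff)
      have gM: "g k v \<in> M" if "k < s" "v \<in> M" for k v
        using that gR commutant_endo endo_mem by blast
      have fE: "?from g \<in> E"
        by (intro endo_setsum endo_compose b_endo) (use gR commutant_endo in auto)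
      have "trace (compose M (a k) (?from g)) = g k" if k: "k < s" for k
      proof (rule endo_eqI)
        show "trace (compose M (a k) (?from g)) \<in> E" by (intro trace_endo endo_compose a_endo fE)
        show "g k \<in> E" using gR[OF k] commutant_endo by blast
        fix v assume v: "v \<in> M"
        have bg: "b l (g l u) \<in> M" if "l < s" "u \<in> M" for l u using that gM endo_mem[OF b_endo] by blast
        have bd: "b l ((\<delta> ^^ j) (g l v)) \<in> M" if "l < s" for l j
          using gM[OF that v] by (intro endo_mem[OF b_endo] delta_pow_mem)
        have "(\<gamma> ^^ j) (a k (\<Sum>l<s. b l (g l ((\<delta> ^^ j) v)))) =
            (\<Sum>l<s. (\<gamma> ^^ j) (a k (b l ((\<delta> ^^ j) (g l v)))))" for j
        proof -
          have pow_sum: "(\<gamma> ^^ j) (sum h I) = (\<Sum>i\<in>I. (\<gamma> ^^ j) (h i))"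
            if "\<And>i. i \<in> I \<Longrightarrow> h i \<in> M" for h and I :: "nat set"
            using that by (induction j) (auto simp: endo_sum[OF gamma_endo] gamma_pow_mem)
          have "(\<Sum>l<s. b l (g l ((\<delta> ^^ j) v))) = (\<Sum>l<s. b l ((\<delta> ^^ j) (g l v)))"
            using v gR by (intro sum.cong refl) (simp add: commutant_delta_pow)
          also have "a k \<dots> = (\<Sum>l<s. a k (b l ((\<delta> ^^ j) (g l v))))"
            using bd by (intro endo_sum[OF a_endo]) auto
          also have "(\<gamma> ^^ j) \<dots> = (\<Sum>l<s. (\<gamma> ^^ j) (a k (b l ((\<delta> ^^ j) (g l v)))))"
            using bd by (intro pow_sum endo_mem[OF a_endo]) auto
          finally show ?thesis .
        qed
        then have "trace (compose M (a k) (?from g)) v =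
            (\<Sum>j<s. \<Sum>l<s. (\<gamma> ^^ j) (a k (b l ((\<delta> ^^ j) (g l v)))))"
          using v by (simp add: trace_def compose_def delta_pow_mem)
        also have "\<dots> = (\<Sum>l<s. \<Sum>j<s. (\<gamma> ^^ j) (a k (b l ((\<delta> ^^ j) (g l v)))))" by (rule sum.swap)
        also have "\<dots> = (\<Sum>l<s. if k = l then g l v else 0)"
          using k v gM by (intro sum.cong refl dual_right) auto
        also have "\<dots> = g k v" using k by (subst sum.delta') auto
        finally show "trace (compose M (a k) (?from g)) v = g k v" .
      qed
      then show "?to (?from g) = g" using g by (intro extensionalityI[of _ "{..<s}"]) (auto simp: PiE_iff)
    qed
    show "?to ` ?A \<subseteq> {..<s} \<rightarrow>\<^sub>E ?R"
    proof (intro image_subsetI PiE_I)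
      fix f k assume f: "f \<in> ?A" and k: "k \<in> {..<s}"
      have e: "compose M (a k) f \<in> E" using f by (intro endo_compose a_endo) auto
      have z: "compose M (a k) f w = 0" if "w \<in> W" for w
        using f that subspaceD(1)[OF W(1)] endo_zero[OF a_endo] by (auto simp: compose_def)
      show "?to f k \<in> ?R" using trace_commutant[OF e] trace_vanishes[OF e z W] k by simp
    qed auto
    show "?from ` ({..<s} \<rightarrow>\<^sub>E ?R) \<subseteq> ?A"
    proof (intro image_subsetI CollectI conjI ballI)
      fix g assume g: "g \<in> {..<s} \<rightarrow>\<^sub>E ?R"
      show "?from g \<in> E"
        by (intro endo_setsum endo_compose b_endo) (use g commutant_endo in \<open>auto simp: PiE_iff\<close>)
      fix w assume w: "w \<in> W"
      then show "?from g w = 0"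
        using g subspaceD(1)[OF W(1)] by (auto simp: PiE_iff compose_def endo_zero[OF b_endo])
    qed
  qed
  then have "card ?A = card ({..<s} \<rightarrow>\<^sub>E ?R)" by (rule bij_betw_same_card)
  then show ?thesis by (simp add: card_funcsetE)
qed

end

section \<open>The Frobenius and dual bases\<close>

lemma finite_field_power_card: "x ^ CARD('a) = (x::'a::{finite,field})"
proof (cases "x = 0")
  case True
  have "CARD('a) \<noteq> 0" by simp
  with True show ?thesis by (simp only: power_0_left) simp
next
  case False
  let ?U = "UNIV - {0::'a}"
  have "bij_betw (\<lambda>y. x * y) ?U ?U"
    by (rule bij_betw_byWitness[where f' = "\<lambda>y. y / x"]) (use False in auto)
  then have "(\<Prod>y\<in>?U. x * y) = \<Prod>?U"
    by (rule prod.reindex_bij_betw[where g = "\<lambda>y. y"])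
  then have "x ^ card ?U * \<Prod>?U = \<Prod>?U" by (simp add: prod.distrib)
  moreover have "\<Prod>?U \<noteq> 0" by simp
  ultimately have "x ^ card ?U = 1" by simp
  moreover have "CARD('a) = Suc (card ?U)"
    by (rule card_Suc_Diff1[symmetric]) auto
  ultimately show ?thesis by (simp only: power_Suc mult_1_right)
qed

lemma two_le_card_field: "2 \<le> CARD('a::{finite,field})"
proof -
  have "card {0, 1::'a} \<le> CARD('a)" by (rule card_mono) auto
  then show ?thesis by simp
qed

text \<open>
  The polynomial \<open>(X + 1)\<^sup>q - X\<^sup>q - 1\<close> has degree less than \<open>q\<close> and vanishes at all \<open>q\<close> elements of the
  field, because \<open>x\<^sup>q = x\<close> there. So it is zero, and its coefficients are the binomial coefficients.
  This makes the \<open>q\<close>-power map additive without reference to the characteristic.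
\<close>

lemma binomial_card_eq_0:
  assumes "0 < k" "k < CARD('a)"
  shows "of_nat (CARD('a) choose k) = (0::'a::{finite,field})"
proof -
  let ?q = "CARD('a)"
  define f :: "'a poly" where "f = [:1, 1:] ^ ?q - monom 1 ?q - 1"
  have lin: "[:1, 1:] ^ ?q = (\<Sum>k\<le>?q. monom (of_nat (?q choose k)) k :: 'a poly)"
  proof -
    have "[:1, 1:] = (monom 1 1 + 1 :: 'a poly)" by (simp add: monom_altdef one_pCons)
    then have "[:1, 1:] ^ ?q = (\<Sum>k\<le>?q. of_nat (?q choose k) * monom 1 1 ^ k * 1 ^ (?q - k) :: 'a poly)"
      by (simp only: binomial_ring)
    also have "\<dots> = (\<Sum>k\<le>?q. monom (of_nat (?q choose k)) k)"
      by (intro sum.cong refl) (simp add: monom_power of_nat_poly smult_monom)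
    finally show ?thesis .
  qed
  have coeff_lin: "coeff ([:1, 1:] ^ ?q :: 'a poly) k = of_nat (?q choose k)" for k
  proof (cases "k \<le> ?q")
    case True
    then show ?thesis by (simp add: lin coeff_sum)
  next
    case False
    then show ?thesis by (simp add: lin coeff_sum binomial_eq_0)
  qed
  have "f = 0"
  proof (rule ccontr)
    assume f: "f \<noteq> 0"
    have "degree f < ?q"
    proof -
      have "degree f \<le> ?q - 1"
      proof (rule degree_le, intro allI impI)
        fix i assume "?q - 1 < i"
        then have "i = ?q \<or> i > ?q" by linarith
        then show "coeff f i = 0"
          using two_le_card_field[where 'a = 'a]
          by (auto simp: f_def coeff_lin binomial_eq_0 coeff_1 simp flip: One_nat_def)
      qed
      then show ?thesis using two_le_card_field[where 'a = 'a] by linarith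
    qed
    moreover have "{x. poly f x = 0} = UNIV"
      by (auto simp: f_def poly_monom finite_field_power_card)
    ultimately show False using card_poly_roots_bound[OF f] by simp
  qed
  then have "coeff f k = 0" by simp
  then show ?thesis using assms by (simp add: f_def coeff_lin coeff_1)
qed

lemma frob_pow_1_add: "frob_pow 1 (x + y) = frob_pow 1 x + frob_pow 1 (y::'a::{finite,field} alg_closure)"
proof -
  let ?q = "CARD('a)"
  have q: "2 \<le> ?q" by (rule two_le_card_field)
  have z: "of_nat (?q choose k) = (0::'a alg_closure)" if "k \<noteq> 0" "k \<noteq> ?q" "k \<le> ?q" for k
  proof -
    have "to_ac (of_nat (?q choose k) :: 'a) = 0" using that by (subst binomial_card_eq_0) auto
    then show ?thesis by simp
  qed
  have "(x + y) ^ ?q = (\<Sum>k\<le>?q. of_nat (?q choose k) * x ^ k * y ^ (?q - k))"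
    by (rule binomial_ring)
  also have "\<dots> = (\<Sum>k\<in>{0, ?q}. of_nat (?q choose k) * x ^ k * y ^ (?q - k))"
    by (rule sum.mono_neutral_right) (auto simp: z)
  also have "\<dots> = x ^ ?q + y ^ ?q" using q by simp
  finally show ?thesis by (simp add: frob_pow_def)
qed

lemma frob_pow_0 [simp]: "frob_pow 0 x = x"
  by (simp add: frob_pow_def)

lemma frob_pow_comp: "frob_pow i (frob_pow j x) = frob_pow (i + j) x"
  by (simp add: frob_pow_def power_add power_mult[symmetric] mult.commute)

lemma frob_pow_add: "frob_pow i (x + y) = frob_pow i x + frob_pow i y"
proof (induction i)
  case (Suc i)
  then show ?case
    using frob_pow_comp[of 1 i x] frob_pow_comp[of 1 i y] frob_pow_comp[of 1 i "x + y"]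
    by (simp add: frob_pow_1_add[unfolded One_nat_def])
qed simp

lemma frob_pow_zero [simp]: "frob_pow i 0 = (0 :: 'a::{finite,field} alg_closure)"
  by (simp add: frob_pow_def)
lemma frob_pow_one [simp]: "frob_pow i 1 = 1" by (simp add: frob_pow_def)
lemma frob_pow_mult: "frob_pow i (x * y) = frob_pow i x * frob_pow i y"
  by (simp add: frob_pow_def power_mult_distrib)
lemma frob_pow_power: "frob_pow i (x ^ k) = frob_pow i x ^ k"
  by (simp add: frob_pow_def power_mult[symmetric] mult.commute)
lemma frob_pow_minus: "frob_pow i (- x) = - frob_pow i (x :: 'a::{finite,field} alg_closure)"
  using frob_pow_add[of i x "- x"] by (simp add: eq_neg_iff_add_eq_0 add.commute)
lemma frob_pow_diff: "frob_pow i (x - y) = frob_pow i x - frob_pow i (y :: 'a::{finite,field} alg_closure)"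
  using frob_pow_add[of i x "- y"] by (simp add: frob_pow_minus)
lemma frob_pow_sum: "frob_pow i (sum f I) = (\<Sum>k\<in>I. frob_pow i (f k))"
  by (induction I rule: infinite_finite_induct) (auto simp: frob_pow_add)
lemma frob_pow_inverse: "frob_pow i (inverse x) = inverse (frob_pow i x)"
  by (simp add: frob_pow_def power_inverse)
lemma frob_pow_eq_0_iff: "frob_pow i x = 0 \<longleftrightarrow> x = (0 :: 'a::{finite,field} alg_closure)"
  by (simp add: frob_pow_def)
lemma frob_pow_inj: "frob_pow i x = frob_pow i y \<longleftrightarrow> x = (y :: 'a::{finite,field} alg_closure)"
  using frob_pow_eq_0_iff[of i "x - y"] by (simp add: frob_pow_diff)
lemma frob_pow_to_ac [simp]: "frob_pow i (to_ac (x::'a::{finite,field})) = to_ac x"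
proof -
  have "x ^ (CARD('a) ^ i) = x"
    by (induction i) (simp_all add: power_mult finite_field_power_card mult.commute)
  then show ?thesis by (simp add: frob_pow_def flip: to_ac_power)
qed
lemma frob_pow_funpow: "(frob_pow i ^^ j) x = frob_pow (i * j) x"
  by (induction j) (simp_all add: frob_pow_comp add.commute)
lemma frob_pow_fixed_mult: "frob_pow k x = x \<Longrightarrow> frob_pow (k * j) x = x"
  unfolding frob_pow_funpow[symmetric] by (induction j) auto

lemma of_nat_card_eq_0: "k > 0 \<Longrightarrow> of_nat (CARD('a) ^ k) = (0 :: 'a::{finite,field} alg_closure)"
proof -
  assume "k > 0"
  have "of_nat (CARD('a) choose 1) = (0::'a)"
    using two_le_card_field[where 'a = 'a] by (intro binomial_card_eq_0) auto
  then have "to_ac (of_nat CARD('a) :: 'a) = 0" by simp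
  then have "of_nat CARD('a) = (0 :: 'a alg_closure)" by simp
  with \<open>k > 0\<close> show ?thesis by simp
qed

text \<open>
  Split off one root at a time: a root of \<open>f\<close> at which the derivative does not vanish is not a root
  of the remaining factor.
\<close>

lemma card_roots_separable:
  fixes f :: "'b::alg_closed_field poly"
  assumes "f \<noteq> 0" "\<And>x. poly f x = 0 \<Longrightarrow> poly (pderiv f) x \<noteq> 0"
  shows "card {x. poly f x = 0} = degree f"
  using assms
proof (induction "degree f" arbitrary: f)
  case 0
  then obtain c where "f = [:c:]" using degree_eq_zeroE[of f] by metis
  then show ?case using 0 by simp
next
  case (Suc n)
  obtain x where x: "poly f x = 0" using alg_closed_imp_poly_has_root[of f] Suc(2) by auto
  obtain g where g: "f = [:- x, 1:] * g" using x by (auto simp: poly_eq_0_iff_dvd)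
  have g0: "g \<noteq> 0" using g Suc.prems by auto
  have df: "degree f = Suc (degree g)" using g0 unfolding g by (subst degree_mult_eq) auto
  have pd: "pderiv f = g + [:- x, 1:] * pderiv g"
    unfolding g pderiv_mult by (simp add: pderiv_pCons)
  have gx: "poly g x \<noteq> 0" using Suc.prems(2)[OF x] by (simp add: pd)
  have "poly (pderiv g) y \<noteq> 0" if "poly g y = 0" for y
    using Suc.prems(2)[of y] that unfolding pd by (auto simp: g)
  then have "card {y. poly g y = 0} = degree g" using Suc df g0 by auto
  moreover have "{y. poly f y = 0} = insert x {y. poly g y = 0}" by (auto simp: g)
  moreover have "finite {y. poly g y = 0}" using g0 by (rule poly_roots_finite)
  ultimately show ?case using gx df by simp
qed

lemma Fq_fixed_finite: "k > 0 \<Longrightarrow> finite {x :: 'a::{finite,field} alg_closure. frob_pow k x = x}"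
  and card_Fq_fixed: "k > 0 \<Longrightarrow> card {x :: 'a::{finite,field} alg_closure. frob_pow k x = x} = CARD('a) ^ k"
proof -
  assume k: "k > 0"
  let ?Q = "CARD('a) ^ k"
  have Q: "?Q > 1" using two_le_card_field[where 'a = 'a] k by (intro one_less_power) auto
  define f :: "'a alg_closure poly" where "f = monom 1 ?Q - [:0, 1:]"
  have d: "degree f = ?Q"
    unfolding f_def diff_conv_add_uminus
    by (subst degree_add_eq_left) (use Q in \<open>auto simp: degree_monom_eq\<close>)
  have f0: "f \<noteq> 0" using d Q by auto
  have eq: "{x. frob_pow k x = x} = {x. poly f x = 0}"
    by (auto simp: f_def poly_monom frob_pow_def)
  have "pderiv f = - 1"
    unfolding f_def by (simp add: pderiv_diff pderiv_monom of_nat_card_eq_0[OF k] pderiv_pCons one_pCons del: of_nat_power)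
  then have "card {x. poly f x = 0} = ?Q" using card_roots_separable[OF f0] d by simp
  then show "card {x :: 'a alg_closure. frob_pow k x = x} = ?Q" by (simp add: eq)
  show "finite {x :: 'a alg_closure. frob_pow k x = x}" using poly_roots_finite[OF f0] by (simp add: eq)
qed

text \<open>
  The fixed fields of the lower powers of the Frobenius have at most \<open>q + \<dots> + q\<^sup>n\<^sup>-\<^sup>1 < q\<^sup>n\<close> elements
  together.
\<close>

lemma exists_degree_n_element:
  assumes n: "n > 0"
  obtains \<theta> :: "'a::{finite,field} alg_closure"
  where "frob_pow n \<theta> = \<theta>" "\<And>i. 0 < i \<Longrightarrow> i < n \<Longrightarrow> frob_pow i \<theta> \<noteq> \<theta>"
proof -
  let ?S = "\<lambda>k. {x :: 'a alg_closure. frob_pow k x = x}"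
  let ?q = "CARD('a)"
  have "card (\<Union>i\<in>{1..<n}. ?S i) \<le> (\<Sum>i\<in>{1..<n}. card (?S i))" by (rule card_UN_le) auto
  also have "\<dots> = (\<Sum>i\<in>{1..<n}. ?q ^ i)" by (intro sum.cong) (auto simp: card_Fq_fixed)
  also have "\<dots> < ?q ^ n" using n
  proof (induction n)
    case (Suc n)
    show ?case
    proof (cases "n = 0")
      case False
      then have "(\<Sum>i\<in>{1..<Suc n}. ?q ^ i) = (\<Sum>i\<in>{1..<n}. ?q ^ i) + ?q ^ n" by simp
      also have "\<dots> < 2 * ?q ^ n" using Suc.IH False by simp
      also have "\<dots> \<le> ?q ^ Suc n" using two_le_card_field[where 'a = 'a] by simp
      finally show ?thesis .
    qed simp
  qed simp
  also have "\<dots> = card (?S n)" using n by (simp add: card_Fq_fixed)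
  finally have lt: "card (\<Union>i\<in>{1..<n}. ?S i) < card (?S n)" .
  have "finite (\<Union>i\<in>{1..<n}. ?S i)" by (intro finite_UN_I Fq_fixed_finite) auto
  then have "\<not> ?S n \<subseteq> (\<Union>i\<in>{1..<n}. ?S i)" using lt card_mono leD by blast
  then obtain \<theta> where \<theta>: "\<theta> \<in> ?S n" "\<theta> \<notin> (\<Union>i\<in>{1..<n}. ?S i)" by blast
  show thesis by (rule that[of \<theta>]) (use \<theta> in auto)
qed

text \<open>
  Polynomials of degree less than \<open>s\<close> that agree at \<open>s\<close> points have equal coefficients.
\<close>

lemma sum_power_unique:
  fixes c c' x :: "nat \<Rightarrow> 'b::idom"
  assumes inj: "inj_on x {..<s}" and eq: "\<And>i. i < s \<Longrightarrow> (\<Sum>l<s. c l * x i ^ l) = (\<Sum>l<s. c' l * x i ^ l)"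
    and l: "l < s"
  shows "c l = c' l"
proof -
  define f where "f = (\<Sum>l<s. monom (c l - c' l) l)"
  have cf: "coeff f l = (if l < s then c l - c' l else 0)" for l
    by (simp add: f_def coeff_sum)
  have "f = 0"
  proof (rule ccontr)
    assume f: "f \<noteq> 0"
    have "degree f < s"
    proof (rule ccontr)
      assume "\<not> degree f < s"
      then have "lead_coeff f = 0" using cf by simp
      then show False using f by simp
    qed
    moreover have "x ` {..<s} \<subseteq> {z. poly f z = 0}"
      using eq by (auto simp: f_def poly_sum poly_monom left_diff_distrib sum_subtractf)
    then have "card (x ` {..<s}) \<le> card {z. poly f z = 0}"
      by (rule card_mono[OF poly_roots_finite[OF f]])
    then have "s \<le> card {z. poly f z = 0}" using card_image[OF inj] by simp
    ultimately show False using card_poly_roots_bound[OF f] by linarith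
  qed
  then show ?thesis using cf[of l] l by simp
qed

lemma lagrange_coefficients:
  fixes x :: "nat \<Rightarrow> 'b::field"
  assumes inj: "inj_on x {..<s}" and s: "s > 0"
  obtains b where "\<And>i. i < s \<Longrightarrow> (\<Sum>l<s. b l * x i ^ l) = (if i = 0 then 1 else 0)"
proof -
  define f where "f = (\<Prod>j\<in>{1..<s}. smult (inverse (x 0 - x j)) [:- x j, 1:])"
  have "degree f \<le> (\<Sum>j\<in>{1..<s}. degree (smult (inverse (x 0 - x j)) [:- x j, 1:]))"
    unfolding f_def by (rule degree_prod_sum_le[unfolded o_def]) simp
  also have "\<dots> \<le> (\<Sum>j\<in>{1..<s}. 1)" by (intro sum_mono) (simp add: order.trans[OF degree_smult_le])
  finally have d: "degree f < s" using s by simp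
  have "poly f (x i) = (if i = 0 then 1 else 0)" if i: "i < s" for i
  proof (cases "i = 0")
    case True
    have "inverse (x 0 - x j) * (x 0 - x j) = 1" if "j \<in> {1..<s}" for j
    proof -
      have "x 0 \<noteq> x j" using inj_onD[OF inj, of 0 j] s that by auto
      then show ?thesis by simp
    qed
    then show ?thesis using True by (simp add: f_def poly_prod algebra_simps)
  next
    case False
    then have "i \<in> {1..<s}" using i by simp
    then have "(\<Prod>j\<in>{1..<s}. poly (smult (inverse (x 0 - x j)) [:- x j, 1:]) (x i)) = 0"
      by (intro prod_zero) auto
    then show ?thesis using False by (simp add: f_def poly_prod)
  qed
  moreover have "poly f z = (\<Sum>l<s. coeff f l * z ^ l)" for z
    unfolding poly_altdef using d by (intro sum.mono_neutral_left) (auto simp: coeff_eq_0)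
  ultimately show thesis using that[of "coeff f"] by simp
qed

text \<open>
  Let \<open>x\<^sub>j\<close> be the \<open>j\<close>-th conjugate of \<open>\<theta>\<close>, and let \<open>b\<^sub>0, \<dots>, b\<^sub>s\<^sub>-\<^sub>1\<close> be the coefficients of the Lagrange
  polynomial that is \<open>1\<close> at \<open>x\<^sub>0\<close> and \<open>0\<close> at the other \<open>x\<^sub>j\<close>. This is the first identity. Applying the
  automorphism to the coefficients permutes the \<open>x\<^sub>j\<close> cyclically, so the \<open>j\<close>-th conjugates of the
  \<open>b\<^sub>l\<close> are the coefficients of the Lagrange polynomial for \<open>x\<^sub>j\<close>; interpolating \<open>X\<^sup>k\<close> at the \<open>x\<^sub>j\<close>
  by these polynomials and comparing coefficients gives the second identity.
\<close>

lemma frobenius_dual_bases: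
  fixes \<theta> :: "'a::{finite,field} alg_closure"
  assumes s: "s > 0" and n: "frob_pow n \<theta> = \<theta>" and per: "frob_pow (e * s) \<theta> = \<theta>"
    and inj: "inj_on (\<lambda>j. frob_pow (e * j) \<theta>) {..<s}"
  obtains b where "\<And>k. frob_pow n (b k) = b k"
    "\<And>j. j < s \<Longrightarrow> (\<Sum>k<s. b k * frob_pow (e * j) (\<theta> ^ k)) = (if j = 0 then 1 else 0)"
    "\<And>k l. k < s \<Longrightarrow> l < s \<Longrightarrow> (\<Sum>j<s. frob_pow (e * j) (\<theta> ^ k * b l)) = (if k = l then 1 else 0)"
proof -
  define x where "x j = frob_pow (e * j) \<theta>" for j
  have "x = (\<lambda>j. frob_pow (e * j) \<theta>)" by (rule ext) (simp add: x_def)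
  then have inj: "inj_on x {..<s}" using inj by simp
  obtain b0 where b0: "\<And>i. i < s \<Longrightarrow> (\<Sum>l<s. b0 l * x i ^ l) = (if i = 0 then 1 else 0)"
    using lagrange_coefficients[OF inj s] by blast
  \<comment> \<open>outside the range the coefficients are set to \<open>0\<close> so that all of them are fixed by \<open>frob_pow n\<close>\<close>
  define b where "b l = (if l < s then b0 l else 0)" for l
  have b: "(\<Sum>l<s. b l * x i ^ l) = (if i = 0 then 1 else 0)" if "i < s" for i
    using b0[OF that] by (simp add: b_def)
  have xs: "frob_pow j (x i) = x i" if "frob_pow j \<theta> = \<theta>" for i j
  proof -
    have "frob_pow j (x i) = frob_pow (e * i) (frob_pow j \<theta>)"
      by (simp add: x_def frob_pow_comp add.commute)
    then show ?thesis using that by (simp add: x_def)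
  qed
  have fixed: "frob_pow n (b l) = b l" for l
  proof (cases "l < s")
    case True
    show ?thesis
    proof (rule sum_power_unique[OF inj _ True])
      fix i assume i: "i < s"
      have "(\<Sum>l<s. frob_pow n (b l) * x i ^ l) = frob_pow n (\<Sum>l<s. b l * x i ^ l)"
        by (simp add: frob_pow_sum frob_pow_mult frob_pow_power xs[OF n])
      then show "(\<Sum>l<s. frob_pow n (b l) * x i ^ l) = (\<Sum>l<s. b l * x i ^ l)"
        by (simp add: b[OF i])
    qed
  qed (simp add: b_def)
  have conj: "(\<Sum>l<s. frob_pow (e * j) (b l) * x i ^ l) = (if i = j then 1 else 0)" if ij: "i < s" "j < s" for i j
  proof -
    \<comment> \<open>\<open>h\<close> is the residue of \<open>i - j\<close> modulo \<open>s\<close>, so that the \<open>j\<close>-th power of the automorphism takes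
      \<open>x h\<close> to \<open>x i\<close>\<close>
    define h where "h = (if j \<le> i then i - j else i + s - j)"
    have h: "h < s" "h = 0 \<longleftrightarrow> i = j" using ij by (auto simp: h_def)
    have "frob_pow (e * j) (x h) = x i"
    proof (cases "j \<le> i")
      case True
      then show ?thesis by (simp add: x_def frob_pow_comp h_def flip: add_mult_distrib2)
    next
      case False
      then have "frob_pow (e * j) (x h) = frob_pow (e * i + e * s) \<theta>"
        using ij by (simp add: x_def frob_pow_comp h_def flip: add_mult_distrib2)
      then show ?thesis by (simp add: x_def per flip: frob_pow_comp)
    qed
    then have "(\<Sum>l<s. frob_pow (e * j) (b l) * x i ^ l) = frob_pow (e * j) (\<Sum>l<s. b l * x h ^ l)"
      by (simp add: frob_pow_sum frob_pow_mult frob_pow_power)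
    then show ?thesis using b[OF h(1)] h(2) by simp
  qed
  \<comment> \<open>as polynomials in \<open>X\<close>, both sides are \<open>X\<^sup>k\<close>: they agree at each \<open>x i\<close>\<close>
  have right: "(\<Sum>j<s. x j ^ k * frob_pow (e * j) (b l)) = (if k = l then 1 else 0)" if kl: "k < s" "l < s" for k l
  proof (rule sum_power_unique[OF inj _ kl(2)])
    fix i assume i: "i < s"
    have "(\<Sum>l<s. (\<Sum>j<s. x j ^ k * frob_pow (e * j) (b l)) * x i ^ l) =
        (\<Sum>l<s. \<Sum>j<s. x j ^ k * (frob_pow (e * j) (b l) * x i ^ l))"
      by (simp add: sum_distrib_right mult.assoc)
    also have "\<dots> = (\<Sum>j<s. x j ^ k * (\<Sum>l<s. frob_pow (e * j) (b l) * x i ^ l))"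
      by (subst sum.swap) (simp add: sum_distrib_left)
    also have "\<dots> = (\<Sum>j<s. if i = j then x j ^ k else 0)"
      using i by (intro sum.cong refl) (simp add: conj)
    also have "\<dots> = x i ^ k" using i by (subst sum.delta') auto
    also have "\<dots> = (\<Sum>l<s. (if k = l then 1 else 0) * x i ^ l)"
    proof -
      have "(\<Sum>l<s. (if k = l then 1 else 0) * x i ^ l) = (\<Sum>l<s. if k = l then x i ^ l else 0)"
        by (intro sum.cong) auto
      then show ?thesis using kl by simp
    qed
    finally show "(\<Sum>l<s. (\<Sum>j<s. x j ^ k * frob_pow (e * j) (b l)) * x i ^ l) =
        (\<Sum>l<s. (if k = l then 1 else 0) * x i ^ l)" .
  qed
  show thesis
  proof (rule that)
    show "frob_pow n (b k) = b k" for k by (rule fixed)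
    show "(\<Sum>k<s. b k * frob_pow (e * j) (\<theta> ^ k)) = (if j = 0 then 1 else 0)" if "j < s" for j
      using b[OF that] by (simp add: x_def frob_pow_power)
    show "(\<Sum>j<s. frob_pow (e * j) (\<theta> ^ k * b l)) = (if k = l then 1 else 0)" if "k < s" "l < s" for k l
      using right[OF that] by (simp add: x_def frob_pow_power frob_pow_mult)
  qed
qed

text \<open>
  A nonzero combination of \<open>f\<close> and \<open>g\<close> of least degree divides both. It is not an associate of \<open>f\<close>,
  as it divides \<open>g\<close>, so it is a unit.
\<close>

lemma irreducible_bezout:
  fixes f :: "'b::field poly"
  assumes f: "Factorial_Ring.irreducible f" and g: "\<not> f dvd g"
  obtains u v where "u * f + v * g = 1"
proof -
  define I where "I = {u * f + v * g | u v. True}"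
  have "f \<in> I" unfolding I_def by (rule CollectI, rule exI[of _ 1], rule exI[of _ 0]) simp
  moreover have "f \<noteq> 0" using f by auto
  ultimately obtain h where h: "h \<in> I" "h \<noteq> 0" and min: "\<And>k. k \<in> I \<Longrightarrow> k \<noteq> 0 \<Longrightarrow> degree h \<le> degree k"
    using ex_has_least_nat[of "\<lambda>h. h \<in> I \<and> h \<noteq> 0" f degree] by blast
  have dvd: "h dvd k" if k: "k \<in> I" for k
  proof (rule ccontr)
    assume "\<not> h dvd k"
    then have ne: "k mod h \<noteq> 0" by (simp add: dvd_eq_mod_eq_0)
    obtain u v u' v' where uv: "h = u * f + v * g" "k = u' * f + v' * g" using h(1) k by (auto simp: I_def)
    have "k mod h = k - (k div h) * h" by (simp add: minus_div_mult_eq_mod)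
    also have "\<dots> = (u' - k div h * u) * f + (v' - k div h * v) * g"
      unfolding uv by (simp add: algebra_simps)
    finally have "k mod h \<in> I" by (auto simp: I_def)
    then have "degree h \<le> degree (k mod h)" using min ne by blast
    then show False using degree_mod_less[OF h(2), of k] ne by simp
  qed
  have "g \<in> I" unfolding I_def by (rule CollectI, rule exI[of _ 0], rule exI[of _ 1]) simp
  then have "h dvd g" by (rule dvd)
  obtain k where k: "f = h * k" using dvd[OF \<open>f \<in> I\<close>] by (elim dvdE)
  then have "is_unit h \<or> is_unit k" using f by (auto simp: Factorial_Ring.irreducible_def)
  moreover have "\<not> is_unit k"
  proof
    assume "is_unit k"
    then have "f dvd h" unfolding k by (simp add: mult_unit_dvd_iff)
    then show False using \<open>h dvd g\<close> g dvd_trans by blast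
  qed
  ultimately obtain w where w: "1 = h * w" by (auto elim: dvdE)
  obtain u v where "h = u * f + v * g" using h(1) by (auto simp: I_def)
  then have "(w * u) * f + (w * v) * g = 1" using w by (simp add: algebra_simps)
  then show thesis by (rule that)
qed

section \<open>Skew polynomials and their evaluation\<close>

lemma (in abelian_monoid) finsum_triangle:
  assumes "\<And>i j. F i j \<in> carrier G"
  shows "(\<Oplus>k\<in>{..n::nat}. \<Oplus>i\<in>{..k}. F i (k - i)) = (\<Oplus>i\<in>{..n}. \<Oplus>j\<in>{..n - i}. F i j)"
proof (induction n)
  case 0
  then show ?case by (simp add: assms Pi_def)
next
  case (Suc n)
  have "(\<Oplus>i\<in>{..n}. \<Oplus>j\<in>{..Suc n - i}. F i j) = (\<Oplus>i\<in>{..n}. F i (Suc n - i) \<oplus> (\<Oplus>j\<in>{..n - i}. F i j))"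
    by (intro finsum_cong' refl) (auto simp: Suc_diff_le assms Pi_def intro!: finsum_closed)
  also have "\<dots> = (\<Oplus>i\<in>{..n}. F i (Suc n - i)) \<oplus> (\<Oplus>i\<in>{..n}. \<Oplus>j\<in>{..n - i}. F i j)"
    by (intro finsum_addf) (auto simp: assms Pi_def intro!: finsum_closed)
  finally have eq: "(\<Oplus>i\<in>{..n}. \<Oplus>j\<in>{..Suc n - i}. F i j) =
      (\<Oplus>i\<in>{..n}. F i (Suc n - i)) \<oplus> (\<Oplus>i\<in>{..n}. \<Oplus>j\<in>{..n - i}. F i j)" .
  have closed: "(\<Oplus>i\<in>{..n}. F i (Suc n - i)) \<in> carrier G" "(\<Oplus>i\<in>{..n}. \<Oplus>j\<in>{..n - i}. F i j) \<in> carrier G"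
    by (auto simp: assms Pi_def intro!: finsum_closed)
  have "(\<Oplus>k\<in>{..Suc n}. \<Oplus>i\<in>{..k}. F i (k - i)) =
      (F (Suc n) 0 \<oplus> (\<Oplus>i\<in>{..n}. F i (Suc n - i))) \<oplus> (\<Oplus>i\<in>{..n}. \<Oplus>j\<in>{..n - i}. F i j)"
    using Suc.IH by (simp add: assms Pi_def)
  also have "\<dots> = F (Suc n) 0 \<oplus> (\<Oplus>i\<in>{..n}. \<Oplus>j\<in>{..Suc n - i}. F i j)"
    unfolding eq using closed by (simp add: a_assoc assms)
  also have "\<dots> = (\<Oplus>i\<in>{..Suc n}. \<Oplus>j\<in>{..Suc n - i}. F i j)"
    by (simp add: assms Pi_def)
  finally show ?case .
qed

lemma skew_UP_simps [simp]:
  "carrier (skew_UP S \<sigma>) = up S" "\<zero>\<^bsub>skew_UP S \<sigma>\<^esub> = (\<lambda>i. \<zero>\<^bsub>S\<^esub>)"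
  "\<one>\<^bsub>skew_UP S \<sigma>\<^esub> = (\<lambda>i. if i = 0 then \<one>\<^bsub>S\<^esub> else \<zero>\<^bsub>S\<^esub>)"
  "f \<in> up S \<Longrightarrow> g \<in> up S \<Longrightarrow> f \<oplus>\<^bsub>skew_UP S \<sigma>\<^esub> g = (\<lambda>i. f i \<oplus>\<^bsub>S\<^esub> g i)"
  "f \<in> up S \<Longrightarrow> g \<in> up S \<Longrightarrow> f \<otimes>\<^bsub>skew_UP S \<sigma>\<^esub> g =
     (\<lambda>k. \<Oplus>\<^bsub>S\<^esub>i\<in>{..k}. f i \<otimes>\<^bsub>S\<^esub> (\<sigma> ^^ i) (g (k - i)))"
  "x \<in> carrier S \<Longrightarrow> up_ring.monom (skew_UP S \<sigma>) x n = (\<lambda>i. if i = n then x else \<zero>\<^bsub>S\<^esub>)"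
  by (simp_all add: skew_UP_def UP_def)

locale skew_poly_ring = ring S for S (structure) +
  fixes \<sigma>
  assumes sigma: "\<sigma> \<in> ring_hom S S"
begin

lemma sigma_pow: "(\<sigma> ^^ i) \<in> ring_hom S S"
proof (induction i)
  case (Suc i)
  then show ?case using ring_hom_trans[OF Suc sigma] by (simp add: comp_def)
qed (auto simp: ring_hom_def)

lemma sigma_pow_closed [simp]: "x \<in> carrier S \<Longrightarrow> (\<sigma> ^^ i) x \<in> carrier S"
  using sigma_pow[of i] by (rule ring_hom_closed)
lemma sigma_pow_add: "x \<in> carrier S \<Longrightarrow> y \<in> carrier S \<Longrightarrow> (\<sigma> ^^ i) (x \<oplus> y) = (\<sigma> ^^ i) x \<oplus> (\<sigma> ^^ i) y"
  using sigma_pow[of i] by (rule ring_hom_add)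
lemma sigma_pow_mult: "x \<in> carrier S \<Longrightarrow> y \<in> carrier S \<Longrightarrow> (\<sigma> ^^ i) (x \<otimes> y) = (\<sigma> ^^ i) x \<otimes> (\<sigma> ^^ i) y"
  using sigma_pow[of i] by (rule ring_hom_mult)
lemma sigma_pow_one: "(\<sigma> ^^ i) \<one> = \<one>"
  using sigma_pow[of i] by (rule ring_hom_one)
lemma sigma_pow_zero: "(\<sigma> ^^ i) \<zero> = \<zero>"
  using ring_hom_zero[OF sigma_pow[of i]] ring_axioms by blast
lemma sigma_pow_finsum: "finite I \<Longrightarrow> (\<And>k. k \<in> I \<Longrightarrow> f k \<in> carrier S) \<Longrightarrow>
    (\<sigma> ^^ i) (\<Oplus>k\<in>I. f k) = (\<Oplus>k\<in>I. (\<sigma> ^^ i) (f k))"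
proof (induction I rule: finite_induct)
  case empty
  then show ?case by (simp add: sigma_pow_zero)
next
  case (insert k I)
  then show ?case by (simp add: Pi_def sigma_pow_add)
qed

abbreviation P where "P \<equiv> skew_UP S \<sigma>"

lemma up_closed [simp]: "f \<in> up S \<Longrightarrow> f i \<in> carrier S" by auto

lemma skew_mult_closed:
  assumes f: "f \<in> up S" and g: "g \<in> up S"
  shows "(\<lambda>k. \<Oplus>i\<in>{..k}. f i \<otimes> (\<sigma> ^^ i) (g (k - i))) \<in> up S"
proof
  show "(\<Oplus>i\<in>{..k}. f i \<otimes> (\<sigma> ^^ i) (g (k - i))) \<in> carrier S" for k
    using f g by (intro finsum_closed) auto
  obtain a where a: "bound \<zero> a f" using f by auto
  obtain b where b: "bound \<zero> b g" using g by auto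
  have "bound \<zero> (a + b) (\<lambda>k. \<Oplus>i\<in>{..k}. f i \<otimes> (\<sigma> ^^ i) (g (k - i)))"
  proof
    fix k assume k: "a + b < k"
    have "f i \<otimes> (\<sigma> ^^ i) (g (k - i)) = \<zero>" for i
    proof (cases "a < i")
      case True
      then show ?thesis using bound.bound[OF a] g by simp
    next
      case False
      then have "g (k - i) = \<zero>" using k bound.bound[OF b] by simp
      then show ?thesis using f by (simp add: sigma_pow_zero)
    qed
    then show "(\<Oplus>i\<in>{..k}. f i \<otimes> (\<sigma> ^^ i) (g (k - i))) = \<zero>" by simp
  qed
  then show "\<exists>n. bound \<zero> n (\<lambda>k. \<Oplus>i\<in>{..k}. f i \<otimes> (\<sigma> ^^ i) (g (k - i)))" ..
qed

text \<open>
  The additive group is that of the commutative polynomials. Associativity is the usual exchange of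
  a triangular double sum, where the twists match by \<open>\<sigma>\<^sup>i(\<sigma>\<^sup>j x) = \<sigma>\<^sup>i\<^sup>+\<^sup>j x\<close>.
\<close>

lemma ring_skew: "ring P"
proof (rule ringI)
  interpret U: UP_ring S "UP S" by unfold_locales
  have "add_monoid P = add_monoid (UP S)" by (simp add: skew_UP_def)
  moreover have "ring (UP S)" by (rule U.UP_ring)
  then have "comm_group (add_monoid (UP S))" using abelian_group.a_comm_group ring_def by blast
  ultimately show "abelian_group P" by (simp add: abelian_group.intro abelian_group_axioms.intro abelian_monoid.intro comm_group_def)
  show "Group.monoid P"
  proof (rule monoidI)
    show "f \<otimes>\<^bsub>P\<^esub> g \<in> carrier P" if "f \<in> carrier P" "g \<in> carrier P" for f g
      using that skew_mult_closed by simp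
    show "\<one>\<^bsub>P\<^esub> \<in> carrier P" using up_one_closed by simp
    show "\<one>\<^bsub>P\<^esub> \<otimes>\<^bsub>P\<^esub> f = f" if f: "f \<in> carrier P" for f
    proof -
      have "(\<Oplus>i\<in>{..k}. (if i = 0 then \<one> else \<zero>) \<otimes> (\<sigma> ^^ i) (f (k - i))) = f k" for k
      proof -
        have "(\<Oplus>i\<in>{..k}. (if i = 0 then \<one> else \<zero>) \<otimes> (\<sigma> ^^ i) (f (k - i))) =
            (\<Oplus>i\<in>{..k}. if 0 = i then f (k - i) else \<zero>)"
          using f by (intro finsum_cong') auto
        also have "\<dots> = f k" using f by (subst finsum_singleton) auto
        finally show ?thesis .
      qed
      then show ?thesis using f up_one_closed by simp
    qed
    show "f \<otimes>\<^bsub>P\<^esub> \<one>\<^bsub>P\<^esub> = f" if f: "f \<in> carrier P" for f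
    proof -
      have "(\<Oplus>i\<in>{..k}. f i \<otimes> (\<sigma> ^^ i) (if k - i = 0 then \<one> else \<zero>)) = f k" for k
      proof -
        have "(\<Oplus>i\<in>{..k}. f i \<otimes> (\<sigma> ^^ i) (if k - i = 0 then \<one> else \<zero>)) =
            (\<Oplus>i\<in>{..k}. if k = i then f i else \<zero>)"
          using f by (intro finsum_cong') (auto simp: sigma_pow_one sigma_pow_zero)
        also have "\<dots> = f k" using f by (subst finsum_singleton) auto
        finally show ?thesis .
      qed
      then show ?thesis using f up_one_closed by simp
    qed
    show "f \<otimes>\<^bsub>P\<^esub> g \<otimes>\<^bsub>P\<^esub> h = f \<otimes>\<^bsub>P\<^esub> (g \<otimes>\<^bsub>P\<^esub> h)" if "f \<in> carrier P" "g \<in> carrier P" "h \<in> carrier P" for f g h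
    proof -
      have f: "f \<in> up S" and g: "g \<in> up S" and h: "h \<in> up S" using that by auto
      let ?F = "\<lambda>n i j. f i \<otimes> ((\<sigma> ^^ i) (g j) \<otimes> (\<sigma> ^^ (i + j)) (h (n - i - j)))"
      have F: "?F n i j \<in> carrier S" for n i j using f g h by simp
      have "(f \<otimes>\<^bsub>P\<^esub> g \<otimes>\<^bsub>P\<^esub> h) n = (f \<otimes>\<^bsub>P\<^esub> (g \<otimes>\<^bsub>P\<^esub> h)) n" for n
      proof -
        have "(f \<otimes>\<^bsub>P\<^esub> g \<otimes>\<^bsub>P\<^esub> h) n =
            (\<Oplus>k\<in>{..n}. (\<Oplus>i\<in>{..k}. f i \<otimes> (\<sigma> ^^ i) (g (k - i))) \<otimes> (\<sigma> ^^ k) (h (n - k)))"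
          using f g h skew_mult_closed by simp
        also have "\<dots> = (\<Oplus>k\<in>{..n}. \<Oplus>i\<in>{..k}. ?F n i (k - i))"
        proof (intro finsum_cong' refl)
          fix k assume k: "k \<in> {..n}"
          have "(\<Oplus>i\<in>{..k}. f i \<otimes> (\<sigma> ^^ i) (g (k - i))) \<otimes> (\<sigma> ^^ k) (h (n - k)) =
              (\<Oplus>i\<in>{..k}. f i \<otimes> (\<sigma> ^^ i) (g (k - i)) \<otimes> (\<sigma> ^^ k) (h (n - k)))"
            using f g h by (intro finsum_ldistr) auto
          also have "\<dots> = (\<Oplus>i\<in>{..k}. ?F n i (k - i))"
            using f g h by (intro finsum_cong') (auto simp: m_assoc)
          finally show "(\<Oplus>i\<in>{..k}. f i \<otimes> (\<sigma> ^^ i) (g (k - i))) \<otimes> (\<sigma> ^^ k) (h (n - k)) =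
              (\<Oplus>i\<in>{..k}. ?F n i (k - i))" .
        qed (use F in \<open>auto intro!: finsum_closed\<close>)
        also have "\<dots> = (\<Oplus>i\<in>{..n}. \<Oplus>j\<in>{..n - i}. ?F n i j)"
          by (rule finsum_triangle[OF F])
        also have "\<dots> = (\<Oplus>i\<in>{..n}. f i \<otimes> (\<sigma> ^^ i) (\<Oplus>j\<in>{..n - i}. g j \<otimes> (\<sigma> ^^ j) (h (n - i - j))))"
        proof (intro finsum_cong' refl)
          fix i assume i: "i \<in> {..n}"
          have "f i \<otimes> (\<sigma> ^^ i) (\<Oplus>j\<in>{..n - i}. g j \<otimes> (\<sigma> ^^ j) (h (n - i - j))) =
            f i \<otimes> (\<Oplus>j\<in>{..n - i}. (\<sigma> ^^ i) (g j) \<otimes> (\<sigma> ^^ (i + j)) (h (n - i - j)))"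
            using f g h by (subst sigma_pow_finsum) (auto simp: sigma_pow_mult funpow_add)
          also have "\<dots> = (\<Oplus>j\<in>{..n - i}. ?F n i j)"
            using f g h by (intro finsum_rdistr) auto
          finally show "(\<Oplus>j\<in>{..n - i}. ?F n i j) =
              f i \<otimes> (\<sigma> ^^ i) (\<Oplus>j\<in>{..n - i}. g j \<otimes> (\<sigma> ^^ j) (h (n - i - j)))" by simp
        qed (use f g h in \<open>auto intro!: finsum_closed\<close>)
        also have "\<dots> = (f \<otimes>\<^bsub>P\<^esub> (g \<otimes>\<^bsub>P\<^esub> h)) n" using f g h skew_mult_closed by simp
        finally show ?thesis .
      qed
      then show ?thesis by (rule ext)
    qed
  qed
next
  fix f g h assume "f \<in> carrier P" "g \<in> carrier P" "h \<in> carrier P"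
  then have f: "f \<in> up S" and g: "g \<in> up S" and h: "h \<in> up S" by auto
  have "(\<Oplus>i\<in>{..k}. (f i \<oplus> g i) \<otimes> (\<sigma> ^^ i) (h (k - i))) =
      (\<Oplus>i\<in>{..k}. f i \<otimes> (\<sigma> ^^ i) (h (k - i))) \<oplus> (\<Oplus>i\<in>{..k}. g i \<otimes> (\<sigma> ^^ i) (h (k - i)))" for k
    using f g h by (subst finsum_addf[symmetric]) (auto simp: l_distr)
  then show "(f \<oplus>\<^bsub>P\<^esub> g) \<otimes>\<^bsub>P\<^esub> h = f \<otimes>\<^bsub>P\<^esub> h \<oplus>\<^bsub>P\<^esub> g \<otimes>\<^bsub>P\<^esub> h"
    using f g h skew_mult_closed up_add_closed by simp
  have "(\<Oplus>i\<in>{..k}. h i \<otimes> (\<sigma> ^^ i) (f (k - i) \<oplus> g (k - i))) =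
      (\<Oplus>i\<in>{..k}. h i \<otimes> (\<sigma> ^^ i) (f (k - i))) \<oplus> (\<Oplus>i\<in>{..k}. h i \<otimes> (\<sigma> ^^ i) (g (k - i)))" for k
    using f g h by (subst finsum_addf[symmetric]) (auto simp: r_distr sigma_pow_add)
  then show "h \<otimes>\<^bsub>P\<^esub> (f \<oplus>\<^bsub>P\<^esub> g) = h \<otimes>\<^bsub>P\<^esub> f \<oplus>\<^bsub>P\<^esub> h \<otimes>\<^bsub>P\<^esub> g"
    using f g h skew_mult_closed up_add_closed by simp
qed

declare up_closed [simp del]

end

lemma finsum_subring:
  assumes T: "ring T" and A: "subring A T" and "finite I" "\<And>i. i \<in> I \<Longrightarrow> f i \<in> A"
  shows "finsum (T\<lparr>carrier := A\<rparr>) f I = finsum T f I"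
  using assms(3,4)
proof (induction I rule: finite_induct)
  case empty
  interpret T: ring T by fact
  interpret S: ring "T\<lparr>carrier := A\<rparr>" by (rule T.subring_is_ring[OF A])
  show ?case by simp
next
  case (insert i I)
  interpret T: ring T by fact
  interpret S: ring "T\<lparr>carrier := A\<rparr>" by (rule T.subring_is_ring[OF A])
  have "A \<subseteq> carrier T" using subringE(1)[OF A] .
  then show ?case using insert by (simp add: Pi_def subset_iff)
qed

text \<open>
  Evaluation at \<open>y\<close> is compatible with the twisted multiplication exactly because \<open>y\<close> satisfies the
  commutation rule of the variable.
\<close>

locale skew_evaluation = T: ring T for T (structure) +
  fixes A and \<sigma> and y
  assumes A: "subring A T"
    and sigma: "\<sigma> \<in> ring_hom (T\<lparr>carrier := A\<rparr>) (T\<lparr>carrier := A\<rparr>)"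
    and y: "y \<in> carrier T"
    and y_commute: "\<And>x. x \<in> A \<Longrightarrow> y \<otimes> x = \<sigma> x \<otimes> y"
begin

sublocale skew_poly_ring "T\<lparr>carrier := A\<rparr>" \<sigma>
  using T.subring_is_ring[OF A] sigma by (simp add: skew_poly_ring_def skew_poly_ring_axioms_def)

definition ev :: "(nat \<Rightarrow> 'a) \<Rightarrow> 'a" where
  "ev f = (\<Oplus>i\<in>{..deg (T\<lparr>carrier := A\<rparr>) f}. f i \<otimes> y [^] i)"

lemma A_carrier: "x \<in> A \<Longrightarrow> x \<in> carrier T" using subringE(1)[OF A] by blast

lemma up_in: "f \<in> up (T\<lparr>carrier := A\<rparr>) \<Longrightarrow> f i \<in> A" using up_closed[of f i] by simp
lemma up_in_carrier: "f \<in> up (T\<lparr>carrier := A\<rparr>) \<Longrightarrow> f i \<in> carrier T" using up_in A_carrier by blast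

lemma deg_vanish:
  assumes f: "f \<in> up (T\<lparr>carrier := A\<rparr>)" and i: "i > deg (T\<lparr>carrier := A\<rparr>) f"
  shows "f i = \<zero>"
proof -
  interpret U: UP_ring "T\<lparr>carrier := A\<rparr>" "UP (T\<lparr>carrier := A\<rparr>)" by unfold_locales
  have "up_ring.coeff (UP (T\<lparr>carrier := A\<rparr>)) f i = \<zero>\<^bsub>T\<lparr>carrier := A\<rparr>\<^esub>"
    by (rule U.deg_aboveD[OF i]) (simp add: UP_def f)
  then show ?thesis by (simp add: UP_def f)
qed

text \<open>
  Evaluation may sum over any range that covers the degree, which allows two polynomials of different
  degrees to be compared.
\<close>

lemma ev_eq:
  assumes f: "f \<in> up (T\<lparr>carrier := A\<rparr>)" and N: "\<And>i. i > N \<Longrightarrow> f i = \<zero>"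
  shows "ev f = (\<Oplus>i\<in>{..N}. f i \<otimes> y [^] i)"
proof -
  let ?d = "deg (T\<lparr>carrier := A\<rparr>) f"
  have c: "f i \<otimes> y [^] i \<in> carrier T" for i using up_in_carrier[OF f] y by simp
  have "ev f = (\<Oplus>i\<in>{..max N ?d}. f i \<otimes> y [^] i)"
    unfolding ev_def using c deg_vanish[OF f] y
    by (intro T.add.finprod_mono_neutral_cong_left) auto
  moreover have "(\<Oplus>i\<in>{..N}. f i \<otimes> y [^] i) = (\<Oplus>i\<in>{..max N ?d}. f i \<otimes> y [^] i)"
    using c N y by (intro T.add.finprod_mono_neutral_cong_left) auto
  ultimately show ?thesis by simp
qed

lemma ev_closed: "f \<in> up (T\<lparr>carrier := A\<rparr>) \<Longrightarrow> ev f \<in> carrier T"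
  unfolding ev_def using up_in_carrier y by (intro T.finsum_closed) auto

lemma ev_add:
  assumes f: "f \<in> up (T\<lparr>carrier := A\<rparr>)" and g: "g \<in> up (T\<lparr>carrier := A\<rparr>)"
  shows "ev (f \<oplus>\<^bsub>P\<^esub> g) = ev f \<oplus> ev g"
proof -
  let ?N = "max (deg (T\<lparr>carrier := A\<rparr>) f) (deg (T\<lparr>carrier := A\<rparr>) g)"
  have "ev (\<lambda>i. f i \<oplus> g i) = (\<Oplus>i\<in>{..?N}. (f i \<oplus> g i) \<otimes> y [^] i)"
    using up_add_closed[OF f g] deg_vanish[OF f] deg_vanish[OF g] by (intro ev_eq) auto
  also have "\<dots> = (\<Oplus>i\<in>{..?N}. f i \<otimes> y [^] i \<oplus> g i \<otimes> y [^] i)"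
    using up_in_carrier[OF f] up_in_carrier[OF g] y by (intro T.finsum_cong') (auto simp: T.l_distr)
  also have "\<dots> = (\<Oplus>i\<in>{..?N}. f i \<otimes> y [^] i) \<oplus> (\<Oplus>i\<in>{..?N}. g i \<otimes> y [^] i)"
    using up_in_carrier[OF f] up_in_carrier[OF g] y by (intro T.finsum_addf) auto
  also have "\<dots> = ev f \<oplus> ev g"
    using ev_eq[OF f, of ?N] ev_eq[OF g, of ?N] deg_vanish[OF f] deg_vanish[OF g] by simp
  finally show ?thesis using f g by simp
qed

lemma sigma_A: "x \<in> A \<Longrightarrow> \<sigma> x \<in> A" using sigma_pow_closed[of x 1] by simp
lemma sigma_pow_A: "x \<in> A \<Longrightarrow> (\<sigma> ^^ i) x \<in> A" using sigma_pow_closed[of x i] by simp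

lemma y_pow_commute: "x \<in> A \<Longrightarrow> y [^] i \<otimes> x = (\<sigma> ^^ i) x \<otimes> y [^] (i::nat)"
proof (induction i arbitrary: x)
  case (Suc i)
  have "y [^] Suc i \<otimes> x = y [^] i \<otimes> (y \<otimes> x)" using Suc.prems y A_carrier by (simp add: T.m_assoc)
  also have "\<dots> = (y [^] i \<otimes> \<sigma> x) \<otimes> y"
    using Suc.prems y A_carrier sigma_A by (simp add: y_commute T.m_assoc)
  also have "\<dots> = (\<sigma> ^^ i) (\<sigma> x) \<otimes> y [^] i \<otimes> y" using Suc sigma_A by simp
  also have "\<dots> = (\<sigma> ^^ Suc i) x \<otimes> y [^] Suc i"
    using Suc.prems y A_carrier sigma_A sigma_pow_A by (simp add: T.m_assoc funpow_swap1)
  finally show ?case .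
qed (use A_carrier in simp)

lemma ev_mult:
  assumes f: "f \<in> up (T\<lparr>carrier := A\<rparr>)" and g: "g \<in> up (T\<lparr>carrier := A\<rparr>)"
  shows "ev (f \<otimes>\<^bsub>P\<^esub> g) = ev f \<otimes> ev g"
proof -
  let ?S = "T\<lparr>carrier := A\<rparr>"
  let ?a = "deg ?S f" and ?b = "deg ?S g"
  let ?N = "?a + ?b"
  let ?G = "\<lambda>i j. (f i \<otimes> y [^] i) \<otimes> (g j \<otimes> y [^] j)"
  have fA: "f i \<in> A" and gA: "g i \<in> A" for i using up_in[OF f] up_in[OF g] by auto
  have fC: "f i \<in> carrier T" and gC: "g i \<in> carrier T" for i using up_in_carrier[OF f] up_in_carrier[OF g] by auto
  have G: "?G i j \<in> carrier T" for i j using fC gC y by simp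
  have prodA: "f i \<otimes> (\<sigma> ^^ i) (g j) \<in> A" for i j
    using fA gA sigma_pow_A subringE(6)[OF A] by blast
  have summand: "f i \<otimes> (\<sigma> ^^ i) (g j) \<otimes> y [^] (i + j) = ?G i j" for i j
  proof -
    have "f i \<otimes> (\<sigma> ^^ i) (g j) \<otimes> y [^] (i + j) = f i \<otimes> ((\<sigma> ^^ i) (g j) \<otimes> y [^] i) \<otimes> y [^] j"
      using fC A_carrier[OF sigma_pow_A[OF gA]] y by (simp add: T.m_assoc T.nat_pow_mult)
    also have "\<dots> = f i \<otimes> (y [^] i \<otimes> g j) \<otimes> y [^] j" by (simp add: y_pow_commute[OF gA])
    also have "\<dots> = ?G i j" using fC gC y by (simp add: T.m_assoc)
    finally show ?thesis .
  qed
  have co: "(f \<otimes>\<^bsub>P\<^esub> g) k = (\<Oplus>i\<in>{..k}. f i \<otimes> (\<sigma> ^^ i) (g (k - i)))" for k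
    using f g by (simp add: finsum_subring[OF T.ring_axioms A] prodA)
  have fg: "f \<otimes>\<^bsub>P\<^esub> g \<in> up ?S" using f g skew_mult_closed by simp
  have "ev (f \<otimes>\<^bsub>P\<^esub> g) = (\<Oplus>k\<in>{..?N}. (f \<otimes>\<^bsub>P\<^esub> g) k \<otimes> y [^] k)"
  proof (rule ev_eq[OF fg])
    fix k assume k: "?N < k"
    have "f i \<otimes> (\<sigma> ^^ i) (g (k - i)) = \<zero>" for i
    proof (cases "?a < i")
      case True
      then show ?thesis using deg_vanish[OF f] A_carrier[OF sigma_pow_A[OF gA]] by simp
    next
      case False
      then have "g (k - i) = \<zero>" using k by (intro deg_vanish[OF g]) simp
      then show ?thesis using fC sigma_pow_zero by simp
    qed
    then show "(f \<otimes>\<^bsub>P\<^esub> g) k = \<zero>" unfolding co by simp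
  qed
  also have "\<dots> = (\<Oplus>k\<in>{..?N}. \<Oplus>i\<in>{..k}. ?G i (k - i))"
  proof (intro T.finsum_cong' refl)
    fix k
    have "(f \<otimes>\<^bsub>P\<^esub> g) k \<otimes> y [^] k = (\<Oplus>i\<in>{..k}. f i \<otimes> (\<sigma> ^^ i) (g (k - i)) \<otimes> y [^] k)"
      unfolding co using A_carrier[OF prodA] y by (intro T.finsum_ldistr) auto
    also have "\<dots> = (\<Oplus>i\<in>{..k}. ?G i (k - i))"
    proof (intro T.finsum_cong' refl)
      fix i assume "i \<in> {..k}"
      then show "f i \<otimes> (\<sigma> ^^ i) (g (k - i)) \<otimes> y [^] k = ?G i (k - i)" using summand[of i "k - i"] by simp
    qed (use G in auto)
    finally show "(f \<otimes>\<^bsub>P\<^esub> g) k \<otimes> y [^] k = (\<Oplus>i\<in>{..k}. ?G i (k - i))" .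
  qed (use G in \<open>auto intro!: T.finsum_closed\<close>)
  also have "\<dots> = (\<Oplus>i\<in>{..?N}. \<Oplus>j\<in>{..?N - i}. ?G i j)" by (rule T.finsum_triangle[OF G])
  also have "\<dots> = (\<Oplus>i\<in>{..?N}. (f i \<otimes> y [^] i) \<otimes> ev g)"
  proof (intro T.finsum_cong' refl)
    fix i
    show "(\<Oplus>j\<in>{..?N - i}. ?G i j) = (f i \<otimes> y [^] i) \<otimes> ev g"
    proof (cases "?a < i")
      case True
      then have "f i = \<zero>" by (rule deg_vanish[OF f])
      then show ?thesis using gC y ev_closed[OF g] by simp
    next
      case False
      then have "ev g = (\<Oplus>j\<in>{..?N - i}. g j \<otimes> y [^] j)"
        by (intro ev_eq[OF g] deg_vanish[OF g]) simp
      then show ?thesis using fC gC y by (subst T.finsum_rdistr[symmetric]) auto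
    qed
  qed (use fC y ev_closed[OF g] in auto)
  also have "\<dots> = (\<Oplus>i\<in>{..?N}. f i \<otimes> y [^] i) \<otimes> ev g"
    using fC y ev_closed[OF g] by (intro T.finsum_ldistr[symmetric]) auto
  also have "(\<Oplus>i\<in>{..?N}. f i \<otimes> y [^] i) = ev f"
    using deg_vanish[OF f] by (intro ev_eq[OF f, symmetric]) simp
  finally show ?thesis .
qed

lemma ev_genideal:
  assumes f: "f \<in> up (T\<lparr>carrier := A\<rparr>)" "ev f = \<zero>" and h: "h \<in> Idl\<^bsub>P\<^esub> {f}"
  shows "h \<in> up (T\<lparr>carrier := A\<rparr>)" "ev h = \<zero>"
proof -
  interpret P: ring P by (rule ring_skew)
  let ?I = "{h \<in> carrier P. ev h = \<zero>}"
  have ev_add': "ev (a \<oplus>\<^bsub>P\<^esub> b) = ev a \<oplus> ev b" if "a \<in> carrier P" "b \<in> carrier P" for a b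
    using that ev_add by simp
  have ev0: "ev \<zero>\<^bsub>P\<^esub> = \<zero>"
    using ev_add'[OF P.zero_closed P.zero_closed] ev_closed[of "\<zero>\<^bsub>P\<^esub>"] P.zero_closed
    by (simp only: P.l_zero[OF P.zero_closed] skew_UP_simps(1)) (metis T.add.l_cancel_one')
  have "ideal ?I P"
  proof (rule idealI[OF ring_skew])
    show "subgroup ?I (add_monoid P)"
    proof (rule P.add.subgroupI)
      show "?I \<subseteq> carrier P" by auto
      show "?I \<noteq> {}" using ev0 P.zero_closed by blast
      fix a assume a: "a \<in> ?I"
      then have "ev (\<ominus>\<^bsub>P\<^esub> a) = ev a \<oplus> ev (\<ominus>\<^bsub>P\<^esub> a)" using ev_closed[of "\<ominus>\<^bsub>P\<^esub> a"] P.a_inv_closed[of a] by simp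
      also have "\<dots> = ev (a \<oplus>\<^bsub>P\<^esub> \<ominus>\<^bsub>P\<^esub> a)" using a P.a_inv_closed[of a] by (intro ev_add'[symmetric]) auto
      also have "\<dots> = \<zero>" using a ev0 by (simp only: P.r_neg mem_Collect_eq)
      finally show "\<ominus>\<^bsub>P\<^esub> a \<in> ?I" using a P.a_inv_closed[of a] by simp
      fix b assume b: "b \<in> ?I"
      then show "a \<oplus>\<^bsub>P\<^esub> b \<in> ?I" using a P.a_closed[of a b] ev_add'[of a b] by simp
    qed
    fix a x assume a: "a \<in> ?I" and x: "x \<in> carrier P"
    show "x \<otimes>\<^bsub>P\<^esub> a \<in> ?I" using a x P.m_closed[of x a] ev_mult[of x a] ev_closed[of x] by simp
    show "a \<otimes>\<^bsub>P\<^esub> x \<in> ?I" using a x P.m_closed[of a x] ev_mult[of a x] ev_closed[of x] by simp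
  qed
  then have "Idl\<^bsub>P\<^esub> {f} \<subseteq> ?I" using f by (intro P.genideal_minimal) auto
  then show "h \<in> up (T\<lparr>carrier := A\<rparr>)" "ev h = \<zero>" using h by auto
qed

text \<open>
  The two-sided ideal generated by a polynomial with value \<open>0\<close> lies in the kernel of the evaluation,
  so that evaluation is constant on its cosets.
\<close>

lemma ev_coset:
  assumes f: "f \<in> up (T\<lparr>carrier := A\<rparr>)" "ev f = \<zero>" and g: "g \<in> up (T\<lparr>carrier := A\<rparr>)"
  shows "ev ` (Idl\<^bsub>P\<^esub> {f} +>\<^bsub>P\<^esub> g) = {ev g}"
proof -
  interpret P: ring P by (rule ring_skew)
  have "ideal (Idl\<^bsub>P\<^esub> {f}) P" using f by (intro P.genideal_ideal) auto
  then have z: "\<zero>\<^bsub>P\<^esub> \<in> Idl\<^bsub>P\<^esub> {f}" by (rule additive_subgroup.zero_closed[OF ideal.axioms(1)])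
  have "ev (h \<oplus>\<^bsub>P\<^esub> g) = ev g" if "h \<in> Idl\<^bsub>P\<^esub> {f}" for h
    using ev_genideal[OF f that] ev_add[of h g] g ev_closed[OF g] by simp
  moreover have "Idl\<^bsub>P\<^esub> {f} +>\<^bsub>P\<^esub> g = (\<lambda>h. h \<oplus>\<^bsub>P\<^esub> g) ` (Idl\<^bsub>P\<^esub> {f})"
    by (auto simp: a_r_coset_def r_coset_def)
  ultimately have "ev ` (Idl\<^bsub>P\<^esub> {f} +>\<^bsub>P\<^esub> g) = (\<lambda>h. ev g) ` (Idl\<^bsub>P\<^esub> {f})"
    by (simp add: image_image)
  then show ?thesis using z by blast
qed

end

section \<open>Twisted polynomials acting on the algebraic closure\<close>

lemma finsum_ring_of_type: "finite I \<Longrightarrow> finsum (ring_of_type_algebra :: 'b::comm_ring_1 ring) f I = sum f I"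
proof (induction I rule: finite_induct)
  case empty
  interpret R: ring "ring_of_type_algebra :: 'b ring" by (rule ring_from_type_algebra)
  show ?case by (simp add: ring_of_type_algebra_def[symmetric]) (simp add: ring_of_type_algebra_def)
next
  case (insert i I)
  interpret R: ring "ring_of_type_algebra :: 'b ring" by (rule ring_from_type_algebra)
  have "f \<in> I \<rightarrow> carrier ring_of_type_algebra" "f i \<in> carrier ring_of_type_algebra"
    by (auto simp: ring_of_type_algebra_def)
  then have "finsum ring_of_type_algebra f (insert i I) = f i \<oplus>\<^bsub>ring_of_type_algebra\<^esub> finsum ring_of_type_algebra f I"
    using insert by (intro R.finsum_insert) auto
  then show ?case using insert by (simp add: ring_of_type_algebra_def)
qed

lemma ring_of_type_simps:
  "carrier ring_of_type_algebra = UNIV" "\<zero>\<^bsub>ring_of_type_algebra\<^esub> = 0" "\<one>\<^bsub>ring_of_type_algebra\<^esub> = 1"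
  "x \<oplus>\<^bsub>ring_of_type_algebra\<^esub> y = x + y" "x \<otimes>\<^bsub>ring_of_type_algebra\<^esub> y = x * y"
  by (simp_all add: ring_of_type_algebra_def)

lemma Fq_ext_simps [simp]:
  "carrier (Fq_ext k) = {x. frob_pow k x = x}" "\<zero>\<^bsub>Fq_ext k\<^esub> = 0" "\<one>\<^bsub>Fq_ext k\<^esub> = 1"
  "x \<oplus>\<^bsub>Fq_ext k\<^esub> y = x + y" "x \<otimes>\<^bsub>Fq_ext k\<^esub> y = x * y"
  by (simp_all add: Fq_ext_def ring_of_type_simps)

lemma subring_Fq_fixed: "subring {x :: 'a::{finite,field} alg_closure. frob_pow k x = x} ring_of_type_algebra"
proof -
  interpret R: ring "ring_of_type_algebra :: 'a alg_closure ring" by (rule ring_from_type_algebra)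
  have m: "\<ominus>\<^bsub>ring_of_type_algebra\<^esub> x = - x" for x :: "'a alg_closure"
    by (rule R.minus_equality) (auto simp: ring_of_type_simps)
  show ?thesis
    by (rule R.subringI) (auto simp: ring_of_type_simps m frob_pow_minus frob_pow_mult frob_pow_add)
qed

lemma finsum_Fq_ext:
  "finite I \<Longrightarrow> (\<And>i. i \<in> I \<Longrightarrow> frob_pow k (f i) = f i) \<Longrightarrow> finsum (Fq_ext k) f I = sum f I"
  unfolding Fq_ext_def
  by (subst finsum_subring[OF ring_from_type_algebra subring_Fq_fixed]) (auto simp: finsum_ring_of_type)

lemma sum_triangle:
  fixes F :: "nat \<Rightarrow> nat \<Rightarrow> 'b::comm_ring_1"
  shows "(\<Sum>k\<le>n. \<Sum>i\<le>k. F i (k - i)) = (\<Sum>i\<le>n. \<Sum>j\<le>n - i. F i j)"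
proof -
  interpret R: ring "ring_of_type_algebra :: 'b ring" by (rule ring_from_type_algebra)
  show ?thesis using R.finsum_triangle[of F n]
    by (simp add: finsum_ring_of_type ring_of_type_simps)
qed

lemma tau_act_eq:
  assumes "\<And>i. i > N \<Longrightarrow> f i = 0"
  shows "tau_act f v = (\<Sum>i\<le>N. f i * frob_pow i v)"
  unfolding tau_act_def
  by (rule sum.mono_neutral_left) (use assms in \<open>auto simp: not_le[symmetric]\<close>)

lemma up_Fq_bound:
  assumes "f \<in> up (Fq_ext r)" obtains N where "\<And>i. i > N \<Longrightarrow> f i = 0"
  using assms by (auto simp: up_def bound_def)

lemma up_Fq_fixed: "f \<in> up (Fq_ext r) \<Longrightarrow> frob_pow r (f i) = f i"
  by (drule mem_upD[of _ _ i]) simp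

lemma tau_act_add_poly:
  assumes "f \<in> up (Fq_ext r)" "g \<in> up (Fq_ext r)"
  shows "tau_act (f \<oplus>\<^bsub>twisted_polys r\<^esub> g) v = tau_act f v + tau_act g v"
proof -
  obtain a b where a: "\<And>i. i > a \<Longrightarrow> f i = 0" and b: "\<And>i. i > b \<Longrightarrow> g i = 0"
    using up_Fq_bound assms by metis
  show ?thesis
    using assms tau_act_eq[of "max a b" f v] tau_act_eq[of "max a b" g v]
      tau_act_eq[of "max a b" "\<lambda>i. f i + g i" v] a b
    by (simp add: distrib_right sum.distrib)
qed

text \<open>
  \<open>\<tau>\<^sup>i\<close> acts additively and takes the coefficient \<open>c\<close> in \<open>c \<tau>\<^sup>j\<close> to \<open>c\<^sup>[\<^sup>i\<^sup>]\<close>, which is the commutation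
  rule of the twisted polynomials.
\<close>

lemma tau_act_mult_poly:
  assumes f: "f \<in> up (Fq_ext r)" and g: "g \<in> up (Fq_ext r)"
  shows "tau_act (f \<otimes>\<^bsub>twisted_polys r\<^esub> g) v = tau_act f (tau_act g v)"
proof -
  obtain a b where a: "\<And>i. i > a \<Longrightarrow> f i = 0" and b: "\<And>i. i > b \<Longrightarrow> g i = 0"
    using up_Fq_bound f g by metis
  have fr: "(frob_pow 1 ^^ i) x = frob_pow i x" for i and x :: "'a alg_closure"
    by (simp only: frob_pow_funpow mult_1)
  let ?h = "\<lambda>k. \<Sum>i\<le>k. f i * frob_pow i (g (k - i))"
  have fixed: "frob_pow r (f i * frob_pow i (g j)) = f i * frob_pow i (g j)" for i j
  proof -
    have "frob_pow r (frob_pow i (g j)) = frob_pow i (frob_pow r (g j))"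
      by (simp add: frob_pow_comp add.commute)
    then show ?thesis by (simp add: frob_pow_mult up_Fq_fixed[OF f] up_Fq_fixed[OF g])
  qed
  have eq: "f \<otimes>\<^bsub>twisted_polys r\<^esub> g = ?h"
    using f g by (simp add: fr finsum_Fq_ext fixed del: One_nat_def)
  have z: "f i * frob_pow i (g j) = 0" if "i + j > a + b" for i j
  proof (cases "i > a")
    case False
    then have "j > b" using that by linarith
    then show ?thesis by (simp add: b)
  qed (simp add: a)
  let ?G = "\<lambda>i j. f i * frob_pow i (g j) * frob_pow (i + j) v"
  have "tau_act ?h v = (\<Sum>k\<le>a + b. ?h k * frob_pow k v)"
    by (rule tau_act_eq) (auto intro!: sum.neutral simp: z)
  also have "\<dots> = (\<Sum>k\<le>a + b. \<Sum>i\<le>k. ?G i (k - i))"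
    by (intro sum.cong refl) (simp add: sum_distrib_right)
  also have "\<dots> = (\<Sum>i\<le>a + b. \<Sum>j\<le>a + b - i. ?G i j)" by (rule sum_triangle)
  also have "\<dots> = (\<Sum>i\<le>a + b. f i * frob_pow i (tau_act g v))"
  proof (intro sum.cong refl)
    fix i assume "i \<in> {..a + b}"
    show "(\<Sum>j\<le>a + b - i. ?G i j) = f i * frob_pow i (tau_act g v)"
    proof (cases "i > a")
      case False
      then have "tau_act g v = (\<Sum>j\<le>a + b - i. g j * frob_pow j v)" by (intro tau_act_eq b) simp
      then show ?thesis
        by (simp add: frob_pow_sum frob_pow_mult frob_pow_comp sum_distrib_left mult.assoc)
    qed (simp add: a)
  qed
  also have "\<dots> = tau_act f (tau_act g v)" by (rule tau_act_eq[symmetric]) (simp add: a)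
  finally show ?thesis by (simp only: eq)
qed

lemma tau_act_add: "tau_act f (u + v) = tau_act f u + tau_act f v"
  by (simp add: tau_act_def frob_pow_add distrib_left sum.distrib)

lemma monom_twisted:
  assumes "frob_pow r x = x"
  shows "up_ring.monom (twisted_polys r) x i \<in> up (Fq_ext r)"
    and "tau_act (up_ring.monom (twisted_polys r) x i) v = x * frob_pow i v"
proof -
  have eq: "up_ring.monom (twisted_polys r) x i = (\<lambda>j. if j = i then x else 0)" using assms by (intro ext) simp
  show "up_ring.monom (twisted_polys r) x i \<in> up (Fq_ext r)"
    unfolding eq using assms by (auto simp: up_def bound_def intro!: exI[of _ i])
  show "tau_act (up_ring.monom (twisted_polys r) x i) v = x * frob_pow i v"
    unfolding eq by (subst tau_act_eq[of i]) (auto simp: if_distrib[of "\<lambda>z. z * _"] cong: if_cong)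
qed

abbreviation ac_eval :: "'a::field poly \<Rightarrow> 'a alg_closure \<Rightarrow> 'a alg_closure" where
  "ac_eval a x \<equiv> poly (map_poly to_ac a) x"

lemma map_poly_to_ac_pCons: "map_poly to_ac (pCons c a) = pCons (to_ac c) (map_poly to_ac a)"
  by (rule poly_eqI) (simp add: coeff_map_poly coeff_pCons split: nat.split)

lemma ac_eval_add: "ac_eval (a + b) x = ac_eval a x + ac_eval b x"
proof -
  have "map_poly to_ac (a + b) = map_poly to_ac a + map_poly to_ac b"
    by (rule poly_eqI) (simp add: coeff_map_poly)
  then show ?thesis by simp
qed

lemma ac_eval_smult: "ac_eval (smult c a) x = to_ac c * ac_eval a x"
proof -
  have "map_poly to_ac (smult c a) = smult (to_ac c) (map_poly to_ac a)"
    by (rule poly_eqI) (simp add: coeff_map_poly)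
  then show ?thesis by simp
qed

lemma ac_eval_mult: "ac_eval (a * b) x = ac_eval a x * ac_eval b x"
proof (induction a rule: pCons_induct)
  case (pCons c a)
  then show ?case
    by (simp add: ac_eval_add ac_eval_smult map_poly_to_ac_pCons mult_pCons_left algebra_simps)
qed simp

lemma ac_eval_uminus: "ac_eval (- a) x = - ac_eval a x"
  using ac_eval_smult[of "-1" a x] by simp

lemma ac_eval_frob: "ac_eval a (frob_pow k x) = frob_pow k (ac_eval a (x :: 'a::{finite,field} alg_closure))"
  by (induction a rule: pCons_induct) (simp_all add: map_poly_to_ac_pCons frob_pow_add frob_pow_mult)

lemma frob_pow_gcd:
  assumes "frob_pow i x = x" "frob_pow j x = (x :: 'a::{finite,field} alg_closure)" "i \<noteq> 0"
  shows "frob_pow (gcd i j) x = x"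
proof -
  obtain u w where uw: "i * u = j * w + gcd i j" using bezout_nat[OF assms(3), of j] by blast
  have "x = frob_pow (j * w + gcd i j) x" using frob_pow_fixed_mult[OF assms(1), of u] uw by simp
  also have "\<dots> = frob_pow (gcd i j) (frob_pow (j * w) x)" by (simp add: frob_pow_comp add.commute)
  also have "\<dots> = frob_pow (gcd i j) x" by (simp add: frob_pow_fixed_mult[OF assms(2)])
  finally show ?thesis by simp
qed

lemma card_poly_degree_less:
  assumes "k > 0"
  shows "card {a :: 'a::{finite,field} poly. degree a < k} = CARD('a) ^ k"
proof -
  have "bij_betw (\<lambda>a. \<lambda>i\<in>{..<k}. coeff a i) {a :: 'a poly. degree a < k} ({..<k} \<rightarrow>\<^sub>E UNIV)"
  proof (rule bij_betw_byWitness[where f' = "\<lambda>c. \<Sum>i<k. monom (c i) i"])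
    show "\<forall>a\<in>{a :: 'a poly. degree a < k}. (\<Sum>i<k. monom ((\<lambda>i\<in>{..<k}. coeff a i) i) i) = a"
    proof
      fix a :: "'a poly" assume a: "a \<in> {a. degree a < k}"
      show "(\<Sum>i<k. monom ((\<lambda>i\<in>{..<k}. coeff a i) i) i) = a"
      proof (rule poly_eqI)
        fix j
        have "coeff (\<Sum>i<k. monom ((\<lambda>i\<in>{..<k}. coeff a i) i) i) j = (\<Sum>i<k. if i = j then coeff a i else 0)"
          unfolding coeff_sum by (intro sum.cong) auto
        also have "\<dots> = coeff a j" using a by (auto simp: coeff_eq_0)
        finally show "coeff (\<Sum>i<k. monom ((\<lambda>i\<in>{..<k}. coeff a i) i) i) j = coeff a j" .
      qed
    qed
    show "\<forall>c\<in>{..<k} \<rightarrow>\<^sub>E UNIV. (\<lambda>i\<in>{..<k}. coeff (\<Sum>i<k. monom (c i :: 'a) i) i) = c"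
    proof
      fix c assume c: "c \<in> {..<k} \<rightarrow>\<^sub>E (UNIV :: 'a set)"
      show "(\<lambda>i\<in>{..<k}. coeff (\<Sum>i<k. monom (c i :: 'a) i) i) = c"
      proof (rule extensionalityI[of _ "{..<k}"])
        fix j assume j: "j \<in> {..<k}"
        have "coeff (\<Sum>i<k. monom (c i) i) j = (\<Sum>i<k. if i = j then c i else 0)"
          unfolding coeff_sum by (intro sum.cong) auto
        then show "(\<lambda>i\<in>{..<k}. coeff (\<Sum>i<k. monom (c i :: 'a) i) i) j = c j" using j by simp
      qed (use c in \<open>auto simp: PiE_iff\<close>)
    qed
    show "(\<lambda>a. \<lambda>i\<in>{..<k}. coeff a i) ` {a :: 'a poly. degree a < k} \<subseteq> {..<k} \<rightarrow>\<^sub>E UNIV"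
      by (intro image_subsetI PiE_I) simp_all
    show "(\<lambda>c. \<Sum>i<k. monom (c i) i) ` ({..<k} \<rightarrow>\<^sub>E UNIV) \<subseteq> {a :: 'a poly. degree a < k}"
    proof clarify
      fix c :: "nat \<Rightarrow> 'a"
      have "degree (\<Sum>i<k. monom (c i) i) \<le> k - 1"
        by (rule degree_sum_le) (auto intro: order.trans[OF degree_monom_le])
      then show "degree (\<Sum>i<k. monom (c i) i) < k" using assms by linarith
    qed
  qed
  then have "card {a :: 'a poly. degree a < k} = card ({..<k} \<rightarrow>\<^sub>E (UNIV :: 'a set))"
    by (rule bij_betw_same_card)
  then show ?thesis by (simp add: card_funcsetE)
qed

locale drinfeld_torsion =
  fixes p0 p :: "'a::{finite,field} poly"
    and t :: "'a alg_closure"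
    and \<phi> :: "'a poly \<Rightarrow> (nat \<Rightarrow> 'a alg_closure)"
    and n r d m :: nat
  assumes n_pos: "n \<ge> 1"
    and p0_monic: "Polynomial.lead_coeff p0 = 1" and p0_irred: "Factorial_Ring.irreducible p0"
    and p0_deg: "Polynomial.degree p0 = r"
    and n_r: "coprime n r"
    and t_mem: "t \<in> carrier (Fq_ext r)" and p0_t: "poly (map_poly to_ac p0) t = 0"
    and drinfeld: "drinfeld_module r n t \<phi>"
    and p_monic: "Polynomial.lead_coeff p = 1" and p_irred: "Factorial_Ring.irreducible p"
    and p_deg: "Polynomial.degree p = d"
    and p_p0: "p \<noteq> p0"
    and m_n: "m dvd n"
begin

definition act :: "'a poly \<Rightarrow> 'a alg_closure \<Rightarrow> 'a alg_closure" where
  "act a v = tau_act (\<phi> a) v"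

definition act_T :: "'a alg_closure \<Rightarrow> 'a alg_closure" where
  "act_T v = t * v + frob_pow n v"

lemma irred_degree_pos: "Factorial_Ring.irreducible f \<Longrightarrow> 0 < degree f" for f :: "'a poly"
  by (rule ccontr) (auto simp: Factorial_Ring.irreducible_def is_unit_iff_degree)

lemma r_pos: "r > 0" using irred_degree_pos[OF p0_irred] p0_deg by simp
lemma d_pos: "d > 0" using irred_degree_pos[OF p_irred] p_deg by simp
lemma m_pos: "m > 0" using m_n n_pos by (auto intro: Nat.gr0I)
lemma t_fixed: "frob_pow r t = t" using t_mem by simp

lemma phi_up: "\<phi> a \<in> up (Fq_ext r)"
  using drinfeld by (auto simp: drinfeld_module_def ring_hom_def ring_of_type_simps)

lemma act_add_poly: "act (a + b) v = act a v + act b v"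
proof -
  have "\<phi> (a + b) = \<phi> a \<oplus>\<^bsub>twisted_polys r\<^esub> \<phi> b"
    using drinfeld by (auto simp: drinfeld_module_def ring_hom_def ring_of_type_simps)
  then show ?thesis by (simp only: act_def tau_act_add_poly[OF phi_up phi_up])
qed

lemma act_mult_poly: "act (a * b) v = act a (act b v)"
proof -
  have "\<phi> (a * b) = \<phi> a \<otimes>\<^bsub>twisted_polys r\<^esub> \<phi> b"
    using drinfeld by (auto simp: drinfeld_module_def ring_hom_def ring_of_type_simps)
  then show ?thesis by (simp only: act_def tau_act_mult_poly[OF phi_up phi_up])
qed

lemma act_const: "act [:c:] v = to_ac c * v"
proof -
  have "\<phi> [:c:] = up_ring.monom (twisted_polys r) (to_ac c) 0"
    using drinfeld by (simp add: drinfeld_module_def)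
  then show ?thesis by (simp only: act_def monom_twisted(2)[OF frob_pow_to_ac] frob_pow_0)
qed

lemma act_variable: "act [:0, 1:] v = act_T v"
proof -
  have "\<phi> [:0, 1:] = up_ring.monom (twisted_polys r) t 0 \<oplus>\<^bsub>twisted_polys r\<^esub>
                  up_ring.monom (twisted_polys r) 1 n"
    using drinfeld by (simp add: drinfeld_module_def)
  then show ?thesis
    by (simp only: act_def act_T_def tau_act_add_poly[OF monom_twisted(1)[OF t_fixed] monom_twisted(1)[OF frob_pow_one]]
        monom_twisted(2)[OF t_fixed] monom_twisted(2)[OF frob_pow_one] frob_pow_0 mult_1)
qed

lemma act_add: "act a (u + v) = act a u + act a v" by (simp add: act_def tau_act_add)
lemma act_zero [simp]: "act a 0 = 0" using act_add[of a 0 0] by (metis add.right_neutral add_left_cancel)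
lemma act_minus: "act a (- v) = - act a v"
  using act_add[of a v "- v"] by (simp add: eq_neg_iff_add_eq_0 add.commute)
lemma act_poly_0 [simp]: "act 0 v = 0" using act_add_poly[of 0 0 v] by (metis add.right_neutral add_left_cancel)
lemma act_one [simp]: "act 1 v = v" using act_const[of 1 v] by (simp add: one_pCons)
lemma act_minus_poly: "act (- a) v = - act a v"
  using act_add_poly[of a "- a" v] by (simp add: eq_neg_iff_add_eq_0 add.commute)
lemma act_diff_poly: "act (a - b) v = act a v - act b v"
  using act_add_poly[of a "- b" v] by (simp add: act_minus_poly)
lemma act_sum: "act a (sum f I) = (\<Sum>i\<in>I. act a (f i))"
  by (induction I rule: infinite_finite_induct) (auto simp: act_add)

lemma pCons_split: "pCons c a = [:c:] + [:0, 1:] * a" for c :: 'a by simp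

lemma act_pCons: "act (pCons c a) v = to_ac c * v + act_T (act a v)"
  unfolding pCons_split[of c a] act_add_poly act_mult_poly act_const act_variable ..

lemma act_pCons': "act (pCons c a) v = to_ac c * v + act a (act_T v)"
  unfolding pCons_split[of c a] mult.commute[of _ a] act_add_poly act_mult_poly act_const act_variable ..

lemma act_scalar: "frob_pow n \<zeta> = \<zeta> \<Longrightarrow> act a (\<zeta> * v) = \<zeta> * act a v"
  by (induction a rule: pCons_induct) (simp_all add: act_pCons act_T_def frob_pow_mult algebra_simps)

lemma act_frob: "act a (frob_pow (r * j) v) = frob_pow (r * j) (act a v)"
  by (induction a rule: pCons_induct)
    (simp_all add: act_pCons act_T_def frob_pow_mult frob_pow_add frob_pow_comp add.commute
      frob_pow_fixed_mult[OF t_fixed])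

text \<open>
  In \<open>\<phi>\<^sub>a = \<Sum> c\<^sub>i \<tau>\<^sup>i\<close> only \<open>c\<^sub>0 = a(t)\<close> contributes to the derivative, since the other terms are
  multiples of \<open>q\<close>-th powers of the variable. The leading term comes from the factor \<open>\<tau>\<^sup>n\<close> of each
  \<open>T\<close>. Hence \<open>\<phi>\<^sub>a\<close> is separable as soon as \<open>a(t) \<noteq> 0\<close>.
\<close>

lemma act_polynomial:
  "\<exists>P. (\<forall>v. poly P v = act a v) \<and> pderiv P = [:ac_eval a t:] \<and>
    (if a = 0 then P = 0 else degree P = CARD('a) ^ (n * degree a))"
proof (induction a rule: pCons_induct)
  case 0
  show ?case by (rule exI[of _ 0]) simp
next
  case (pCons c a)
  then obtain P where P: "\<And>v. poly P v = act a v" "pderiv P = [:ac_eval a t:]"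
    "if a = 0 then P = 0 else degree P = CARD('a) ^ (n * degree a)" by blast
  let ?q = "CARD('a)"
  let ?Q = "?q ^ n"
  have q: "2 \<le> ?q" by (rule two_le_card_field)
  have Q: "1 < ?Q" using n_pos q by (intro one_less_power) auto
  define P' where "P' = [:0, to_ac c:] + (smult t P + P ^ ?Q)"
  have pv: "poly P' v = act (pCons c a) v" for v
    by (simp add: P'_def act_pCons act_T_def P(1) frob_pow_def mult.commute)
  have "pderiv (P ^ ?Q) = 0"
    using n_pos by (simp add: pderiv_power of_nat_card_eq_0 del: of_nat_power)
  then have pd: "pderiv P' = [:ac_eval (pCons c a) t:]"
    by (simp add: P'_def pderiv_add pderiv_smult P(2) pderiv_pCons map_poly_to_ac_pCons)
  have "degree P' = ?q ^ (n * degree (pCons c a))"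
  proof (cases "a = 0")
    case True
    then have "P = 0" "c \<noteq> 0" using P(3) pCons.hyps by auto
    then show ?thesis using True Q by (simp add: P'_def power_0_left)
  next
    case False
    then have dP: "degree P = ?q ^ (n * degree a)" using P(3) by simp
    then have dP1: "1 \<le> degree P" using q by simp
    have dQ: "degree (P ^ ?Q) = ?Q * degree P" using dP1 by (intro degree_power_eq) auto
    have lt: "degree P < ?Q * degree P" using Q dP1 by simp
    have "degree ([:0, to_ac c:] + smult t P) < ?Q * degree P"
    proof -
      have "degree [:0, to_ac c:] \<le> 1" by simp
      then show ?thesis using lt dP1 degree_smult_le[of t P]
        by (intro le_less_trans[OF degree_add_le[of _ "degree P"]]) auto
    qed
    then have "degree P' = degree (P ^ ?Q)"
      unfolding P'_def add.assoc[symmetric] by (intro degree_add_eq_right) (simp add: dQ)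
    then show ?thesis using False by (simp add: dQ dP power_add[symmetric] mult.commute)
  qed
  moreover have "pCons c a \<noteq> 0" using pCons.hyps by auto
  ultimately show ?case using pv pd by (intro exI[of _ P']) auto
qed

lemma not_p_dvd_p0: "\<not> p dvd p0"
proof
  assume "p dvd p0"
  then obtain k where k: "p0 = p * k" by (elim dvdE)
  then have "p dvd 1 \<or> k dvd 1" using p0_irred unfolding Factorial_Ring.irreducible_def by blast
  moreover have "\<not> p dvd 1" using p_irred by (simp add: Factorial_Ring.irreducible_def)
  ultimately obtain c where c: "k = [:c:]" by (auto simp: is_unit_poly_iff)
  have "lead_coeff p0 = lead_coeff p * c" unfolding k c by simp
  then have "c = 1" using p0_monic p_monic by simp
  then show False using k c p_p0 by simp
qed

lemma p_p0_bezout: obtains u w where "u * p + w * p0 = 1"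
  using irreducible_bezout[OF p_irred not_p_dvd_p0] by blast

lemma p_t: "ac_eval p t \<noteq> 0"
proof
  assume z: "ac_eval p t = 0"
  obtain u w where "u * p + w * p0 = 1" by (rule p_p0_bezout)
  then have "ac_eval (u * p + w * p0) t = 1" by simp
  then show False using z p0_t by (simp add: ac_eval_add ac_eval_mult)
qed

lemma torsion_eq: "torsion \<phi> p = {v. act p v = 0}" by (simp add: torsion_def act_def)

lemma card_torsion: "card (torsion \<phi> p) = CARD('a) ^ (n * d)"
  and finite_torsion: "finite (torsion \<phi> p)"
proof -
  have "p \<noteq> 0" using p_irred by auto
  then obtain P where P: "\<And>v. poly P v = act p v" "pderiv P = [:ac_eval p t:]"
      "degree P = CARD('a) ^ (n * degree p)"
    using act_polynomial[of p] by auto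
  have P0: "P \<noteq> 0" using P(2) p_t by auto
  have eq: "torsion \<phi> p = {v. poly P v = 0}" by (simp add: torsion_eq P(1))
  show "finite (torsion \<phi> p)" unfolding eq by (rule poly_roots_finite[OF P0])
  show "card (torsion \<phi> p) = CARD('a) ^ (n * d)"
    unfolding eq using card_roots_separable[OF P0] P(2,3) p_t p_deg by simp
qed

lemma ac_eval_t_eq_0:
  assumes "degree a < r" "ac_eval a t = 0"
  shows "a = 0"
proof (rule ccontr)
  assume "a \<noteq> 0"
  then have "\<not> p0 dvd a" using assms p0_deg dvd_imp_degree_le[of p0 a] by auto
  then obtain u v where "u * p0 + v * a = 1" using irreducible_bezout[OF p0_irred] by blast
  then have "ac_eval (u * p0 + v * a) t = 1" by simp
  then show False using assms p0_t by (simp add: ac_eval_add ac_eval_mult)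
qed

text \<open>
  If \<open>t\<close> were fixed by a smaller power of the Frobenius, so would be the \<open>q\<^sup>r\<close> values at \<open>t\<close> of
  polynomials of degree less than \<open>r\<close>. These are distinct, and there are too many of them.
\<close>

lemma frob_t_neq:
  assumes "0 < k" "k < r"
  shows "frob_pow k t \<noteq> t"
proof
  assume k: "frob_pow k t = t"
  let ?A = "{a :: 'a poly. degree a < r}"
  have "inj_on (\<lambda>a. ac_eval a t) ?A"
  proof (rule inj_onI)
    fix a b assume ab: "a \<in> ?A" "b \<in> ?A" "ac_eval a t = ac_eval b t"
    have "degree (a - b) < r" using ab by (auto intro: degree_diff_less)
    moreover have "ac_eval (a - b) t = 0"
      using ab(3) ac_eval_add[of a "- b" t] by (simp add: ac_eval_uminus)
    ultimately show "a = b" using ac_eval_t_eq_0 by fastforce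
  qed
  then have "card ?A \<le> card {x :: 'a alg_closure. frob_pow k x = x}"
    using assms by (intro card_inj_on_le[OF _ _ Fq_fixed_finite]) (auto simp: k ac_eval_frob[symmetric])
  then have "CARD('a) ^ r \<le> CARD('a) ^ k"
    using assms by (simp add: card_poly_degree_less card_Fq_fixed)
  then show False using assms two_le_card_field[where 'a = 'a] by simp
qed

text \<open>
  As \<open>n\<close> is prime to the degree \<open>r\<close> of \<open>t\<close>, the \<open>n\<close>-th power of the Frobenius generates the Galois
  group of \<open>t\<close> and runs through all its conjugates.
\<close>

lemma inj_frob_t: "inj_on (\<lambda>j. frob_pow (n * j) t) {..<r}"
proof -
  have ne: "frob_pow (n * i) t \<noteq> frob_pow (n * j) t" if ij: "i < j" "j < r" for i j
  proof
    assume eq: "frob_pow (n * i) t = frob_pow (n * j) t"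
    have "frob_pow (n * j) t = frob_pow (n * i) (frob_pow (n * (j - i)) t)"
      using ij by (simp add: frob_pow_comp flip: add_mult_distrib2)
    then have "frob_pow (n * (j - i)) t = t" using eq by (simp add: frob_pow_inj)
    then have g: "frob_pow (gcd (n * (j - i)) r) t = t"
      using ij n_pos by (intro frob_pow_gcd t_fixed) auto
    have "gcd (n * (j - i)) r = gcd (j - i) r" using n_r by (simp add: gcd_mult_left_left_cancel coprime_commute)
    moreover have "gcd (j - i) r \<le> j - i" using ij by (intro gcd_le1_nat) simp
    then have "gcd (j - i) r < r" using ij by linarith
    ultimately show False using frob_t_neq[of "gcd (j - i) r"] g ij r_pos by auto
  qed
  show ?thesis by (rule inj_onI) (metis lessThan_iff linorder_neqE_nat ne)
qed

text \<open>
  \<open>\<Sum> c\<^sub>i X\<^sup>i\<close> acts as \<open>v \<mapsto> \<Sum> c\<^sub>i \<phi>\<^sub>T\<^sup>i v\<close>, with the coefficients to the left of the powers of the operator.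
  This is not multiplicative, as the operator does not commute with multiplication by \<open>c\<^sub>i\<close>, but it
  extends the action of \<open>A\<close> to polynomials over the algebraic closure.
\<close>

definition left_eval :: "'a alg_closure poly \<Rightarrow> 'a alg_closure \<Rightarrow> 'a alg_closure" where
  "left_eval P = fold_coeffs (\<lambda>c f v. c * v + f (act_T v)) P (\<lambda>_. 0)"

lemma left_eval_0 [simp]: "left_eval 0 v = 0" by (simp add: left_eval_def)

lemma left_eval_pCons: "left_eval (pCons c P) v = c * v + left_eval P (act_T v)"
  by (cases "c = 0 \<and> P = 0") (auto simp: left_eval_def)

lemma left_eval_smult: "left_eval (smult c P) v = c * left_eval P v"
  by (induction P arbitrary: v rule: pCons_induct) (simp_all add: left_eval_pCons algebra_simps)

lemma left_eval_add: "left_eval (P + Q) v = left_eval P v + left_eval Q v"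
proof (induction P arbitrary: Q v rule: pCons_induct)
  case (pCons c P)
  then show ?case by (cases Q) (simp add: left_eval_pCons algebra_simps)
qed simp

lemma left_eval_map_poly: "left_eval (map_poly to_ac a) v = act a v"
  by (induction a arbitrary: v rule: pCons_induct)
    (simp_all add: map_poly_to_ac_pCons left_eval_pCons act_pCons')

text \<open>
  A twisted factorization of \<open>\<tau>\<^sup>n\<^sup>k\<close>: since \<open>\<phi>\<^sub>T - t = \<tau>\<^sup>n\<close> and \<open>\<tau>\<^sup>n\<^sup>k t = t\<^sup>[\<^sup>n\<^sup>k\<^sup>] \<tau>\<^sup>n\<^sup>k\<close>, one has
  \<open>\<tau>\<^sup>n\<^sup>k (\<phi>\<^sub>T - t) = \<tau>\<^sup>n\<^sup>(\<^sup>k\<^sup>+\<^sup>1\<^sup>)\<close>, which is \<open>\<tau>\<^sup>n\<^sup>k \<phi>\<^sub>T - t\<^sup>[\<^sup>n\<^sup>k\<^sup>] \<tau>\<^sup>n\<^sup>k\<close>; so passing from \<open>k\<close> to \<open>k + 1\<close>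
  multiplies the polynomial by \<open>X - t\<^sup>[\<^sup>n\<^sup>k\<^sup>]\<close>.
\<close>

lemma left_eval_newton:
  "left_eval (\<Prod>j<k. [:- frob_pow (n * j) t, 1:]) v = frob_pow (n * k) v"
proof (induction k arbitrary: v)
  case 0
  show ?case by (simp add: one_pCons left_eval_pCons)
next
  case (Suc k)
  let ?N = "\<Prod>j<k. [:- frob_pow (n * j) t, 1:]"
  have "(\<Prod>j<Suc k. [:- frob_pow (n * j) t, 1:]) = pCons 0 ?N + smult (- frob_pow (n * k) t) ?N"
    by (simp add: mult.commute[of ?N])
  then show ?case
    by (simp add: left_eval_add left_eval_pCons left_eval_smult Suc.IH act_T_def frob_pow_add
        frob_pow_mult frob_pow_comp add.commute del: smult_minus_left)
qed

text \<open>
  The \<open>r\<close> conjugates of \<open>t\<close> are roots of \<open>p\<^sub>0\<close>, so the difference of the two monic polynomials of degree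
  \<open>r\<close> has \<open>r\<close> roots and smaller degree.
\<close>

lemma p0_splits: "map_poly to_ac p0 = (\<Prod>j<r. [:- frob_pow (n * j) t, 1:])"
proof (rule ccontr)
  assume ne: "map_poly to_ac p0 \<noteq> (\<Prod>j<r. [:- frob_pow (n * j) t, 1:])"
  let ?P = "map_poly to_ac p0" and ?N = "\<Prod>j<r. [:- frob_pow (n * j) t, 1:]"
  have dP: "degree ?P = r" by (simp add: degree_map_poly p0_deg)
  have lP: "lead_coeff ?P = 1" using p0_monic by (simp add: dP coeff_map_poly p0_deg)
  have dN: "degree ?N = r" by (subst degree_prod_eq_sum_degree) auto
  have lN: "lead_coeff ?N = 1" by (simp add: lead_coeff_prod)
  define D where "D = ?P - ?N"
  have D0: "D \<noteq> 0" using ne by (simp add: D_def)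
  have "degree D \<le> r" unfolding D_def using dP dN by (intro degree_diff_le) auto
  moreover have "coeff D r = 0" using lP lN dP dN by (simp add: D_def)
  ultimately have dD: "degree D < r" using D0 by (metis le_neq_implies_less leading_coeff_0_iff)
  have "(\<lambda>j. frob_pow (n * j) t) ` {..<r} \<subseteq> {x. poly D x = 0}"
    using p0_t by (auto simp: D_def poly_prod ac_eval_frob)
  then have "card ((\<lambda>j. frob_pow (n * j) t) ` {..<r}) \<le> card {x. poly D x = 0}"
    by (intro card_mono poly_roots_finite[OF D0])
  then have "r \<le> card {x. poly D x = 0}" using card_image[OF inj_frob_t] by simp
  then show False using card_poly_roots_bound[OF D0] dD by linarith
qed

text \<open>
  In characteristic \<open>p\<^sub>0\<close> the module is totally supersingular: \<open>\<phi>\<close> takes \<open>p\<^sub>0\<close> to the power \<open>\<tau>\<^sup>n\<^sup>r = \<pi>\<^sup>n\<close>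
  of the Frobenius. This makes \<open>\<pi>\<^sup>n\<close> central in \<open>E\<close>.
\<close>

lemma act_p0: "act p0 v = frob_pow (n * r) v"
  using left_eval_newton[of r v] by (simp add: p0_splits[symmetric] left_eval_map_poly)

end

section \<open>The torsion module\<close>

lemma ac_module_simps [simp]:
  "carrier (ac_module s W) = W" "\<zero>\<^bsub>ac_module s W\<^esub> = 0"
  "ring.add (ac_module s W) = (+)" "module.smult (ac_module s W) = s"
  "(ac_module s W)\<lparr>carrier := W'\<rparr> = ac_module s W'"
  by (simp_all add: ac_module_def)

lemma class_iff: "x \<in> residue_class f a \<longleftrightarrow> f dvd x - (a :: 'b::field poly)"
proof -
  have "residue_class f a = {b * f + a | b. True}"
    by (auto simp: residue_class_def a_r_coset_def r_coset_def cgenideal_def ring_of_type_simps)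
  then have "x \<in> residue_class f a \<longleftrightarrow> (\<exists>b. x - a = f * b)"
    by (auto simp: algebra_simps)
  then show ?thesis by (simp add: dvd_def)
qed

lemma residue_class_eq_iff: "residue_class f a = residue_class f b \<longleftrightarrow> f dvd a - (b :: 'b::field poly)"
proof
  assume "residue_class f a = residue_class f b"
  then have "a \<in> residue_class f b" using class_iff[of a f a] by simp
  then show "f dvd a - b" by (simp add: class_iff)
next
  assume ab: "f dvd a - b"
  have "f dvd x - a \<longleftrightarrow> f dvd x - b" for x
    using dvd_add_left_iff[OF ab, of "x - a"] by simp
  then show "residue_class f a = residue_class f b" by (auto simp: class_iff)
qed

lemma ideal_PIdl: "ideal (PIdl\<^bsub>ring_of_type_algebra\<^esub> f) (ring_of_type_algebra :: 'b::field poly ring)"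
  by (intro cring.cgenideal_ideal cring_from_type_algebra) (simp add: ring_of_type_simps)

lemma residue_class_hom: "residue_class f \<in> ring_hom ring_of_type_algebra (residue_field (f :: 'b::field poly))"
proof -
  have "residue_class f = (+>\<^bsub>ring_of_type_algebra\<^esub>) (PIdl\<^bsub>ring_of_type_algebra\<^esub> f)"
    by (rule ext) (simp add: residue_class_def)
  then show ?thesis unfolding residue_field_def by (simp only: ideal.rcos_ring_hom[OF ideal_PIdl])
qed

lemma residue_class_add: "residue_class f a \<oplus>\<^bsub>residue_field f\<^esub> residue_class f b = residue_class f (a + (b :: 'b::field poly))"
  using ring_hom_add[OF residue_class_hom[of f], of a b] by (simp add: ring_of_type_simps)
lemma residue_class_mult: "residue_class f a \<otimes>\<^bsub>residue_field f\<^esub> residue_class f b = residue_class f (a * (b :: 'b::field poly))"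
  using ring_hom_mult[OF residue_class_hom[of f], of a b] by (simp add: ring_of_type_simps)
lemma residue_class_one: "\<one>\<^bsub>residue_field f\<^esub> = residue_class f (1 :: 'b::field poly)"
  using ring_hom_one[OF residue_class_hom[of f]] by (simp add: ring_of_type_simps)
lemma cring_residue: "cring (residue_field (f :: 'b::field poly))"
  unfolding residue_field_def by (rule ideal.quotient_is_cring[OF ideal_PIdl cring_from_type_algebra])
lemma residue_class_zero: "\<zero>\<^bsub>residue_field f\<^esub> = residue_class f (0 :: 'b::field poly)"
  using ring_hom_zero[OF residue_class_hom[of f] ring_from_type_algebra cring.axioms(1)[OF cring_residue]]
  by (simp add: ring_of_type_simps)
lemma carrier_residue: "carrier (residue_field f) = range (residue_class (f :: 'b::field poly))"
  by (auto simp: residue_field_def residue_class_def FactRing_def A_RCOSETS_def' ring_of_type_simps)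

lemma field_residue:
  assumes "Factorial_Ring.irreducible (f :: 'b::field poly)"
  shows "Ring.field (residue_field f)"
proof (rule cring.cring_fieldI2[OF cring_residue])
  have "\<not> f dvd 1" using assms by (simp add: Factorial_Ring.irreducible_def)
  then show "\<zero>\<^bsub>residue_field f\<^esub> \<noteq> \<one>\<^bsub>residue_field f\<^esub>"
    by (simp add: residue_class_zero residue_class_one residue_class_eq_iff)
  fix B assume B: "B \<in> carrier (residue_field f)" "B \<noteq> \<zero>\<^bsub>residue_field f\<^esub>"
  then obtain a where a: "B = residue_class f a" by (auto simp: carrier_residue)
  then have "\<not> f dvd a" using B(2) by (simp add: residue_class_zero residue_class_eq_iff)
  then obtain u v where uv: "u * f + v * a = 1" using irreducible_bezout[OF assms] by blast
  have "f dvd a * v - 1"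
  proof
    show "a * v - 1 = f * (- u)" using uv by (simp add: algebra_simps eq_neg_iff_add_eq_0)
  qed
  then have "B \<otimes>\<^bsub>residue_field f\<^esub> residue_class f v = \<one>\<^bsub>residue_field f\<^esub>"
    by (simp add: a residue_class_mult residue_class_one residue_class_eq_iff)
  then show "\<exists>b\<in>carrier (residue_field f). B \<otimes>\<^bsub>residue_field f\<^esub> b = \<one>\<^bsub>residue_field f\<^esub>"
    by (auto simp: carrier_residue)
qed

lemma card_residue:
  fixes f :: "'a::{finite,field} poly"
  assumes "0 < degree f"
  shows "card (carrier (residue_field f)) = CARD('a) ^ degree f"
proof -
  have "bij_betw (residue_class f) {a. degree a < degree f} (carrier (residue_field f))"
    unfolding bij_betw_def
  proof
    show "inj_on (residue_class f) {a. degree a < degree f}"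
    proof (rule inj_onI)
      fix a b assume ab: "a \<in> {a. degree a < degree f}" "b \<in> {a. degree a < degree f}" "residue_class f a = residue_class f b"
      then have "f dvd a - b" by (simp add: residue_class_eq_iff)
      moreover have "degree (a - b) < degree f" using ab by (auto intro: degree_diff_less)
      ultimately show "a = b" using dvd_imp_degree_le[of f "a - b"] by fastforce
    qed
    show "residue_class f ` {a. degree a < degree f} = carrier (residue_field f)"
    proof -
      have "residue_class f a \<in> residue_class f ` {a. degree a < degree f}" for a
      proof (rule image_eqI[of _ _ "a mod f"])
        show "residue_class f a = residue_class f (a mod f)"
          by (simp add: residue_class_eq_iff minus_mod_eq_mult_div)
        have "f \<noteq> 0" using assms by auto
        then show "a mod f \<in> {a. degree a < degree f}"
          using degree_mod_less[of f a] assms by auto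
      qed
      then show ?thesis by (auto simp: carrier_residue)
    qed
  qed
  then show ?thesis using card_poly_degree_less[OF assms] bij_betw_same_card by metis
qed

context drinfeld_torsion
begin

abbreviation tors where "tors \<equiv> torsion \<phi> p"
abbreviation \<pi> where "\<pi> \<equiv> frob_endo \<phi> p r"

lemma tors_iff: "v \<in> tors \<longleftrightarrow> act p v = 0" by (simp add: torsion_eq)
lemma tors_0: "0 \<in> tors" by (simp add: tors_iff)
lemma tors_add: "u \<in> tors \<Longrightarrow> v \<in> tors \<Longrightarrow> u + v \<in> tors" by (simp add: tors_iff act_add)
lemma tors_minus: "v \<in> tors \<Longrightarrow> - v \<in> tors" by (simp add: tors_iff act_minus)
lemma tors_act: "v \<in> tors \<Longrightarrow> act a v \<in> tors"
  by (simp add: tors_iff) (metis act_mult_poly act_zero mult.commute)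
lemma tors_frob: "v \<in> tors \<Longrightarrow> frob_pow (r * j) v \<in> tors"
  by (simp add: tors_iff act_frob)
lemma tors_scalar: "frob_pow n \<zeta> = \<zeta> \<Longrightarrow> v \<in> tors \<Longrightarrow> \<zeta> * v \<in> tors"
  by (simp add: tors_iff act_scalar)

lemma act_cong: "p dvd a - b \<Longrightarrow> v \<in> tors \<Longrightarrow> act a v = act b v"
proof -
  assume "p dvd a - b" and v: "v \<in> tors"
  then obtain k where "a - b = k * p" by (metis dvdE mult.commute)
  then have "act (a - b) v = 0" using v by (simp add: act_mult_poly tors_iff)
  then show ?thesis by (simp add: act_diff_poly)
qed

text \<open>
  Polynomials that differ by a multiple of \<open>p\<close> act alike on the torsion, so the set of results is a
  singleton.
\<close>

lemma class_act: "v \<in> tors \<Longrightarrow> class_act \<phi> (residue_class p a) v = act a v"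
proof -
  assume v: "v \<in> tors"
  have "a \<in> residue_class p a" by (simp add: class_iff)
  have "tau_act (\<phi> x) v = act a v" if "x \<in> residue_class p a" for x
    using act_cong[OF _ v, of x a] that by (simp add: act_def[symmetric] class_iff)
  then have "(\<lambda>x. tau_act (\<phi> x) v) ` residue_class p a = (\<lambda>x. act a v) ` residue_class p a"
    by (rule image_cong[OF refl])
  also have "\<dots> = {act a v}" by (rule image_constant[OF \<open>a \<in> residue_class p a\<close>])
  finally have "(\<lambda>x. tau_act (\<phi> x) v) ` residue_class p a = {act a v}" .
  then show ?thesis by (simp add: class_act_def)
qed

sublocale L: finite_linear_space "residue_field p" "ac_module (class_act \<phi>) tors"
proof (intro finite_linear_space.intro vectorspace.intro finite_linear_space_axioms.intro moduleI)
  let ?V = "ac_module (class_act \<phi>) tors"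
  show "Ring.field (residue_field p)" by (rule field_residue[OF p_irred])
  show "cring (residue_field p)" by (rule cring_residue)
  show "abelian_group ?V"
  proof (rule abelian_groupI)
    show "\<exists>y\<in>carrier ?V. y \<oplus>\<^bsub>?V\<^esub> x = \<zero>\<^bsub>?V\<^esub>" if "x \<in> carrier ?V" for x
      using that tors_minus by (intro bexI[of _ "- x"]) auto
  qed (auto simp: tors_0 tors_add)
  show "finite (carrier (residue_field p))"
    using card_residue[of p] d_pos p_deg by (intro card_ge_0_finite) simp
  show "finite (carrier ?V)" by (simp add: finite_torsion)
qed (auto simp: carrier_residue class_act tors_act residue_class_add residue_class_mult residue_class_one
    act_add_poly act_mult_poly act_add tors_add)

lemma torsion_endo_eq: "torsion_endo \<phi> p = endo_ring (residue_field p) (ac_module (class_act \<phi>) tors)"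
  by (simp add: torsion_endo_def)

lemma card_kappa: "card (carrier (residue_field p)) = CARD('a) ^ d"
  using card_residue[of p] d_pos p_deg by simp

lemma mem_E_iff: "f \<in> L.E \<longleftrightarrow> f \<in> extensional tors \<and> (\<forall>v\<in>tors. f v \<in> tors) \<and>
    (\<forall>u\<in>tors. \<forall>v\<in>tors. f (u + v) = f u + f v) \<and> (\<forall>a. \<forall>v\<in>tors. f (act a v) = act a (f v))"
  unfolding L.endo_iff by (auto simp: carrier_residue class_act tors_act)

lemma restrict_endo:
  assumes "\<And>v. v \<in> tors \<Longrightarrow> f v \<in> tors" "\<And>u v. f (u + v) = f u + f v" "\<And>a v. f (act a v) = act a (f v)"
  shows "restrict f tors \<in> L.E"
  using assms by (auto simp: mem_E_iff tors_act tors_add)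

lemma act_act: "act a (act b v) = act b (act a v)"
  by (metis act_mult_poly mult.commute)

lemma residue_endo_eq: "residue_endo \<phi> p (residue_class p a) = (\<lambda>v\<in>tors. act a v)"
  by (auto simp: residue_endo_def class_act)
lemma residue_endo_mem: "B \<in> carrier (residue_field p) \<Longrightarrow> residue_endo \<phi> p B \<in> L.E"
  by (auto simp: carrier_residue residue_endo_eq intro!: restrict_endo tors_act act_add act_act)
lemma scalar_endo_mem: "frob_pow n \<zeta> = \<zeta> \<Longrightarrow> scalar_endo \<phi> p \<zeta> \<in> L.E"
  unfolding scalar_endo_def
  by (intro restrict_endo) (auto simp: tors_scalar act_scalar distrib_left)
lemma frob_restrict_mem: "(\<lambda>v\<in>tors. frob_pow (r * j) v) \<in> L.E"
  by (intro restrict_endo) (auto simp: tors_frob act_frob frob_pow_add)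
lemma frob_endo_mem: "\<pi> \<in> L.E"
  using frob_restrict_mem[of 1] by (simp add: frob_endo_def)

lemma funpow_frob: "v \<in> tors \<Longrightarrow> ((\<lambda>v\<in>tors. frob_pow (r * i) v) ^^ j) v = frob_pow (r * i * j) v"
proof (induction j)
  case (Suc j)
  have "frob_pow (r * i * j) v \<in> tors" using tors_frob[OF Suc.prems, of "i * j"] by (simp add: mult.assoc)
  then show ?case using Suc by (simp add: frob_pow_comp)
qed simp

lemma frob_endo_pow: "\<pi> [^]\<^bsub>torsion_endo \<phi> p\<^esub> (k::nat) = (\<lambda>v\<in>tors. frob_pow (r * k) v)"
proof (rule L.endo_eqI)
  interpret E: ring "torsion_endo \<phi> p" unfolding torsion_endo_eq by (rule L.ring_endo)
  show "\<pi> [^]\<^bsub>torsion_endo \<phi> p\<^esub> k \<in> L.E"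
    using E.nat_pow_closed[of "\<pi>" k] frob_endo_mem by (simp add: torsion_endo_eq)
  show "(\<lambda>v\<in>tors. frob_pow (r * k) v) \<in> L.E" by (rule frob_restrict_mem)
  fix v assume v: "v \<in> L.M"
  have "((\<lambda>v\<in>tors. frob_pow (r * 1) v) ^^ k) v = frob_pow (r * 1 * k) v"
    by (rule funpow_frob) (use v in simp)
  then show "(\<pi> [^]\<^bsub>torsion_endo \<phi> p\<^esub> k) v = (\<lambda>v\<in>tors. frob_pow (r * k) v) v"
    using L.endo_nat_pow[OF frob_endo_mem v, of k] v
    by (simp add: torsion_endo_eq frob_endo_def)
qed

text \<open>
  A Bezout coefficient that inverts \<open>c\<close>: modulo \<open>p\<close> it is an inverse of \<open>p\<^sub>0\<close>.
\<close>

definition c_inv :: "'a poly" where "c_inv = (SOME w. \<exists>u. u * p + w * p0 = 1)"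

lemma act_c_inv: "v \<in> tors \<Longrightarrow> act c_inv (act p0 v) = v"
proof -
  assume v: "v \<in> tors"
  have "\<exists>w u. u * p + w * p0 = 1" using p_p0_bezout by metis
  then obtain u where u: "u * p + c_inv * p0 = 1" unfolding c_inv_def using someI_ex[of "\<lambda>w. \<exists>u. u * p + w * p0 = 1"] by blast
  have "act (u * p + c_inv * p0) v = act c_inv (act p0 v)"
    using v by (simp add: act_add_poly act_mult_poly tors_iff)
  then show ?thesis unfolding u by simp
qed

text \<open>
  The inverse of \<open>\<pi>\<^sup>j\<close> for \<open>j \<le> n\<close>, namely \<open>c\<^sup>-\<^sup>1 \<pi>\<^sup>n\<^sup>-\<^sup>j\<close>.
\<close>

definition frob_inv :: "nat \<Rightarrow> 'a alg_closure \<Rightarrow> 'a alg_closure" where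
  "frob_inv j = (\<lambda>v\<in>tors. act c_inv (frob_pow (r * (n - j)) v))"

lemma frob_inv_mem: "frob_inv j \<in> L.E"
  unfolding frob_inv_def
  by (intro restrict_endo) (auto simp: tors_frob tors_act act_frob frob_pow_add act_add act_act[of c_inv])

lemma frob_frob_inv: "j \<le> n \<Longrightarrow> v \<in> tors \<Longrightarrow> frob_pow (r * j) (frob_inv j v) = v"
  using act_c_inv[of v] act_p0[of v]
  by (simp add: frob_inv_def act_frob[symmetric] frob_pow_comp mult.commute[of n] flip: add_mult_distrib2)

lemma frob_inv_frob: "j \<le> n \<Longrightarrow> v \<in> tors \<Longrightarrow> frob_inv j (frob_pow (r * j) v) = v"
  using act_c_inv[of v] act_p0[of v]
  by (simp add: frob_inv_def tors_frob frob_pow_comp mult.commute[of n] flip: add_mult_distrib2)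

text \<open>
  For \<open>\<theta>\<close> of degree \<open>n\<close> over the field with \<open>q\<close> elements, the conjugates of \<open>\<theta>\<close> under powers of
  \<open>\<tau>\<^sup>r\<^sup>k\<close> repeat only after \<open>s = n/k\<close> steps, because \<open>r\<close> is prime to \<open>n\<close>. The case \<open>k = m\<close> serves the
  descent from \<open>E\<close> to \<open>R\<close>, and the case \<open>k = 1\<close> the independence of the powers of \<open>\<pi>\<close> over \<open>K\<close>.
\<close>

lemma cyclic_dual_bases:
  assumes k: "k * s = n"
  obtains \<theta> :: "'a alg_closure" and b where "frob_pow n \<theta> = \<theta>" "\<forall>k. frob_pow n (b k) = b k"
    "\<forall>j<s. (\<Sum>l<s. b l * frob_pow (r * k * j) (\<theta> ^ l)) = (if j = 0 then 1 else 0)"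
    "\<forall>i<s. \<forall>l<s. (\<Sum>j<s. frob_pow (r * k * j) (\<theta> ^ i * b l)) = (if i = l then 1 else 0)"
proof -
  have ks: "k > 0" "s > 0" using k n_pos by (auto intro: Nat.gr0I)
  obtain \<theta> :: "'a alg_closure" where \<theta>: "frob_pow n \<theta> = \<theta>" "\<And>i. 0 < i \<Longrightarrow> i < n \<Longrightarrow> frob_pow i \<theta> \<noteq> \<theta>"
    using exists_degree_n_element[of n] n_pos by (metis One_nat_def Suc_le_lessD)
  have per: "frob_pow (r * k * s) \<theta> = \<theta>"
  proof -
    have eq: "r * k * s = n * r" by (simp add: k[symmetric] mult_ac)
    show ?thesis unfolding eq by (rule frob_pow_fixed_mult[OF \<theta>(1)])
  qed
  have ne: "frob_pow (r * k * i) \<theta> \<noteq> frob_pow (r * k * j) \<theta>" if ij: "i < j" "j < s" for i j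
  proof
    assume eq: "frob_pow (r * k * i) \<theta> = frob_pow (r * k * j) \<theta>"
    have "frob_pow (r * k * j) \<theta> = frob_pow (r * k * i) (frob_pow (r * k * (j - i)) \<theta>)"
      using ij by (simp add: frob_pow_comp flip: add_mult_distrib2)
    then have "frob_pow (r * (k * (j - i))) \<theta> = \<theta>" using eq by (simp add: frob_pow_inj mult.assoc)
    then have g: "frob_pow (gcd (r * (k * (j - i))) n) \<theta> = \<theta>"
      using ij ks r_pos by (intro frob_pow_gcd \<theta>(1)) auto
    have "gcd (r * (k * (j - i))) n = gcd (k * (j - i)) n"
      using n_r by (simp add: gcd_mult_left_left_cancel)
    moreover have "gcd (k * (j - i)) n \<le> k * (j - i)" using ij ks by (intro gcd_le1_nat) simp
    moreover have "k * (j - i) < n" unfolding k[symmetric] using ij ks by simp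
    moreover have "0 < gcd (k * (j - i)) n" using n_pos by simp
    ultimately show False using \<theta>(2)[of "gcd (k * (j - i)) n"] g by auto
  qed
  have inj: "inj_on (\<lambda>j. frob_pow (r * k * j) \<theta>) {..<s}"
    by (rule inj_onI) (metis lessThan_iff linorder_neqE_nat ne)
  show thesis
  proof (rule frobenius_dual_bases[OF ks(2) \<theta>(1) per inj])
    fix b :: "nat \<Rightarrow> 'a alg_closure"
    assume b: "\<And>l. frob_pow n (b l) = b l"
      "\<And>j. j < s \<Longrightarrow> (\<Sum>l<s. b l * frob_pow (r * k * j) (\<theta> ^ l)) = (if j = 0 then 1 else 0)"
      "\<And>i l. i < s \<Longrightarrow> l < s \<Longrightarrow> (\<Sum>j<s. frob_pow (r * k * j) (\<theta> ^ i * b l)) = (if i = l then 1 else 0)"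
    show thesis
    proof (rule that[OF \<theta>(1)])
      show "\<forall>l. frob_pow n (b l) = b l" using b(1) by blast
      show "\<forall>j<s. (\<Sum>l<s. b l * frob_pow (r * k * j) (\<theta> ^ l)) = (if j = 0 then 1 else 0)"
        using b(2) by blast
      show "\<forall>i<s. \<forall>l<s. (\<Sum>j<s. frob_pow (r * k * j) (\<theta> ^ i * b l)) = (if i = l then 1 else 0)"
        using b(3) by blast
    qed
  qed
qed

definition gamma :: "'a alg_closure \<Rightarrow> 'a alg_closure" where
  "gamma = (\<lambda>v\<in>tors. frob_pow (r * m) v)"

abbreviation s where "s \<equiv> n div m"

lemma m_s: "m * s = n" using m_n by simp
lemma s_pos: "s > 0" using m_s n_pos by (auto intro: Nat.gr0I)

lemma gamma_pow: "v \<in> tors \<Longrightarrow> (gamma ^^ j) v = frob_pow (r * m * j) v"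
  unfolding gamma_def by (rule funpow_frob)

text \<open>
  The dual bases act on \<open>M\<close> as scalars, and \<open>\<gamma>\<^sup>s = \<pi>\<^sup>n\<close> commutes with \<open>E\<close> because it is the action of
  \<open>p\<^sub>0\<close>.
\<close>

lemma torsion_endo_descent:
  obtains a b where "endo_descent (residue_field p) (ac_module (class_act \<phi>) tors) gamma (frob_inv m) s a b"
proof -
  obtain \<theta> :: "'a alg_closure" and b where \<theta>: "frob_pow n \<theta> = \<theta>" and "\<forall>k. frob_pow n (b k) = b k"
    and "\<forall>j<s. (\<Sum>l<s. b l * frob_pow (r * m * j) (\<theta> ^ l)) = (if j = 0 then 1 else 0)"
    and "\<forall>i<s. \<forall>l<s. (\<Sum>j<s. frob_pow (r * m * j) (\<theta> ^ i * b l)) = (if i = l then 1 else 0)"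
    by (rule cyclic_dual_bases[OF m_s])
  then have b: "\<And>k. frob_pow n (b k) = b k"
    and G1: "\<And>j. j < s \<Longrightarrow> (\<Sum>l<s. b l * frob_pow (r * m * j) (\<theta> ^ l)) = (if j = 0 then 1 else 0)"
    and G2: "\<And>i l. i < s \<Longrightarrow> l < s \<Longrightarrow> (\<Sum>j<s. frob_pow (r * m * j) (\<theta> ^ i * b l)) = (if i = l then 1 else 0)"
    by blast+
  have mn: "m \<le> n" using m_n n_pos by (auto intro: dvd_imp_le)
  have th: "frob_pow n (\<theta> ^ l) = \<theta> ^ l" for l by (simp add: frob_pow_power \<theta>)
  have "endo_descent (residue_field p) (ac_module (class_act \<phi>) tors) gamma (frob_inv m) s
     (\<lambda>k. scalar_endo \<phi> p (\<theta> ^ k)) (\<lambda>k. scalar_endo \<phi> p (b k))"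
  proof (unfold_locales, unfold ac_module_simps)
    show "gamma \<in> L.E" unfolding gamma_def by (rule frob_restrict_mem)
    show "frob_inv m \<in> L.E" by (rule frob_inv_mem)
    show "gamma (frob_inv m v) = v" if v: "v \<in> tors" for v
      using L.endo_mem[OF frob_inv_mem[of m], of v] v frob_frob_inv[OF mn v] by (simp add: gamma_def)
    show "frob_inv m (gamma v) = v" if v: "v \<in> tors" for v
      using v frob_inv_frob[OF mn v] by (simp add: gamma_def)
    show "0 < s" by (rule s_pos)
    show "f ((gamma ^^ s) v) = (gamma ^^ s) (f v)" if f: "f \<in> L.E" and v: "v \<in> tors" for f v
    proof -
      have g: "(gamma ^^ s) u = act p0 u" if "u \<in> tors" for u
        using that by (simp add: gamma_pow act_p0 m_s mult.assoc mult.commute[of n])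
      have "f v \<in> tors" using f v by (simp add: mem_E_iff)
      then show ?thesis using f v by (simp add: g mem_E_iff)
    qed
    show "scalar_endo \<phi> p (\<theta> ^ k) \<in> L.E" for k by (rule scalar_endo_mem[OF th])
    show "scalar_endo \<phi> p (b k) \<in> L.E" for k by (rule scalar_endo_mem[OF b])
    show "(\<Sum>k<s. scalar_endo \<phi> p (b k) ((gamma ^^ j) (scalar_endo \<phi> p (\<theta> ^ k) v))) = (if j = 0 then v else 0)"
      if j: "j < s" and v: "v \<in> tors" for j v
    proof -
      have fv: "frob_pow (r * m * j) u \<in> tors" if "u \<in> tors" for u
        using tors_frob[OF that, of "m * j"] by (simp add: mult.assoc)
      have "scalar_endo \<phi> p (b k) ((gamma ^^ j) (scalar_endo \<phi> p (\<theta> ^ k) v)) =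
          (b k * frob_pow (r * m * j) (\<theta> ^ k)) * frob_pow (r * m * j) v" for k
      proof -
        have 1: "\<theta> ^ k * v \<in> tors" by (rule tors_scalar[OF th v])
        show ?thesis using v fv[OF 1] 1 by (simp add: scalar_endo_def gamma_pow frob_pow_mult)
      qed
      then have "(\<Sum>k<s. scalar_endo \<phi> p (b k) ((gamma ^^ j) (scalar_endo \<phi> p (\<theta> ^ k) v))) =
          (\<Sum>k<s. b k * frob_pow (r * m * j) (\<theta> ^ k)) * frob_pow (r * m * j) v"
        by (simp only: sum_distrib_right)
      also have "\<dots> = (if j = 0 then v else 0)" unfolding G1[OF j] by simp
      finally show ?thesis .
    qed
    show "(\<Sum>j<s. (gamma ^^ j) (scalar_endo \<phi> p (\<theta> ^ k) (scalar_endo \<phi> p (b l) ((frob_inv m ^^ j) v)))) =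
        (if k = l then v else 0)" if kl: "k < s" "l < s" and v: "v \<in> tors" for k l v
    proof -
      have "(gamma ^^ j) (scalar_endo \<phi> p (\<theta> ^ k) (scalar_endo \<phi> p (b l) ((frob_inv m ^^ j) v))) =
          frob_pow (r * m * j) (\<theta> ^ k * b l) * v" for j
      proof -
        have inv: "(frob_inv m ^^ j) u \<in> tors \<and> frob_pow (r * m * j) ((frob_inv m ^^ j) u) = u" if "u \<in> tors" for u
        proof (induction j)
          case (Suc j)
          let ?u = "(frob_inv m ^^ j) u"
          have "frob_inv m ?u \<in> tors" using L.endo_mem[OF frob_inv_mem[of m], of ?u] Suc.IH by simp
          moreover have "frob_pow (r * m * Suc j) (frob_inv m ?u) = frob_pow (r * m * j) (frob_pow (r * m) (frob_inv m ?u))"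
            by (simp add: frob_pow_comp add.commute)
          ultimately show ?case using Suc.IH frob_frob_inv[OF mn, of ?u] by simp
        qed (use that in simp)
        let ?u = "(frob_inv m ^^ j) v"
        have 1: "b l * ?u \<in> tors" using inv[OF v] by (intro tors_scalar b) simp
        have 2: "\<theta> ^ k * (b l * ?u) \<in> tors" by (rule tors_scalar[OF th 1])
        show ?thesis using inv[OF v] 1 2 by (simp add: scalar_endo_def gamma_pow frob_pow_mult mult.assoc)
      qed
      then have "(\<Sum>j<s. (gamma ^^ j) (scalar_endo \<phi> p (\<theta> ^ k) (scalar_endo \<phi> p (b l) ((frob_inv m ^^ j) v)))) =
          (\<Sum>j<s. frob_pow (r * m * j) (\<theta> ^ k * b l)) * v" by (simp only: sum_distrib_right)
      also have "\<dots> = (if k = l then v else 0)" unfolding G2[OF kl] by simp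
      finally show ?thesis .
    qed
  qed
  then show thesis by (rule that)
qed

end

section \<open>Left ideals of the centralizer and stable subspaces\<close>

lemma left_mult_vectorspace:
  assumes T: "ring T" and F: "Ring.field F" and h: "h \<in> ring_hom F T"
    and C: "additive_subgroup C T" and hC: "\<And>x c. x \<in> carrier F \<Longrightarrow> c \<in> C \<Longrightarrow> h x \<otimes>\<^bsub>T\<^esub> c \<in> C"
  shows "vectorspace F (left_mult_module T h C)"
proof -
  interpret T: ring T by fact
  interpret F: Ring.field F by fact
  interpret C: additive_subgroup C T by fact
  note CT = subsetD[OF C.a_subset]
  show ?thesis
  proof (intro vectorspace.intro moduleI F F.is_cring)
    show "abelian_group (left_mult_module T h C)"
    proof (rule abelian_groupI)
      show "\<exists>y\<in>carrier (left_mult_module T h C). y \<oplus>\<^bsub>left_mult_module T h C\<^esub> x = \<zero>\<^bsub>left_mult_module T h C\<^esub>"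
        if "x \<in> carrier (left_mult_module T h C)" for x
        using that CT C.a_inv_closed T.l_neg
        by (intro bexI[of _ "\<ominus>\<^bsub>T\<^esub> x"]) (auto simp: left_mult_module_def)
    qed (use CT in \<open>auto simp: left_mult_module_def T.a_ac\<close>)
  qed (use CT hC ring_hom_closed[OF h] in \<open>auto simp: left_mult_module_def ring_hom_add[OF h] ring_hom_mult[OF h]
      ring_hom_one[OF h] T.l_distr T.r_distr T.m_assoc\<close>)
qed

context drinfeld_torsion
begin

abbreviation En where "En \<equiv> torsion_endo \<phi> p"
abbreviation R where "R \<equiv> R_ring \<phi> p r m"
abbreviation K where "K \<equiv> K_ring \<phi> p m"
abbreviation Z where "Z \<equiv> zero_set \<phi> p"
abbreviation Ann where "Ann \<equiv> annihilator \<phi> p r m"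
abbreviation \<sigma> where "\<sigma> \<equiv> frob_conj \<phi> p r"
abbreviation monic_in where "monic_in \<equiv> monic_with_class_in \<phi> p p0 r m n"

lemma ring_En: "ring En" unfolding torsion_endo_eq by (rule L.ring_endo)

lemma En_simps:
  "carrier En = L.E" "\<one>\<^bsub>En\<^esub> = (\<lambda>v\<in>tors. v)" "\<zero>\<^bsub>En\<^esub> = (\<lambda>v\<in>tors. 0)"
  "f \<otimes>\<^bsub>En\<^esub> g = compose tors f g" "f \<oplus>\<^bsub>En\<^esub> g = (\<lambda>v\<in>tors. f v + g v)"
  unfolding torsion_endo_eq by simp_all

lemma En_a_inv: "f \<in> L.E \<Longrightarrow> \<ominus>\<^bsub>En\<^esub> f = (\<lambda>v\<in>tors. - f v)"
  unfolding torsion_endo_eq using L.endo_a_inv by simp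

lemma En_finsum: "finite I \<Longrightarrow> (\<And>i. i \<in> I \<Longrightarrow> f i \<in> L.E) \<Longrightarrow> finsum En f I = (\<lambda>v\<in>tors. \<Sum>i\<in>I. f i v)"
  unfolding torsion_endo_eq using L.endo_finsum[of I f] by simp

lemma gamma_eq: "\<pi> [^]\<^bsub>En\<^esub> m = gamma"
  by (simp add: frob_endo_pow gamma_def)

lemma gamma_mem: "gamma \<in> L.E" unfolding gamma_def by (rule frob_restrict_mem)

lemma E_mem: "f \<in> L.E \<Longrightarrow> v \<in> tors \<Longrightarrow> f v \<in> tors" by (simp add: mem_E_iff)
lemma E_add: "f \<in> L.E \<Longrightarrow> u \<in> tors \<Longrightarrow> v \<in> tors \<Longrightarrow> f (u + v) = f u + f v" by (simp add: mem_E_iff)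
lemma E_minus: "f \<in> L.E \<Longrightarrow> v \<in> tors \<Longrightarrow> f (- v) = - f v" using L.endo_minus by simp
lemma E_ext: "f \<in> L.E \<Longrightarrow> f \<in> extensional tors" by (simp add: mem_E_iff)

text \<open>
  The carrier of \<open>R\<close>: commuting with \<open>\<gamma>\<close> suffices, as elements of \<open>E\<close> commute with \<open>\<kappa>\<close> anyway.
\<close>

definition R_set :: "('a alg_closure \<Rightarrow> 'a alg_closure) set" where
  "R_set = {f \<in> L.E. \<forall>v\<in>tors. f (gamma v) = gamma (f v)}"

abbreviation R0_gens where
  "R0_gens \<equiv> residue_endo \<phi> p ` carrier (residue_field p) \<union> {gamma}"

lemma R0_gens_mem: "R0_gens \<subseteq> L.E" using residue_endo_mem gamma_mem by auto

lemma R0_carrier: "carrier (R0_ring \<phi> p r m) = generate_ring En R0_gens"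
  by (simp add: R0_ring_def gamma_eq)

lemma R0_mem: "x \<in> generate_ring En R0_gens \<Longrightarrow> x \<in> L.E"
  using ring.generate_ring_in_carrier[OF ring_En, of R0_gens x] R0_gens_mem by (simp add: En_simps)

text \<open>
  Induction on the generation of \<open>R\<^sub>0\<close> by \<open>\<kappa>\<close> and \<open>\<gamma>\<close>.
\<close>

lemma R_set_commutes_R0:
  assumes f: "f \<in> R_set" and x: "x \<in> generate_ring En R0_gens" and v: "v \<in> tors"
  shows "f (x v) = x (f v)"
proof -
  have fE: "f \<in> L.E" using f by (simp add: R_set_def)
  show ?thesis using x v
  proof (induction arbitrary: v rule: generate_ring.induct)
    case one
    then show ?case using E_mem[OF fE] by (simp add: En_simps)
  next
    case (incl h)
    then show ?case using f
    proof (elim UnE imageE)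
      fix B assume "h = residue_endo \<phi> p B" "B \<in> carrier (residue_field p)"
      then obtain a where "h = (\<lambda>v\<in>tors. act a v)" by (auto simp: carrier_residue residue_endo_eq)
      then show ?thesis using incl.prems fE E_mem[OF fE] by (simp add: mem_E_iff)
    qed (simp add: R_set_def)
  next
    case (a_inv h)
    then show ?case using E_mem[OF fE] E_minus[OF fE] E_mem[OF R0_mem]
      by (simp add: En_a_inv R0_mem)
  next
    case (eng_add h1 h2)
    then show ?case using E_mem[OF fE] E_add[OF fE] E_mem[OF R0_mem] by (simp add: En_simps)
  next
    case (eng_mult h1 h2)
    then show ?case using E_mem[OF fE] E_mem[OF R0_mem] by (simp add: En_simps compose_def)
  qed
qed

lemma gamma_R0: "gamma \<in> generate_ring En R0_gens" by (rule generate_ring.incl) simp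
lemma residue_endo_R0: "B \<in> carrier (residue_field p) \<Longrightarrow> residue_endo \<phi> p B \<in> generate_ring En R0_gens"
  by (rule generate_ring.incl) simp

lemma R_carrier: "carrier R = R_set"
proof
  show "carrier R \<subseteq> R_set"
  proof
    fix f assume "f \<in> carrier R"
    then have f: "f \<in> L.E" "\<And>x. x \<in> generate_ring En R0_gens \<Longrightarrow> compose tors f x = compose tors x f"
      by (auto simp: R_ring_def centralizer_def R0_carrier En_simps)
    have "f (gamma v) = gamma (f v)" if "v \<in> tors" for v
      using fun_cong[OF f(2)[OF gamma_R0], of v] that by (simp add: compose_def)
    then show "f \<in> R_set" using f(1) by (simp add: R_set_def)
  qed
  show "R_set \<subseteq> carrier R"
  proof
    fix f assume f: "f \<in> R_set"
    have "compose tors f x = compose tors x f" if "x \<in> generate_ring En R0_gens" for x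
      by (rule extensionalityI[of _ tors]) (auto simp: compose_def R_set_commutes_R0[OF f that])
    then show "f \<in> carrier R"
      using f by (auto simp: R_ring_def centralizer_def R0_carrier En_simps R_set_def)
  qed
qed

lemma R_ring_eq: "R = En\<lparr>carrier := R_set\<rparr>"
  using R_carrier by (simp add: R_ring_def)

lemma R_set_E: "f \<in> R_set \<Longrightarrow> f \<in> L.E" by (simp add: R_set_def)
lemma R_set_gamma: "f \<in> R_set \<Longrightarrow> v \<in> tors \<Longrightarrow> f (gamma v) = gamma (f v)" by (simp add: R_set_def)

lemma R_set_compose: "f \<in> R_set \<Longrightarrow> g \<in> R_set \<Longrightarrow> compose tors f g \<in> R_set"
  using L.endo_compose[of f g] E_mem[OF gamma_mem] E_mem[OF R_set_E]
  by (simp add: R_set_def compose_def)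
lemma R_set_plus: "f \<in> R_set \<Longrightarrow> g \<in> R_set \<Longrightarrow> (\<lambda>v\<in>tors. f v + g v) \<in> R_set"
  using L.endo_plus[of f g] E_mem[OF gamma_mem] E_mem[OF R_set_E] E_add[OF gamma_mem]
  by (simp add: R_set_def)
lemma R_set_uminus: "f \<in> R_set \<Longrightarrow> (\<lambda>v\<in>tors. - f v) \<in> R_set"
  using L.endo_uminus[of f] E_mem[OF gamma_mem] E_mem[OF R_set_E] E_minus[OF gamma_mem]
  by (simp add: R_set_def)
lemma R_set_id: "(\<lambda>v\<in>tors. v) \<in> R_set"
  using L.endo_id E_mem[OF gamma_mem] by (simp add: R_set_def)
lemma R_set_null: "(\<lambda>v\<in>tors. 0) \<in> R_set"
  using L.endo_null E_mem[OF gamma_mem] L.endo_zero[OF gamma_mem] by (simp add: R_set_def)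
lemma residue_endo_R_set: "B \<in> carrier (residue_field p) \<Longrightarrow> residue_endo \<phi> p B \<in> R_set"
proof -
  assume B: "B \<in> carrier (residue_field p)"
  then obtain a where a: "B = residue_class p a" by (auto simp: carrier_residue)
  have "act a (gamma v) = gamma (act a v)" if "v \<in> tors" for v
    using that by (simp add: gamma_def act_frob tors_act)
  then show ?thesis using residue_endo_mem[OF B] E_mem[OF gamma_mem]
    by (simp add: R_set_def a residue_endo_eq tors_act)
qed

lemma subring_R_set: "subring R_set En"
  by (rule ring.subringI[OF ring_En])
    (auto simp: En_simps R_set_E R_set_id R_set_compose R_set_plus En_a_inv R_set_uminus)

lemma ring_R: "ring R"
  unfolding R_ring_eq by (rule ring.subring_is_ring[OF ring_En subring_R_set])

lemma R_simps:
  "\<zero>\<^bsub>R\<^esub> = (\<lambda>v\<in>tors. 0)"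
  "f \<otimes>\<^bsub>R\<^esub> g = compose tors f g" "f \<oplus>\<^bsub>R\<^esub> g = (\<lambda>v\<in>tors. f v + g v)"
  unfolding R_ring_eq using En_simps by simp_all

lemma left_idealD_R:
  assumes "left_ideal C R"
  shows "C \<subseteq> R_set" "(\<lambda>v\<in>tors. 0) \<in> C" "\<And>f g. f \<in> C \<Longrightarrow> g \<in> C \<Longrightarrow> (\<lambda>v\<in>tors. f v + g v) \<in> C"
    "\<And>f g. f \<in> R_set \<Longrightarrow> g \<in> C \<Longrightarrow> compose tors f g \<in> C"
proof -
  have a: "additive_subgroup C R" using assms by (simp add: left_ideal_def)
  show "C \<subseteq> R_set" using additive_subgroup.a_subset[OF a] by (simp add: R_carrier)
  show "(\<lambda>v\<in>tors. 0) \<in> C" using additive_subgroup.zero_closed[OF a] by (simp add: R_simps)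
  show "(\<lambda>v\<in>tors. f v + g v) \<in> C" if "f \<in> C" "g \<in> C" for f g
    using additive_subgroup.a_closed[OF a that] by (simp add: R_simps)
  show "compose tors f g \<in> C" if "f \<in> R_set" "g \<in> C" for f g
    using assms that by (simp add: left_ideal_def R_carrier R_simps)
qed

lemma additive_subgroup_En:
  assumes C: "C \<subseteq> L.E" "(\<lambda>v\<in>tors. 0) \<in> C" "\<And>f g. f \<in> C \<Longrightarrow> g \<in> C \<Longrightarrow> (\<lambda>v\<in>tors. f v + g v) \<in> C"
    "\<And>f. f \<in> C \<Longrightarrow> (\<lambda>v\<in>tors. - f v) \<in> C"
  shows "additive_subgroup C En"
proof -
  interpret En: ring En by (rule ring_En)
  show ?thesis
    by (intro additive_subgroup.intro En.add.subgroupI) (use C in \<open>auto simp: En_simps En_a_inv\<close>)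
qed

lemma left_idealI_R:
  assumes C: "C \<subseteq> R_set" "(\<lambda>v\<in>tors. 0) \<in> C" "\<And>f g. f \<in> C \<Longrightarrow> g \<in> C \<Longrightarrow> (\<lambda>v\<in>tors. f v + g v) \<in> C"
    "\<And>f g. f \<in> R_set \<Longrightarrow> g \<in> C \<Longrightarrow> compose tors f g \<in> C"
  shows "left_ideal C R"
proof -
  interpret R: ring "R" by (rule ring_R)
  have neg: "(\<lambda>v\<in>tors. - f v) \<in> C" if f: "f \<in> C" for f
  proof -
    have "compose tors (\<lambda>v\<in>tors. - (\<lambda>v\<in>tors. v) v) f = (\<lambda>v\<in>tors. - f v)"
      using E_mem[OF R_set_E[OF subsetD[OF C(1) f]]] by (auto simp: compose_def)
    then show ?thesis using C(4)[OF R_set_uminus[OF R_set_id] f] by simp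
  qed
  have R_inv: "\<ominus>\<^bsub>R\<^esub> f = (\<lambda>v\<in>tors. - f v)" if f: "f \<in> C" for f
    using f C(1) by (intro R.minus_equality) (auto simp: R_carrier R_simps R_set_uminus intro!: restrict_ext)
  have "additive_subgroup C R"
    by (intro additive_subgroup.intro R.add.subgroupI) (use C neg in \<open>auto simp: R_carrier R_simps R_inv\<close>)
  then show ?thesis using C(4) by (simp add: left_ideal_def R_carrier R_simps)
qed

abbreviation stable :: "'a alg_closure set \<Rightarrow> bool" where
  "stable W \<equiv> subspace (residue_field p) W (ac_module (class_act \<phi>) tors) \<and> (\<forall>w\<in>W. gamma w \<in> W)"

lemma subspace_stable_iff:
  "subspace (residue_field p) W (ac_module (class_act \<phi>) tors) \<longleftrightarrow>
    W \<subseteq> tors \<and> 0 \<in> W \<and> (\<forall>u\<in>W. \<forall>v\<in>W. u + v \<in> W) \<and> (\<forall>a. \<forall>v\<in>W. act a v \<in> W)"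
proof -
  have "(\<forall>B\<in>carrier (residue_field p). \<forall>v\<in>W. class_act \<phi> B v \<in> W) \<longleftrightarrow> (\<forall>a. \<forall>v\<in>W. act a v \<in> W)"
    if "W \<subseteq> tors" using that class_act by (auto simp: carrier_residue subset_iff)
  then show ?thesis unfolding L.subspace_iff by auto
qed

lemma subgroup_ac_module:
  "subgroup W (add_monoid (ac_module a U)) \<longleftrightarrow> subgroup W (add_monoid (ac_module b U))"
  by (simp add: subgroup_def m_inv_def)

lemma R0_submodule_iff: "R0_submodule \<phi> p r m W \<longleftrightarrow> stable W"
proof
  let ?V = "ac_module (class_act \<phi>) tors"
  {
    assume "R0_submodule \<phi> p r m W"
    then have s: "subgroup W (add_monoid ?V)"
      and sm: "\<And>x w. x \<in> generate_ring En R0_gens \<Longrightarrow> w \<in> W \<Longrightarrow> x w \<in> W"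
      using subgroup_ac_module
      by (auto simp: R0_submodule_def Module.submodule_def Module.submodule_axioms_def R0_carrier)
    have W: "W \<subseteq> tors" "0 \<in> W" "\<And>u v. u \<in> W \<Longrightarrow> v \<in> W \<Longrightarrow> u + v \<in> W"
      using subgroup.subset[OF s] subgroup.one_closed[OF s] subgroup.m_closed[OF s] by auto
    have "act a v \<in> W" if "v \<in> W" for a v
      using sm[OF residue_endo_R0[of "residue_class p a"] that] that W(1)
      by (auto simp: carrier_residue residue_endo_eq)
    then show "stable W" using W sm[OF gamma_R0] by (auto simp: subspace_stable_iff)
  }
  assume W: "stable W"
  note WD = L.subspaceD[OF conjunct1[OF W]]
  have WM: "W \<subseteq> tors" using WD(1) by simp
  have actW: "act a v \<in> W" if "v \<in> W" for a v using W that by (simp add: subspace_stable_iff)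
  have inv: "\<ominus>\<^bsub>?V\<^esub> w = - w" if "w \<in> W" for w using L.a_inv_V[of w] that WM by auto
  have "subgroup W (add_monoid ?V)"
    by (rule L.M.add.subgroupI) (use WD WM inv in auto)
  moreover have "x w \<in> W" if x: "x \<in> generate_ring En R0_gens" and w: "w \<in> W" for x w
    using x w
  proof (induction arbitrary: w rule: generate_ring.induct)
    case one
    then show ?case using WM by (auto simp: En_simps)
  next
    case (incl h)
    then show ?case using W WM actW by (auto simp: carrier_residue residue_endo_eq)
  next
    case (a_inv h)
    then show ?case using WD(5) WM by (auto simp: En_a_inv R0_mem)
  next
    case (eng_add h1 h2)
    then show ?case using WD(3) WM by (auto simp: En_simps)
  next
    case (eng_mult h1 h2)
    then show ?case using WM by (auto simp: En_simps compose_def)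
  qed
  ultimately show "R0_submodule \<phi> p r m W"
    using subgroup_ac_module
    by (auto simp: R0_submodule_def Module.submodule_def Module.submodule_axioms_def R0_carrier)
qed

lemma zero_set_eq: "Z C = {v \<in> tors. \<forall>f\<in>C. f v = 0}"
  by (simp add: zero_set_def)
lemma annihilator_eq: "Ann W = {f \<in> R_set. \<forall>v\<in>W. f v = 0}"
  by (simp add: annihilator_def R_carrier)

lemma zero_annihilator:
  assumes W: "stable W" shows "Z (Ann W) = W"
proof -
  obtain a b where "endo_descent (residue_field p) (ac_module (class_act \<phi>) tors) gamma (frob_inv m) s a b"
    by (rule torsion_endo_descent)
  then interpret D: endo_descent "residue_field p" "ac_module (class_act \<phi>) tors" gamma "frob_inv m" s a b .
  have "D.commutant = R_set" by (simp add: D.commutant_def R_set_def)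
  then show ?thesis using D.common_zeros_annihilator[of W] W by (simp add: zero_set_eq annihilator_eq)
qed

lemma annihilator_zero:
  assumes C: "left_ideal C R" shows "Ann (Z C) = C"
proof -
  obtain a b where "endo_descent (residue_field p) (ac_module (class_act \<phi>) tors) gamma (frob_inv m) s a b"
    by (rule torsion_endo_descent)
  then interpret D: endo_descent "residue_field p" "ac_module (class_act \<phi>) tors" gamma "frob_inv m" s a b .
  have "D.commutant = R_set" by (simp add: D.commutant_def R_set_def)
  then show ?thesis using D.annihilator_common_zeros[of C] left_idealD_R[OF C]
    by (simp add: zero_set_eq annihilator_eq)
qed

text \<open>
  The annihilator of \<open>W\<close> in \<open>E\<close> counted in two ways: by linear algebra, and through descent.
\<close>

lemma card_annihilator:
  assumes W: "stable W"
  obtains k where "CARD('a) ^ (n * d) = card W * CARD('a) ^ (d * k)"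
    "card (Ann W) ^ s = CARD('a) ^ (n * d * k)"
proof -
  obtain a b where "endo_descent (residue_field p) (ac_module (class_act \<phi>) tors) gamma (frob_inv m) s a b"
    by (rule torsion_endo_descent)
  then interpret D: endo_descent "residue_field p" "ac_module (class_act \<phi>) tors" gamma "frob_inv m" s a b .
  have "D.commutant = R_set" by (simp add: D.commutant_def R_set_def)
  then have 1: "card {f \<in> L.E. \<forall>w\<in>W. f w = 0} = card (Ann W) ^ s"
    using D.card_annihilator_commutant[of W] W by (simp add: annihilator_eq)
  obtain k where k: "card L.M = card W * card (carrier (residue_field p)) ^ k"
    "card {f \<in> L.E. \<forall>w\<in>W. f w = 0} = card L.M ^ k"
    by (rule L.card_endo_annihilator[OF conjunct1[OF W]])
  show thesis
    by (rule that[of k]) (use k in \<open>simp_all add: 1[symmetric] card_torsion card_kappa power_mult\<close>)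
qed

lemma zero_set_stable:
  assumes C: "left_ideal C R" shows "stable (Z C)"
proof -
  have fE: "f \<in> L.E" if "f \<in> C" for f using left_idealD_R(1)[OF C] that R_set_E by blast
  show ?thesis unfolding subspace_stable_iff zero_set_eq
  proof (intro conjI ballI allI)
    show "0 \<in> {v \<in> tors. \<forall>f\<in>C. f v = 0}" using L.endo_zero[OF fE] tors_0 by blast
    show "u + v \<in> {v \<in> tors. \<forall>f\<in>C. f v = 0}"
      if "u \<in> {v \<in> tors. \<forall>f\<in>C. f v = 0}" "v \<in> {v \<in> tors. \<forall>f\<in>C. f v = 0}" for u v
    proof -
      have "f (u + v) = 0" if "f \<in> C" for f
      proof -
        have "f u = 0" "f v = 0" using \<open>u \<in> _\<close> \<open>v \<in> _\<close> that by blast+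
        then show ?thesis using E_add[OF fE[OF that], of u v] \<open>u \<in> _\<close> \<open>v \<in> _\<close> by simp
      qed
      then show ?thesis using that tors_add by simp
    qed
    show "act a v \<in> {v \<in> tors. \<forall>f\<in>C. f v = 0}" if "v \<in> {v \<in> tors. \<forall>f\<in>C. f v = 0}" for a v
    proof -
      have "f (act a v) = 0" if "f \<in> C" for f
      proof -
        have "f (act a v) = act a (f v)" using fE[OF that] \<open>v \<in> _\<close> by (simp add: mem_E_iff)
        moreover have "f v = 0" using \<open>v \<in> _\<close> that by blast
        ultimately show ?thesis by simp
      qed
      then show ?thesis using that tors_act by simp
    qed
    show "gamma v \<in> {v \<in> tors. \<forall>f\<in>C. f v = 0}" if v: "v \<in> {v \<in> tors. \<forall>f\<in>C. f v = 0}" for v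
    proof -
      have "f (gamma v) = 0" if f: "f \<in> C" for f
      proof -
        have "f v = 0" using v f by blast
        then show ?thesis
          using v R_set_gamma[OF subsetD[OF left_idealD_R(1)[OF C] f], of v] L.endo_zero[OF gamma_mem] by simp
      qed
      then show ?thesis using v E_mem[OF gamma_mem] by simp
    qed
  qed blast
qed

lemma annihilator_left_ideal:
  assumes "W \<subseteq> tors" shows "left_ideal (Ann W) R"
  using assms unfolding annihilator_eq
  by (intro left_idealI_R) (auto simp: R_set_null R_set_plus R_set_compose compose_eq L.endo_zero[OF R_set_E] subset_iff)

lemma set_add_R: "C1 <+>\<^bsub>R\<^esub> C2 = {\<lambda>v\<in>tors. f v + g v | f g. f \<in> C1 \<and> g \<in> C2}"
  by (auto simp: set_add_def set_mult_def R_simps)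

lemma set_add_left_ideal:
  assumes C1: "left_ideal C1 R" and C2: "left_ideal C2 R"
  shows "left_ideal (C1 <+>\<^bsub>R\<^esub> C2) R"
proof (rule left_idealI_R)
  note D1 = left_idealD_R[OF C1] and D2 = left_idealD_R[OF C2]
  show "C1 <+>\<^bsub>R\<^esub> C2 \<subseteq> R_set" using D1(1) D2(1) R_set_plus by (auto simp: set_add_R)
  have "(\<lambda>v\<in>tors. (\<lambda>v\<in>tors. 0) v + (\<lambda>v\<in>tors. 0) v) \<in> C1 <+>\<^bsub>R\<^esub> C2"
    unfolding set_add_R using D1(2) D2(2) by blast
  then show "(\<lambda>v\<in>tors. 0) \<in> C1 <+>\<^bsub>R\<^esub> C2" by (simp cong: restrict_cong)
next
  note D1 = left_idealD_R[OF C1] and D2 = left_idealD_R[OF C2]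
  fix x y assume "x \<in> C1 <+>\<^bsub>R\<^esub> C2" "y \<in> C1 <+>\<^bsub>R\<^esub> C2"
  then obtain f g f' g' where xy: "f \<in> C1" "g \<in> C2" "x = (\<lambda>v\<in>tors. f v + g v)"
      "f' \<in> C1" "g' \<in> C2" "y = (\<lambda>v\<in>tors. f' v + g' v)"
    unfolding set_add_R by blast
  have "(\<lambda>v\<in>tors. x v + y v) = (\<lambda>v\<in>tors. (\<lambda>v\<in>tors. f v + f' v) v + (\<lambda>v\<in>tors. g v + g' v) v)"
    using xy by (intro restrict_ext) simp
  then show "(\<lambda>v\<in>tors. x v + y v) \<in> C1 <+>\<^bsub>R\<^esub> C2"
    unfolding set_add_R using D1(3)[OF xy(1,4)] D2(3)[OF xy(2,5)] by blast
next
  note D1 = left_idealD_R[OF C1] and D2 = left_idealD_R[OF C2]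
  fix h x assume h: "h \<in> R_set" and "x \<in> C1 <+>\<^bsub>R\<^esub> C2"
  then obtain f g where x: "f \<in> C1" "g \<in> C2" "x = (\<lambda>v\<in>tors. f v + g v)" unfolding set_add_R by blast
  have "f \<in> L.E" "g \<in> L.E" using x D1(1) D2(1) R_set_E by auto
  then have "compose tors h x = (\<lambda>v\<in>tors. compose tors h f v + compose tors h g v)"
    unfolding x(3) compose_def by (intro restrict_ext) (simp add: E_mem E_add[OF R_set_E[OF h]])
  then show "compose tors h x \<in> C1 <+>\<^bsub>R\<^esub> C2"
    unfolding set_add_R using D1(4)[OF h x(1)] D2(4)[OF h x(2)] by blast
qed

lemma zero_set_add:
  assumes C1: "left_ideal C1 R" and C2: "left_ideal C2 R"
  shows "Z (C1 <+>\<^bsub>R\<^esub> C2) = Z C1 \<inter> Z C2"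
proof
  note D1 = left_idealD_R[OF C1] and D2 = left_idealD_R[OF C2]
  show "Z C1 \<inter> Z C2 \<subseteq> Z (C1 <+>\<^bsub>R\<^esub> C2)"
    by (auto simp: zero_set_eq set_add_R)
  show "Z (C1 <+>\<^bsub>R\<^esub> C2) \<subseteq> Z C1 \<inter> Z C2"
  proof
    fix v assume v: "v \<in> Z (C1 <+>\<^bsub>R\<^esub> C2)"
    then have z: "f v + g v = 0" if "f \<in> C1" "g \<in> C2" for f g
    proof -
      have "(\<lambda>v\<in>tors. f v + g v) \<in> C1 <+>\<^bsub>R\<^esub> C2" unfolding set_add_R using that by blast
      then have "(\<lambda>v\<in>tors. f v + g v) v = 0" "v \<in> tors" using v unfolding zero_set_eq by blast+
      then show ?thesis by simp
    qed
    have vt: "v \<in> tors" using v by (simp add: zero_set_eq)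
    have "f v = 0" if "f \<in> C1" for f using z[OF that D2(2)] vt by simp
    moreover have "g v = 0" if "g \<in> C2" for g using z[OF D1(2) that] vt by simp
    ultimately show "v \<in> Z C1 \<inter> Z C2" using vt by (simp add: zero_set_eq)
  qed
qed

lemma stable_sum:
  assumes W1: "stable W1" and W2: "stable W2"
  shows "stable {v + w | v w. v \<in> W1 \<and> w \<in> W2}"
proof -
  have g: "gamma (u + w) = gamma u + gamma w" if "u \<in> W1" "w \<in> W2" for u w
    using that W1 W2 by (intro E_add[OF gamma_mem]) (auto simp: subspace_stable_iff)
  have add: "\<exists>v' w'. v + w + (v2 + w2) = v' + w' \<and> v' \<in> W1 \<and> w' \<in> W2"
    if "v \<in> W1" "v2 \<in> W1" "w \<in> W2" "w2 \<in> W2" for v w v2 w2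
    using that W1 W2 by (intro exI[of _ "v + v2"] exI[of _ "w + w2"]) (simp add: subspace_stable_iff algebra_simps)
  show ?thesis unfolding subspace_stable_iff
  proof (intro conjI ballI allI)
    show "{v + w | v w. v \<in> W1 \<and> w \<in> W2} \<subseteq> tors"
      using W1 W2 tors_add by (auto simp: subspace_stable_iff subset_iff)
    have "0 = 0 + (0 :: 'a alg_closure)" by simp
    then show "0 \<in> {v + w | v w. v \<in> W1 \<and> w \<in> W2}" using W1 W2 unfolding subspace_stable_iff by blast
    show "x + y \<in> {v + w | v w. v \<in> W1 \<and> w \<in> W2}"
      if "x \<in> {v + w | v w. v \<in> W1 \<and> w \<in> W2}" "y \<in> {v + w | v w. v \<in> W1 \<and> w \<in> W2}" for x y
      using that add by blast
    show "act a x \<in> {v + w | v w. v \<in> W1 \<and> w \<in> W2}" if "x \<in> {v + w | v w. v \<in> W1 \<and> w \<in> W2}" for a x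
      using that W1 W2 act_add unfolding subspace_stable_iff by blast
    show "gamma x \<in> {v + w | v w. v \<in> W1 \<and> w \<in> W2}" if "x \<in> {v + w | v w. v \<in> W1 \<and> w \<in> W2}" for x
      using that W1 W2 g unfolding subspace_stable_iff by blast
  qed
qed

lemma annihilator_sum:
  assumes W1: "stable W1" and W2: "stable W2"
  shows "Ann {v + w | v w. v \<in> W1 \<and> w \<in> W2} =
    Ann W1 \<inter> Ann W2"
proof
  have 0: "0 \<in> W1" "0 \<in> W2" and sub: "W1 \<subseteq> tors" "W2 \<subseteq> tors" using W1 W2 by (auto simp: subspace_stable_iff)
  show "Ann {v + w | v w. v \<in> W1 \<and> w \<in> W2} \<subseteq> Ann W1 \<inter> Ann W2"
  proof
    fix f assume "f \<in> Ann {v + w | v w. v \<in> W1 \<and> w \<in> W2}"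
    then have f: "f \<in> R_set" and z: "\<And>v w. v \<in> W1 \<Longrightarrow> w \<in> W2 \<Longrightarrow> f (v + w) = 0"
      unfolding annihilator_eq by blast+
    have "f v = 0" if "v \<in> W1" for v using z[OF that 0(2)] by simp
    moreover have "f w = 0" if "w \<in> W2" for w using z[OF 0(1) that] by simp
    ultimately show "f \<in> Ann W1 \<inter> Ann W2" using f by (simp add: annihilator_eq)
  qed
  show "Ann W1 \<inter> Ann W2 \<subseteq> Ann {v + w | v w. v \<in> W1 \<and> w \<in> W2}"
    using sub by (auto simp: annihilator_eq E_add[OF R_set_E] subset_iff)
qed

text \<open>
  Both sides are stable subspaces and have the annihilator \<open>C1 \<inter> C2\<close>.
\<close>

lemma zero_set_inter:
  assumes C1: "left_ideal C1 R" and C2: "left_ideal C2 R"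
  shows "Z (C1 \<inter> C2) = {v + w | v w. v \<in> Z C1 \<and> w \<in> Z C2}"
proof -
  let ?W = "{v + w | v w. v \<in> Z C1 \<and> w \<in> Z C2}"
  have "Ann ?W = C1 \<inter> C2"
    using annihilator_sum[OF zero_set_stable[OF C1] zero_set_stable[OF C2]]
    by (simp only: annihilator_zero[OF C1] annihilator_zero[OF C2])
  then show ?thesis
    using zero_annihilator[OF stable_sum[OF zero_set_stable[OF C1] zero_set_stable[OF C2]]] by simp
qed

text \<open>
  Both sides are left ideals and have the common zeros \<open>W1 \<inter> W2\<close>.
\<close>

lemma annihilator_inter:
  assumes W1: "stable W1" and W2: "stable W2"
  shows "Ann (W1 \<inter> W2) =
    Ann W1 <+>\<^bsub>R\<^esub> Ann W2"
proof -
  have sub: "W1 \<subseteq> tors" "W2 \<subseteq> tors" using W1 W2 by (auto simp: subspace_stable_iff)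
  note I1 = annihilator_left_ideal[OF sub(1)] and I2 = annihilator_left_ideal[OF sub(2)]
  have "Z (Ann W1 <+>\<^bsub>R\<^esub> Ann W2) = W1 \<inter> W2"
    using zero_set_add[OF I1 I2] by (simp add: zero_annihilator[OF W1] zero_annihilator[OF W2])
  then show ?thesis using annihilator_zero[OF set_add_left_ideal[OF I1 I2]] by simp
qed

lemma residue_endo_hom: "residue_endo \<phi> p \<in> ring_hom (residue_field p) En"
proof (rule ring_hom_memI)
  show "residue_endo \<phi> p x \<in> carrier En" if "x \<in> carrier (residue_field p)" for x
    using residue_endo_mem[OF that] by (simp add: En_simps)
qed (auto simp: carrier_residue residue_class_mult residue_class_add residue_class_one residue_endo_eq En_simps
    compose_def act_mult_poly act_add_poly tors_act intro!: restrict_ext)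

lemma left_ideal_En:
  assumes C: "left_ideal C R" shows "additive_subgroup C En"
proof (rule additive_subgroup_En)
  note D = left_idealD_R[OF C]
  show "C \<subseteq> L.E" using D(1) R_set_E by blast
  show "(\<lambda>v\<in>tors. - f v) \<in> C" if f: "f \<in> C" for f
  proof -
    have "compose tors (\<lambda>v\<in>tors. - (\<lambda>v\<in>tors. v) v) f = (\<lambda>v\<in>tors. - f v)"
      using E_mem[OF R_set_E[OF subsetD[OF D(1) f]]] by (auto simp: compose_def)
    then show ?thesis using D(4)[OF R_set_uminus[OF R_set_id] f] by simp
  qed
qed (use left_idealD_R[OF C] in auto)

lemma finite_R_set: "finite R_set"
proof (rule finite_subset)
  show "R_set \<subseteq> tors \<rightarrow>\<^sub>E tors" by (auto simp: R_set_def mem_E_iff PiE_def)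
  show "finite (tors \<rightarrow>\<^sub>E tors)" by (intro finite_PiE finite_torsion)
qed

lemma card_dim_kappa_R:
  assumes C: "left_ideal C R"
  shows "card C = CARD('a) ^ (d * dim_kappa_R \<phi> p C)"
proof -
  have "vectorspace (residue_field p) (left_mult_module En (residue_endo \<phi> p) C)"
    using left_idealD_R(4)[OF C residue_endo_R_set]
    by (intro left_mult_vectorspace[OF ring_En field_residue[OF p_irred] residue_endo_hom left_ideal_En[OF C]])
      (simp add: En_simps)
  then interpret W: vectorspace "residue_field p" "left_mult_module En (residue_endo \<phi> p) C" .
  have "finite C" using finite_subset[OF left_idealD_R(1)[OF C] finite_R_set] .
  then show ?thesis
    using W.card_carrier_eq_power_dim
    by (simp add: left_mult_module_def[of En] dim_kappa_R_def card_kappa power_mult)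
qed

lemma card_dim_kappa_M:
  assumes W: "stable W" shows "card W = CARD('a) ^ (d * dim_kappa_M \<phi> p W)"
proof -
  have "vectorspace (residue_field p) (ac_module (class_act \<phi>) W)"
    using L.subspace_is_vs[OF conjunct1[OF W]] by simp
  then interpret W: vectorspace "residue_field p" "ac_module (class_act \<phi>) W" .
  have "finite W" using W finite_torsion by (auto simp: subspace_stable_iff intro: finite_subset)
  then show ?thesis
    using W.card_carrier_eq_power_dim by (simp add: dim_kappa_M_def card_kappa power_mult)
qed

lemma q_power_inj: "CARD('a) ^ i = CARD('a) ^ j \<longleftrightarrow> i = j"
  using two_le_card_field[where 'a = 'a] by (intro power_inject_exp) simp

text \<open>
  With \<open>e = dim W\<close> the two counts give \<open>k = n - e\<close> and \<open>|Ann W|\<^sup>s = q\<^sup>n\<^sup>d\<^sup>k\<close>; as \<open>n = m s\<close>, the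
  \<open>s\<close>-th root is \<open>q\<^sup>d\<^sup>m\<^sup>k\<close>.
\<close>

lemma card_annihilator_dim:
  assumes W: "stable W"
  shows "dim_kappa_M \<phi> p W \<le> n" "card (Ann W) = CARD('a) ^ (d * (m * (n - dim_kappa_M \<phi> p W)))"
    "dim_kappa_R \<phi> p (Ann W) = m * (n - dim_kappa_M \<phi> p W)"
proof -
  let ?e = "dim_kappa_M \<phi> p W"
  have I: "left_ideal (Ann W) R"
    using W by (intro annihilator_left_ideal) (simp add: subspace_stable_iff)
  let ?h = "dim_kappa_R \<phi> p (Ann W)"
  obtain k where k: "CARD('a) ^ (n * d) = card W * CARD('a) ^ (d * k)"
    "card (Ann W) ^ s = CARD('a) ^ (n * d * k)"
    by (rule card_annihilator[OF W])
  have "CARD('a) ^ (n * d) = CARD('a) ^ (d * ?e + d * k)"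
    using k(1) card_dim_kappa_M[OF W] by (simp add: power_add)
  then have "d * n = d * (?e + k)" unfolding q_power_inj by (simp add: algebra_simps)
  then have nk: "n = ?e + k" using d_pos by simp
  have "CARD('a) ^ (d * ?h * s) = CARD('a) ^ (n * d * k)"
    using k(2) card_dim_kappa_R[OF I] by (simp add: power_mult)
  then have "d * ?h * s = n * d * k" unfolding q_power_inj .
  then have "s * d * ?h = s * d * (m * k)" using m_s by (simp add: mult_ac)
  then have h: "?h = m * k" using s_pos d_pos by simp
  show "?e \<le> n" using nk by simp
  show "?h = m * (n - ?e)" using h nk by simp
  then show "card (Ann W) = CARD('a) ^ (d * (m * (n - ?e)))"
    using card_dim_kappa_R[OF I] by simp
qed

lemma galois_bijections:
  "bij_betw (Z) {C. left_ideal C R} {W. R0_submodule \<phi> p r m W}"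
  "bij_betw (Ann) {W. R0_submodule \<phi> p r m W} {C. left_ideal C R}"
proof -
  have Z: "Z ` {C. left_ideal C R} \<subseteq> {W. R0_submodule \<phi> p r m W}"
    using zero_set_stable by (auto simp: R0_submodule_iff)
  have A: "Ann ` {W. R0_submodule \<phi> p r m W} \<subseteq> {C. left_ideal C R}"
    using annihilator_left_ideal by (auto simp: R0_submodule_iff subspace_stable_iff)
  have ZA: "\<forall>W\<in>{W. R0_submodule \<phi> p r m W}. Z (Ann W) = W"
    using zero_annihilator by (auto simp: R0_submodule_iff)
  have AZ: "\<forall>C\<in>{C. left_ideal C R}. Ann (Z C) = C"
    using annihilator_zero by auto
  show "bij_betw (Z) {C. left_ideal C R} {W. R0_submodule \<phi> p r m W}"
    by (rule bij_betw_byWitness[OF AZ ZA Z A])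
  show "bij_betw (Ann) {W. R0_submodule \<phi> p r m W} {C. left_ideal C R}"
    by (rule bij_betw_byWitness[OF ZA AZ A Z])
qed

end

section \<open>The field generated by the scalars\<close>

lemma cring_Fq_ext: "cring (Fq_ext k :: 'a::{finite,field} alg_closure ring)"
proof -
  interpret R: ring "Fq_ext k :: 'a alg_closure ring"
    unfolding Fq_ext_def by (rule ring.subring_is_ring[OF ring_from_type_algebra subring_Fq_fixed])
  show ?thesis
    by (intro cring.intro comm_monoid.intro comm_monoid_axioms.intro R.ring_axioms R.monoid_axioms)
      (simp add: mult.commute)
qed

lemma field_Fq_ext: "Ring.field (Fq_ext k :: 'a::{finite,field} alg_closure ring)"
proof (rule cring.cring_fieldI2[OF cring_Fq_ext])
  show "\<zero>\<^bsub>Fq_ext k\<^esub> \<noteq> \<one>\<^bsub>Fq_ext k\<^esub>" by simp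
  fix x :: "'a alg_closure" assume "x \<in> carrier (Fq_ext k)" "x \<noteq> \<zero>\<^bsub>Fq_ext k\<^esub>"
  then show "\<exists>y\<in>carrier (Fq_ext k). x \<otimes>\<^bsub>Fq_ext k\<^esub> y = \<one>\<^bsub>Fq_ext k\<^esub>"
    by (intro bexI[of _ "inverse x"]) (auto simp: frob_pow_inverse)
qed

context drinfeld_torsion
begin

lemma fixed_m_n: "frob_pow m \<zeta> = \<zeta> \<Longrightarrow> frob_pow n \<zeta> = \<zeta>"
  using frob_pow_fixed_mult[of m \<zeta> s] m_s by simp

text \<open>
  The endomorphism given by the tensor \<open>\<Sum>\<^sub>i \<zeta>\<^sub>i \<otimes> T\<^sup>i\<close>. As \<open>1, T, \<dots>, T\<^sup>d\<^sup>-\<^sup>1\<close> is a basis of \<open>\<kappa>\<close>, every element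
  of \<open>K\<close> has this form.
\<close>

definition tensor_endo :: "(nat \<Rightarrow> 'a alg_closure) \<Rightarrow> 'a alg_closure \<Rightarrow> 'a alg_closure" where
  "tensor_endo \<zeta> = (\<lambda>v\<in>tors. \<Sum>i<d. \<zeta> i * act (monom 1 i) v)"

definition K_set :: "('a alg_closure \<Rightarrow> 'a alg_closure) set" where
  "K_set = {tensor_endo \<zeta> | \<zeta>. \<forall>i. frob_pow m (\<zeta> i) = \<zeta> i}"

lemma act_sum_poly: "act (sum f I) v = (\<Sum>i\<in>I. act (f i) v)"
  by (induction I rule: infinite_finite_induct) (auto simp: act_add_poly)

lemma act_monom: "act (monom c i) v = to_ac c * act (monom 1 i) v"
proof -
  have "monom c i = [:c:] * monom 1 i" by (simp add: smult_monom)
  then show ?thesis by (simp only: act_mult_poly act_const)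
qed

lemma act_expand:
  assumes v: "v \<in> tors"
  shows "act a v = (\<Sum>i<d. to_ac (coeff (a mod p) i) * act (monom 1 i) v)"
proof -
  have "p dvd a - a mod p" by (simp add: minus_mod_eq_mult_div)
  then have 1: "act a v = act (a mod p) v" by (rule act_cong[OF _ v])
  have "p \<noteq> 0" using p_irred by auto
  then have "a mod p = 0 \<or> degree (a mod p) < d" using degree_mod_less[of p a] p_deg by simp
  then have "degree (a mod p) < d" using d_pos by auto
  then have "a mod p = (\<Sum>i\<le>d - 1. monom (coeff (a mod p) i) i)"
    by (intro poly_as_sum_of_monoms'[symmetric]) simp
  also have "{..d - 1} = {..<d}" using d_pos by auto
  finally have e: "a mod p = (\<Sum>i<d. monom (coeff (a mod p) i) i)" .
  have "act (a mod p) v = act (\<Sum>i<d. monom (coeff (a mod p) i) i) v" using e by (rule arg_cong)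
  also have "\<dots> = (\<Sum>i<d. act (monom (coeff (a mod p) i) i) v)" by (rule act_sum_poly)
  also have "\<dots> = (\<Sum>i<d. to_ac (coeff (a mod p) i) * act (monom 1 i) v)"
    by (intro sum.cong refl) (rule act_monom)
  finally show ?thesis using 1 by simp
qed

lemma K_set_add: "f \<in> K_set \<Longrightarrow> g \<in> K_set \<Longrightarrow> (\<lambda>v\<in>tors. f v + g v) \<in> K_set"
proof -
  assume "f \<in> K_set" "g \<in> K_set"
  then obtain \<zeta> \<xi> where "f = tensor_endo \<zeta>" "g = tensor_endo \<xi>" "\<forall>i. frob_pow m (\<zeta> i) = \<zeta> i" "\<forall>i. frob_pow m (\<xi> i) = \<xi> i"
    by (auto simp: K_set_def)
  then have "(\<lambda>v\<in>tors. f v + g v) = tensor_endo (\<lambda>i. \<zeta> i + \<xi> i) \<and> (\<forall>i. frob_pow m (\<zeta> i + \<xi> i) = \<zeta> i + \<xi> i)"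
    by (auto simp: tensor_endo_def frob_pow_add distrib_right sum.distrib intro!: restrict_ext)
  then show ?thesis unfolding K_set_def by blast
qed

lemma K_set_pure:
  assumes "frob_pow m \<zeta> = \<zeta>"
  shows "(\<lambda>v\<in>tors. \<zeta> * act a v) \<in> K_set"
proof -
  have "(\<lambda>v\<in>tors. \<zeta> * act a v) = tensor_endo (\<lambda>i. \<zeta> * to_ac (coeff (a mod p) i))"
    unfolding tensor_endo_def by (intro restrict_ext) (simp add: act_expand[of _ a] sum_distrib_left mult.assoc)
  moreover have "\<forall>i. frob_pow m (\<zeta> * to_ac (coeff (a mod p) i)) = \<zeta> * to_ac (coeff (a mod p) i)"
    by (simp add: frob_pow_mult assms)
  ultimately show ?thesis unfolding K_set_def by blast
qed

lemma K_set_sum: "(\<And>i. i \<in> I \<Longrightarrow> f i \<in> K_set) \<Longrightarrow> (\<lambda>v\<in>tors. \<Sum>i\<in>I. f i v) \<in> K_set"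
proof (induction I rule: infinite_finite_induct)
  case (insert i I)
  then have "(\<lambda>v\<in>tors. f i v + (\<lambda>v\<in>tors. \<Sum>i\<in>I. f i v) v) \<in> K_set" by (intro K_set_add) auto
  moreover have "(\<lambda>v\<in>tors. f i v + (\<lambda>v\<in>tors. \<Sum>i\<in>I. f i v) v) = (\<lambda>v\<in>tors. \<Sum>i\<in>insert i I. f i v)"
    using insert.hyps by (intro restrict_ext) simp
  ultimately show ?case by (simp only:)
qed (use K_set_pure[of 0 0] in \<open>simp_all cong: restrict_cong\<close>)

lemma K_set_E: "f \<in> K_set \<Longrightarrow> f \<in> L.E"
proof -
  assume "f \<in> K_set"
  then obtain \<zeta> where f: "f = tensor_endo \<zeta>" "\<And>i. frob_pow n (\<zeta> i) = \<zeta> i" by (auto simp: K_set_def fixed_m_n)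
  have "(\<lambda>v\<in>tors. \<zeta> i * act (monom 1 i) v) \<in> L.E" for i
  proof (intro restrict_endo)
    show "\<zeta> i * act (monom 1 i) (u + v) = \<zeta> i * act (monom 1 i) u + \<zeta> i * act (monom 1 i) v" for u v
      by (simp add: act_add distrib_left)
    show "\<zeta> i * act (monom 1 i) (act a v) = act a (\<zeta> i * act (monom 1 i) v)" for a v
      by (simp add: act_scalar[OF f(2)] act_act)
  qed (intro tors_scalar f(2) tors_act)
  then have "(\<lambda>v\<in>tors. \<Sum>i<d. (\<lambda>v\<in>tors. \<zeta> i * act (monom 1 i) v) v) \<in> L.E"
    using L.endo_setsum[of "{..<d}" "\<lambda>i. \<lambda>v\<in>tors. \<zeta> i * act (monom 1 i) v"] by simp
  then show ?thesis by (simp add: f(1) tensor_endo_def cong: restrict_cong)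
qed

lemma K_set_apply: "f \<in> K_set \<Longrightarrow> v \<in> tors \<Longrightarrow> f v \<in> tors" by (rule E_mem[OF K_set_E])

lemma K_set_scalar: "f \<in> K_set \<Longrightarrow> frob_pow n \<xi> = \<xi> \<Longrightarrow> v \<in> tors \<Longrightarrow> f (\<xi> * v) = \<xi> * f v"
proof -
  assume f: "f \<in> K_set" and x: "frob_pow n \<xi> = \<xi>" and v: "v \<in> tors"
  obtain \<zeta> where "f = tensor_endo \<zeta>" using f by (auto simp: K_set_def)
  then show ?thesis using v tors_scalar[OF x v]
    by (simp add: tensor_endo_def act_scalar[OF x] sum_distrib_left mult_ac)
qed

lemma K_set_mult:
  assumes f: "f \<in> K_set" and g: "g \<in> K_set" shows "compose tors f g \<in> K_set"
proof -
  obtain \<zeta> where z: "f = tensor_endo \<zeta>" "\<And>i. frob_pow m (\<zeta> i) = \<zeta> i" using f by (auto simp: K_set_def)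
  obtain \<xi> where x: "g = tensor_endo \<xi>" "\<And>i. frob_pow m (\<xi> i) = \<xi> i" using g by (auto simp: K_set_def)
  have "compose tors f g = (\<lambda>v\<in>tors. \<Sum>i<d. (\<lambda>v\<in>tors. \<Sum>j<d.
      (\<lambda>v\<in>tors. (\<zeta> i * \<xi> j) * act (monom 1 i * monom 1 j) v) v) v)"
  proof (rule extensionalityI[of _ tors])
    fix v assume v: "v \<in> tors"
    then have "compose tors f g v = tensor_endo \<zeta> (tensor_endo \<xi> v)" by (simp add: compose_def z x)
    also have "\<dots> = (\<Sum>i<d. \<zeta> i * act (monom 1 i) (\<Sum>j<d. \<xi> j * act (monom 1 j) v))"
      using v K_set_apply[OF g v] by (simp add: tensor_endo_def x(1))
    also have "\<dots> = (\<Sum>i<d. \<Sum>j<d. (\<zeta> i * \<xi> j) * act (monom 1 i * monom 1 j) v)"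
      by (simp add: act_sum act_scalar[OF fixed_m_n[OF x(2)]] act_mult_poly sum_distrib_left mult.assoc del: mult_monom)
    finally show "compose tors f g v = (\<lambda>v\<in>tors. \<Sum>i<d. (\<lambda>v\<in>tors. \<Sum>j<d.
      (\<lambda>v\<in>tors. (\<zeta> i * \<xi> j) * act (monom 1 i * monom 1 j) v) v) v) v" using v by simp
  qed auto
  moreover have "\<dots> \<in> K_set"
    by (intro K_set_sum K_set_pure) (simp add: frob_pow_mult z(2) x(2))
  ultimately show ?thesis by simp
qed

lemma K_set_comm:
  assumes f: "f \<in> K_set" and g: "g \<in> K_set" shows "compose tors f g = compose tors g f"
proof (rule extensionalityI[of _ tors])
  fix v assume v: "v \<in> tors"
  obtain \<zeta> where z: "f = tensor_endo \<zeta>" "\<And>i. frob_pow m (\<zeta> i) = \<zeta> i" using f by (auto simp: K_set_def)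
  have gE: "g \<in> L.E" by (rule K_set_E[OF g])
  have gs: "g (\<Sum>i<d. \<zeta> i * act (monom 1 i) v) = (\<Sum>i<d. g (\<zeta> i * act (monom 1 i) v))"
    by (rule L.endo_sum[OF gE]) (simp add: tors_scalar[OF fixed_m_n[OF z(2)]] tors_act v)
  have ga: "g (act a v) = act a (g v)" for a using gE v by (simp add: mem_E_iff)
  have "g (f v) = (\<Sum>i<d. g (\<zeta> i * act (monom 1 i) v))" using v gs by (simp add: z(1) tensor_endo_def)
  also have "\<dots> = (\<Sum>i<d. \<zeta> i * act (monom 1 i) (g v))"
    by (intro sum.cong refl) (simp add: K_set_scalar[OF g fixed_m_n[OF z(2)]] tors_act v ga)
  also have "\<dots> = f (g v)" using K_set_apply[OF g v] by (simp add: z(1) tensor_endo_def)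
  finally show "compose tors f g v = compose tors g f v" using v by (simp add: compose_def)
qed auto

lemma scalar_residue_pure:
  assumes "frob_pow m \<zeta> = \<zeta>"
  shows "scalar_endo \<phi> p \<zeta> \<otimes>\<^bsub>En\<^esub> residue_endo \<phi> p (residue_class p a) = (\<lambda>v\<in>tors. \<zeta> * act a v)"
  by (rule extensionalityI[of _ tors]) (auto simp: En_simps scalar_endo_def residue_endo_eq compose_def tors_act)

lemma K_carrier: "carrier K = K_set"
proof
  show "carrier K \<subseteq> K_set"
  proof
    fix f assume "f \<in> carrier K"
    then obtain N \<zeta> x where f: "f = (\<Oplus>\<^bsub>En\<^esub>i\<in>{..<N::nat}. scalar_endo \<phi> p (\<zeta> i) \<otimes>\<^bsub>En\<^esub> residue_endo \<phi> p (x i))"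
      and z: "\<zeta> \<in> {..<N} \<rightarrow> carrier (Fq_ext m)" and x: "x \<in> {..<N} \<rightarrow> carrier (residue_field p)"
      by (auto simp: K_ring_def)
    have t: "scalar_endo \<phi> p (\<zeta> i) \<otimes>\<^bsub>En\<^esub> residue_endo \<phi> p (x i) \<in> K_set" if "i < N" for i
    proof -
      obtain a where "x i = residue_class p a" using x \<open>i < N\<close> by (force simp: carrier_residue)
      moreover have "frob_pow m (\<zeta> i) = \<zeta> i" using z \<open>i < N\<close> by (auto simp: Pi_iff)
      ultimately show ?thesis using scalar_residue_pure K_set_pure by simp
    qed
    then have "f = (\<lambda>v\<in>tors. \<Sum>i<N. (scalar_endo \<phi> p (\<zeta> i) \<otimes>\<^bsub>En\<^esub> residue_endo \<phi> p (x i)) v)"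
      unfolding f by (intro En_finsum K_set_E) auto
    then show "f \<in> K_set" using t by (simp only:) (intro K_set_sum, auto)
  qed
  show "K_set \<subseteq> carrier K"
  proof
    fix f assume "f \<in> K_set"
    then obtain \<zeta> where z: "f = tensor_endo \<zeta>" "\<And>i. frob_pow m (\<zeta> i) = \<zeta> i" by (auto simp: K_set_def)
    let ?t = "\<lambda>i. scalar_endo \<phi> p (\<zeta> i) \<otimes>\<^bsub>En\<^esub> residue_endo \<phi> p (residue_class p (monom 1 i))"
    have "(\<Oplus>\<^bsub>En\<^esub>i\<in>{..<d}. ?t i) = (\<lambda>v\<in>tors. \<Sum>i<d. ?t i v)"
      by (intro En_finsum) (auto simp: scalar_residue_pure z(2) intro!: K_set_E K_set_pure)
    also have "\<dots> = f"
      unfolding z(1) tensor_endo_def by (intro restrict_ext sum.cong refl) (simp add: scalar_residue_pure z(2))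
    finally have "f = (\<Oplus>\<^bsub>En\<^esub>i\<in>{..<d}. ?t i)" by simp
    moreover have "\<zeta> \<in> {..<d} \<rightarrow> carrier (Fq_ext m)" using z(2) by simp
    moreover have "(\<lambda>i. residue_class p (monom 1 i)) \<in> {..<d} \<rightarrow> carrier (residue_field p)" by (simp add: carrier_residue)
    ultimately show "f \<in> carrier K" unfolding K_ring_def by fastforce
  qed
qed

lemma K_ring_eq: "K = En\<lparr>carrier := K_set\<rparr>"
  using K_carrier by (simp add: K_ring_def)

lemma K_set_id: "(\<lambda>v\<in>tors. v) \<in> K_set" using K_set_pure[of 1 1] by simp
lemma K_set_null: "(\<lambda>v\<in>tors. 0) \<in> K_set" using K_set_pure[of 0 0] by simp
lemma K_set_uminus: "f \<in> K_set \<Longrightarrow> (\<lambda>v\<in>tors. - f v) \<in> K_set"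
proof -
  assume f: "f \<in> K_set"
  have "(\<lambda>v\<in>tors. - 1 * act 1 v) \<in> K_set" by (intro K_set_pure) (simp add: frob_pow_minus)
  then have "compose tors (\<lambda>v\<in>tors. - 1 * act 1 v) f \<in> K_set" using f by (rule K_set_mult)
  moreover have "compose tors (\<lambda>v\<in>tors. - 1 * act 1 v) f = (\<lambda>v\<in>tors. - f v)"
    by (rule extensionalityI[of _ tors]) (auto simp: compose_def K_set_apply[OF f])
  ultimately show ?thesis by simp
qed

lemma subring_K_set: "subring K_set En"
  by (rule ring.subringI[OF ring_En])
    (auto simp: En_simps K_set_E K_set_id K_set_mult K_set_add En_a_inv K_set_uminus)

lemma K_set_R_set: "K_set \<subseteq> R_set"
proof
  fix f assume f: "f \<in> K_set"
  obtain \<zeta> where z: "f = tensor_endo \<zeta>" "\<And>i. frob_pow m (\<zeta> i) = \<zeta> i" using f by (auto simp: K_set_def)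
  have zg: "frob_pow (r * m) (\<zeta> i) = \<zeta> i" for i
    using frob_pow_fixed_mult[OF z(2), of r] by (simp add: mult.commute)
  have "f (gamma v) = gamma (f v)" if v: "v \<in> tors" for v
    using v tors_frob[OF v] K_set_apply[OF f v]
    by (simp add: gamma_def z(1) tensor_endo_def act_frob frob_pow_sum frob_pow_mult zg)
  then show "f \<in> R_set" using K_set_E[OF f] by (simp add: R_set_def)
qed

lemma cring_K: "cring K"
proof -
  interpret K: ring "K" unfolding K_ring_eq by (rule ring.subring_is_ring[OF ring_En subring_K_set])
  show ?thesis
    by (intro cring.intro comm_monoid.intro comm_monoid_axioms.intro K.ring_axioms K.monoid_axioms)
      (auto simp: K_carrier K_ring_eq En_simps K_set_comm)
qed

lemma finite_K_set: "finite K_set" and card_K_set_le: "card K_set \<le> CARD('a) ^ (m * d)"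
proof -
  let ?F = "{x :: 'a alg_closure. frob_pow m x = x}"
  have "K_set \<subseteq> tensor_endo ` ({..<d} \<rightarrow>\<^sub>E ?F)"
  proof
    fix f assume "f \<in> K_set"
    then obtain \<zeta> where z: "f = tensor_endo \<zeta>" "\<And>i. frob_pow m (\<zeta> i) = \<zeta> i" by (auto simp: K_set_def)
    have "tensor_endo \<zeta> = tensor_endo (restrict \<zeta> {..<d})" by (simp add: tensor_endo_def)
    then show "f \<in> tensor_endo ` ({..<d} \<rightarrow>\<^sub>E ?F)" using z by auto
  qed
  moreover have fin: "finite ({..<d} \<rightarrow>\<^sub>E ?F)" using Fq_fixed_finite[OF m_pos] by (intro finite_PiE) auto
  ultimately show "finite K_set" using finite_surj by blast
  have "card K_set \<le> card ({..<d} \<rightarrow>\<^sub>E ?F)"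
    using surj_card_le[OF fin \<open>K_set \<subseteq> _\<close>] .
  also have "\<dots> = CARD('a) ^ (m * d)"
    by (simp add: card_funcsetE card_Fq_fixed[OF m_pos] power_mult)
  finally show "card K_set \<le> CARD('a) ^ (m * d)" .
qed

lemma scalar_endo_hom: "scalar_endo \<phi> p \<in> ring_hom (Fq_ext m) En"
proof (rule ring_hom_memI)
  show "scalar_endo \<phi> p x \<in> carrier En" if "x \<in> carrier (Fq_ext m)" for x
    using scalar_endo_mem[of x] fixed_m_n[of x] that by (simp add: En_simps)
qed (auto simp: En_simps scalar_endo_def compose_def fixed_m_n tors_scalar mult.assoc distrib_right
      intro!: restrict_ext)

lemma scalar_endo_K_set: "frob_pow m \<zeta> = \<zeta> \<Longrightarrow> scalar_endo \<phi> p \<zeta> \<in> K_set"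
  using K_set_pure[of \<zeta> 1] by (simp add: scalar_endo_def)
lemma residue_endo_K_set: "B \<in> carrier (residue_field p) \<Longrightarrow> residue_endo \<phi> p B \<in> K_set"
  using K_set_pure[of 1] by (auto simp: carrier_residue residue_endo_eq)

text \<open>
  \<open>C\<close> is a vector space over \<open>\<kappa>\<close> and over \<open>L\<close>, so its order is a power of \<open>q\<^sup>d\<close> and of \<open>q\<^sup>m\<close>. The
  exponent is thus a multiple of both \<open>d\<close> and \<open>m\<close>, which are coprime.
\<close>

lemma card_K_ideal:
  assumes md: "coprime m d" and C: "additive_subgroup C En" "finite C"
    and KC: "\<And>k c. k \<in> K_set \<Longrightarrow> c \<in> C \<Longrightarrow> compose tors k c \<in> C"
  obtains k where "card C = CARD('a) ^ (m * d * k)"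
proof -
  interpret A: vectorspace "residue_field p" "left_mult_module En (residue_endo \<phi> p) C"
    using KC[OF residue_endo_K_set]
    by (intro left_mult_vectorspace[OF ring_En field_residue[OF p_irred] residue_endo_hom C(1)]) (simp add: En_simps)
  interpret B: vectorspace "Fq_ext m :: 'a alg_closure ring" "left_mult_module En (scalar_endo \<phi> p) C"
    using KC[OF scalar_endo_K_set]
    by (intro left_mult_vectorspace[OF ring_En field_Fq_ext scalar_endo_hom C(1)]) (simp add: En_simps)
  have a: "card C = CARD('a) ^ (d * A.dim)"
    using A.card_carrier_eq_power_dim C(2) by (simp add: left_mult_module_def[of En] card_kappa power_mult)
  have b: "card C = CARD('a) ^ (m * B.dim)"
    using B.card_carrier_eq_power_dim C(2)
    by (simp add: left_mult_module_def[of En] card_Fq_fixed[OF m_pos] power_mult)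
  have "d * A.dim = m * B.dim" using a b q_power_inj by simp
  then have "m dvd d * A.dim" by simp
  then have "m dvd A.dim" using md by (simp add: coprime_dvd_mult_right_iff)
  then obtain k where "A.dim = m * k" by (elim dvdE)
  then show thesis using that[of k] a by (simp add: mult_ac)
qed

lemma torsion_nontrivial: "\<exists>v\<in>tors. v \<noteq> 0"
proof (rule ccontr)
  assume "\<not> (\<exists>v\<in>tors. v \<noteq> 0)"
  then have "tors = {0}" using tors_0 by auto
  then have "CARD('a) ^ (n * d) = CARD('a) ^ 0" using card_torsion by simp
  then have "n * d = 0" unfolding q_power_inj .
  then show False using n_pos d_pos by simp
qed

lemma id_neq_null: "(\<lambda>v\<in>tors. v) \<noteq> (\<lambda>v\<in>tors. 0)"
  using torsion_nontrivial by (metis restrict_apply')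

lemma additive_subgroup_K_set: "additive_subgroup K_set En"
  by (rule additive_subgroup_En) (auto simp: K_set_E K_set_null K_set_add K_set_uminus)

text \<open>
  The ideal \<open>K x\<close> is nonzero, so it has at least \<open>q\<^sup>m\<^sup>d\<close> elements. There are no more in \<open>K\<close>; hence
  \<open>K x = K\<close>.
\<close>

lemma K_set_inverse:
  assumes md: "coprime m d" and x: "x \<in> K_set" "x \<noteq> (\<lambda>v\<in>tors. 0)"
  obtains y where "y \<in> K_set" "compose tors y x = (\<lambda>v\<in>tors. v)"
proof -
  let ?C = "(\<lambda>k. compose tors k x) ` K_set"
  have sub: "?C \<subseteq> K_set" using K_set_mult x by auto
  have z: "compose tors (\<lambda>v\<in>tors. 0) x = (\<lambda>v\<in>tors. 0)"
    using K_set_apply[OF x(1)] by (auto simp: compose_def)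
  have "additive_subgroup ?C En"
  proof (rule additive_subgroup_En)
    show "?C \<subseteq> L.E" using sub K_set_E by blast
    show "(\<lambda>v\<in>tors. 0) \<in> ?C" using z K_set_null by (metis imageI)
    show "(\<lambda>v\<in>tors. f v + g v) \<in> ?C" if fg: "f \<in> ?C" "g \<in> ?C" for f g
    proof -
      obtain k l where kl: "k \<in> K_set" "l \<in> K_set" "f = compose tors k x" "g = compose tors l x" using fg by blast
      have "(\<lambda>v\<in>tors. f v + g v) = compose tors (\<lambda>v\<in>tors. k v + l v) x"
        by (rule extensionalityI[of _ tors]) (auto simp: kl compose_def K_set_apply[OF x(1)])
      then show ?thesis using K_set_add[OF kl(1,2)] by blast
    qed
    show "(\<lambda>v\<in>tors. - f v) \<in> ?C" if f: "f \<in> ?C" for f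
    proof -
      obtain k where k: "k \<in> K_set" "f = compose tors k x" using f by blast
      have "(\<lambda>v\<in>tors. - f v) = compose tors (\<lambda>v\<in>tors. - k v) x"
        by (rule extensionalityI[of _ tors]) (auto simp: k compose_def K_set_apply[OF x(1)])
      then show ?thesis using K_set_uminus[OF k(1)] by blast
    qed
  qed
  moreover have "finite ?C" using finite_K_set by simp
  moreover have "compose tors k c \<in> ?C" if k: "k \<in> K_set" and c: "c \<in> ?C" for k c
  proof -
    obtain l where l: "l \<in> K_set" "c = compose tors l x" using c by blast
    have "compose tors k c = compose tors (compose tors k l) x"
      by (rule extensionalityI[of _ tors]) (auto simp: l compose_def K_set_apply[OF x(1)])
    then show ?thesis using K_set_mult[OF k l(1)] by blast
  qed
  ultimately obtain k where k: "card ?C = CARD('a) ^ (m * d * k)"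
    using card_K_ideal[OF md] by blast
  have "compose tors (\<lambda>v\<in>tors. v) x = x"
    by (rule extensionalityI[of _ tors]) (auto simp: compose_def K_set_apply[OF x(1)] E_ext[OF K_set_E[OF x(1)]])
  then have "{x, \<lambda>v\<in>tors. 0} \<subseteq> ?C" using z K_set_id K_set_null by (metis empty_subsetI imageI insert_subset)
  then have "card {x, \<lambda>v\<in>tors. 0} \<le> card ?C" using finite_K_set by (intro card_mono) auto
  then have "card ?C \<noteq> 1" using x(2) by simp
  then have "1 \<le> k" using k by (cases k) auto
  then have "CARD('a) ^ (m * d) \<le> card ?C"
    unfolding k by (intro power_increasing) auto
  then have "?C = K_set"
    using card_subset_eq[OF finite_K_set sub] card_K_set_le card_mono[OF finite_K_set sub] by linarith
  then have "(\<lambda>v\<in>tors. v) \<in> ?C" using K_set_id by simp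
  then show thesis using that by (metis imageE)
qed

lemma card_K_set:
  assumes md: "coprime m d" shows "card K_set = CARD('a) ^ (m * d)"
proof -
  obtain k where k: "card K_set = CARD('a) ^ (m * d * k)"
    using card_K_ideal[OF md additive_subgroup_K_set finite_K_set K_set_mult] by blast
  have "card {\<lambda>v\<in>tors. v, \<lambda>v\<in>tors. 0} \<le> card K_set"
    using finite_K_set K_set_id K_set_null by (intro card_mono) auto
  then have "card K_set \<noteq> 1" using id_neq_null by simp
  then have "1 \<le> k" using k by (cases k) auto
  then have "CARD('a) ^ (m * d) \<le> card K_set" unfolding k by (intro power_increasing) auto
  then show ?thesis using card_K_set_le by simp
qed

lemma field_K:
  assumes md: "coprime m d" shows "Ring.field K"
proof (rule cring.cring_fieldI2[OF cring_K])
  show "\<zero>\<^bsub>K\<^esub> \<noteq> \<one>\<^bsub>K\<^esub>" using id_neq_null by (simp add: K_ring_eq En_simps)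
  fix x assume "x \<in> carrier K" "x \<noteq> \<zero>\<^bsub>K\<^esub>"
  then have x: "x \<in> K_set" "x \<noteq> (\<lambda>v\<in>tors. 0)" by (simp_all add: K_carrier K_ring_eq En_simps)
  obtain y where y: "y \<in> K_set" "compose tors y x = (\<lambda>v\<in>tors. v)" by (rule K_set_inverse[OF md x])
  then have "compose tors x y = (\<lambda>v\<in>tors. v)" using K_set_comm[OF x(1) y(1)] by simp
  then show "\<exists>y\<in>carrier K. x \<otimes>\<^bsub>K\<^esub> y = \<one>\<^bsub>K\<^esub>"
    using y(1) by (intro bexI[of _ y]) (simp_all add: K_carrier K_ring_eq En_simps)
qed

section \<open>Polynomials in the Frobenius over the field\<close>

lemma tors_pi: "v \<in> tors \<Longrightarrow> frob_pow r v \<in> tors" using tors_frob[of v 1] by simp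
definition pi_inv where "pi_inv = frob_inv 1"

lemma pi_pi_inv: "v \<in> tors \<Longrightarrow> frob_pow r (pi_inv v) = v"
  using frob_frob_inv[OF n_pos, of v] by (simp add: pi_inv_def)
lemma pi_inv_pi: "v \<in> tors \<Longrightarrow> pi_inv (frob_pow r v) = v"
  using frob_inv_frob[OF n_pos, of v] by (simp add: pi_inv_def)
lemma pi_inv_tors: "v \<in> tors \<Longrightarrow> pi_inv v \<in> tors" unfolding pi_inv_def using E_mem[OF frob_inv_mem[of 1]] .

lemma pi_inv_mem: "pi_inv \<in> L.E" unfolding pi_inv_def by (rule frob_inv_mem)

lemma inv_frob_endo: "inv\<^bsub>En\<^esub> \<pi> = pi_inv"
proof -
  interpret E: ring En by (rule ring_En)
  have "\<pi> \<otimes>\<^bsub>En\<^esub> pi_inv = \<one>\<^bsub>En\<^esub>"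
    by (rule extensionalityI[of _ tors])
      (auto simp: En_simps compose_def frob_endo_def pi_inv_tors pi_pi_inv)
  moreover have "pi_inv \<otimes>\<^bsub>En\<^esub> \<pi> = \<one>\<^bsub>En\<^esub>"
    by (rule extensionalityI[of _ tors])
      (auto simp: En_simps compose_def frob_endo_def tors_pi pi_inv_pi)
  ultimately show ?thesis
    using frob_endo_mem pi_inv_mem by (intro E.inv_char) (auto simp: En_simps)
qed

lemma frob_conj_eq:
  assumes x: "\<And>v. v \<in> tors \<Longrightarrow> x v \<in> tors"
  shows "\<sigma> x = (\<lambda>v\<in>tors. frob_pow r (x (pi_inv v)))"
  unfolding frob_conj_def inv_frob_endo
  by (rule extensionalityI[of _ tors])
    (auto simp: En_simps compose_def frob_endo_def pi_inv_tors x)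

lemma frob_conj_K_set: assumes x: "x \<in> K_set" shows "\<sigma> x \<in> K_set"
proof -
  obtain \<zeta> where z: "x = tensor_endo \<zeta>" "\<And>i. frob_pow m (\<zeta> i) = \<zeta> i" using x by (auto simp: K_set_def)
  have af: "frob_pow r (act a v) = act a (frob_pow r v)" for a v using act_frob[of a 1 v] by simp
  have "\<sigma> x = (\<lambda>v\<in>tors. frob_pow r (x (pi_inv v)))"
    by (rule frob_conj_eq[OF K_set_apply[OF x]])
  also have "\<dots> = tensor_endo (\<lambda>i. frob_pow r (\<zeta> i))"
    unfolding tensor_endo_def
  proof (intro restrict_ext)
    fix v assume v: "v \<in> tors"
    then show "frob_pow r (x (pi_inv v)) = (\<Sum>i<d. frob_pow r (\<zeta> i) * act (monom 1 i) v)"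
      using pi_inv_tors[OF v]
      by (simp add: z(1) tensor_endo_def frob_pow_sum frob_pow_mult af pi_pi_inv)
  qed
  finally have "\<sigma> x = tensor_endo (\<lambda>i. frob_pow r (\<zeta> i))" .
  moreover have "frob_pow m (frob_pow r (\<zeta> i)) = frob_pow r (\<zeta> i)" for i
  proof -
    have "frob_pow m (frob_pow r (\<zeta> i)) = frob_pow r (frob_pow m (\<zeta> i))" by (simp add: frob_pow_comp add.commute)
    then show ?thesis by (simp add: z(2))
  qed
  ultimately show ?thesis unfolding K_set_def by blast
qed

sublocale S: skew_evaluation En K_set "\<sigma>" "\<pi>"
proof (intro skew_evaluation.intro skew_evaluation_axioms.intro ring_En subring_K_set)
  show "\<pi> \<in> carrier En" using frob_endo_mem by (simp add: En_simps)
  show "\<pi> \<otimes>\<^bsub>En\<^esub> x = \<sigma> x \<otimes>\<^bsub>En\<^esub> \<pi>" if x: "x \<in> K_set" for x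
    by (rule extensionalityI[of _ tors])
      (auto simp: frob_conj_eq[of x, OF K_set_apply[OF x]] En_simps compose_def frob_endo_def tors_pi pi_inv_pi K_set_apply[OF x])
  show "\<sigma> \<in> ring_hom (En\<lparr>carrier := K_set\<rparr>) (En\<lparr>carrier := K_set\<rparr>)"
  proof (rule ring_hom_memI)
    fix x y assume "x \<in> carrier (En\<lparr>carrier := K_set\<rparr>)" "y \<in> carrier (En\<lparr>carrier := K_set\<rparr>)"
    then have x: "x \<in> K_set" and y: "y \<in> K_set" by simp_all
    have "\<sigma> (compose tors x y) = compose tors (\<sigma> x) (\<sigma> y)"
      by (rule extensionalityI[of _ tors])
        (auto simp: frob_conj_eq[of x, OF K_set_apply[OF x]] frob_conj_eq[of y, OF K_set_apply[OF y]] frob_conj_eq[OF K_set_apply[OF K_set_mult[OF x y]]]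
          compose_eq pi_inv_tors tors_pi pi_inv_pi K_set_apply[OF x] K_set_apply[OF y])
    then show "\<sigma> (x \<otimes>\<^bsub>En\<lparr>carrier := K_set\<rparr>\<^esub> y) =
        \<sigma> x \<otimes>\<^bsub>En\<lparr>carrier := K_set\<rparr>\<^esub> \<sigma> y" by (simp add: En_simps)
    have "\<sigma> (\<lambda>v\<in>tors. x v + y v) = (\<lambda>v\<in>tors. \<sigma> x v + \<sigma> y v)"
      by (rule extensionalityI[of _ tors])
        (auto simp: frob_conj_eq[of x, OF K_set_apply[OF x]] frob_conj_eq[of y, OF K_set_apply[OF y]] frob_conj_eq[OF K_set_apply[OF K_set_add[OF x y]]]
          pi_inv_tors frob_pow_add)
    then show "\<sigma> (x \<oplus>\<^bsub>En\<lparr>carrier := K_set\<rparr>\<^esub> y) =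
        \<sigma> x \<oplus>\<^bsub>En\<lparr>carrier := K_set\<rparr>\<^esub> \<sigma> y" by (simp add: En_simps)
  next
    have "\<sigma> (\<lambda>v\<in>tors. v) = (\<lambda>v\<in>tors. v)"
      by (rule extensionalityI[of _ tors])
        (auto simp: frob_conj_eq[OF K_set_apply[OF K_set_id]] pi_inv_tors pi_pi_inv)
    then show "\<sigma> \<one>\<^bsub>En\<lparr>carrier := K_set\<rparr>\<^esub> = \<one>\<^bsub>En\<lparr>carrier := K_set\<rparr>\<^esub>" by (simp add: En_simps)
  qed (simp add: frob_conj_K_set)
qed

abbreviation upK where "upK \<equiv> up K"

lemma ev_eq_eval: "S.ev g = eval_at_frob \<phi> p r m g"
  by (simp add: S.ev_def eval_at_frob_def K_ring_eq)

lemma up_K_set: "g \<in> upK \<Longrightarrow> g i \<in> K_set" unfolding K_ring_eq by (rule S.up_in)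

lemma ev_apply:
  assumes g: "g \<in> upK" and N: "\<And>i. i > N \<Longrightarrow> g i = (\<lambda>v\<in>tors. 0)"
  shows "S.ev g = (\<lambda>v\<in>tors. \<Sum>i\<le>N. g i (frob_pow (r * i) v))"
proof -
  have c: "compose tors (g i) (\<lambda>v\<in>tors. frob_pow (r * i) v) \<in> L.E" for i
    using L.endo_compose[OF K_set_E[OF up_K_set[OF g]] frob_restrict_mem] by simp
  have "S.ev g = (\<Oplus>\<^bsub>En\<^esub>i\<in>{..N}. g i \<otimes>\<^bsub>En\<^esub> (\<pi> [^]\<^bsub>En\<^esub> i))"
    using g N by (intro S.ev_eq) (auto simp: K_ring_eq En_simps)
  also have "\<dots> = (\<lambda>v\<in>tors. \<Sum>i\<le>N. (g i \<otimes>\<^bsub>En\<^esub> (\<pi> [^]\<^bsub>En\<^esub> i)) v)"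
    using c by (intro En_finsum) (auto simp: frob_endo_pow En_simps)
  also have "\<dots> = (\<lambda>v\<in>tors. \<Sum>i\<le>N. g i (frob_pow (r * i) v))"
    by (intro restrict_ext sum.cong refl) (simp add: frob_endo_pow En_simps compose_eq)
  finally show ?thesis .
qed

lemma monom_up: "x \<in> K_set \<Longrightarrow> (\<lambda>i. if i = N then x else (\<lambda>v\<in>tors. 0)) \<in> upK"
  by (auto simp: up_def bound_def K_carrier K_ring_eq En_simps K_set_null intro!: exI[of _ N])

lemma ev_monom:
  assumes x: "x \<in> K_set"
  shows "S.ev (\<lambda>i. if i = N then x else (\<lambda>v\<in>tors. 0)) = (\<lambda>v\<in>tors. x (frob_pow (r * N) v))"
proof -
  have "(\<Sum>i\<le>N. (if i = N then x else (\<lambda>v\<in>tors. 0)) (frob_pow (r * i) v)) = x (frob_pow (r * N) v)"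
    if v: "v \<in> tors" for v
  proof -
    have "(\<Sum>i\<le>N. (if i = N then x else (\<lambda>v\<in>tors. 0)) (frob_pow (r * i) v)) =
        (\<Sum>i\<le>N. if i = N then x (frob_pow (r * i) v) else 0)"
      by (intro sum.cong refl) (simp add: tors_frob[OF v])
    then show ?thesis by simp
  qed
  then show ?thesis by (subst ev_apply[OF monom_up[OF x], of N]) (auto intro!: restrict_ext)
qed

text \<open>
  The value of \<open>y\<^sup>n - c\<close> at \<open>\<pi>\<close> is \<open>\<pi>\<^sup>n - c\<close>, and \<open>p\<^sub>0\<close> acts as \<open>\<pi>\<^sup>n\<close>.
\<close>

lemma relation_evaluates_to_0:
  defines "P \<equiv> K_skew_polys \<phi> p r m"
  defines "f \<equiv> up_ring.monom P \<one>\<^bsub>K\<^esub> n \<ominus>\<^bsub>P\<^esub> up_ring.monom P (residue_endo \<phi> p (residue_class p p0)) 0"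
  shows "f \<in> upK" "S.ev f = (\<lambda>v\<in>tors. 0)"
proof -
  let ?f1 = "\<lambda>i. if i = n then (\<lambda>v\<in>tors. v) else (\<lambda>v\<in>tors. 0)"
  let ?c = "\<lambda>v\<in>tors. act p0 v"
  let ?f2 = "\<lambda>i. if i = 0 then ?c else (\<lambda>v\<in>tors. 0)"
  have c: "?c \<in> K_set" using K_set_pure[of 1 p0] by simp
  interpret P: ring P unfolding P_def K_ring_eq by (rule S.ring_skew)
  have f1: "up_ring.monom P \<one>\<^bsub>K\<^esub> n = ?f1"
    using K_set_id unfolding P_def by (intro ext) (simp add: K_carrier K_ring_eq En_simps)
  have f2: "up_ring.monom P (residue_endo \<phi> p (residue_class p p0)) 0 = ?f2"
    using c unfolding P_def by (intro ext) (simp add: K_carrier K_ring_eq En_simps residue_endo_eq)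
  have car: "carrier P = upK" by (simp add: P_def)
  have u: "?f1 \<in> carrier P" "?f2 \<in> carrier P" using monom_up[OF K_set_id] monom_up[OF c] by (simp_all only: car)
  have f: "f = ?f1 \<ominus>\<^bsub>P\<^esub> ?f2" unfolding f_def f1 f2 ..
  have fP: "f \<in> carrier P" unfolding f using u by (rule P.minus_closed)
  then show fu: "f \<in> upK" by (simp only: car)
  have "f \<oplus>\<^bsub>P\<^esub> ?f2 = ?f1" unfolding f using u by (simp add: P.minus_eq P.a_assoc P.l_neg)
  moreover have "S.ev (f \<oplus>\<^bsub>P\<^esub> ?f2) = S.ev f \<oplus>\<^bsub>En\<^esub> S.ev ?f2"
    unfolding P_def K_ring_eq using fu monom_up[OF c] by (intro S.ev_add) (simp_all only: K_ring_eq)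
  ultimately have eq: "S.ev f \<oplus>\<^bsub>En\<^esub> S.ev ?f2 = S.ev ?f1" by simp
  have evE: "S.ev f \<in> L.E" using S.ev_closed[of f] fu by (simp add: K_ring_eq En_simps)
  show "S.ev f = (\<lambda>v\<in>tors. 0)"
  proof (rule extensionalityI[of _ tors])
    show "S.ev f \<in> extensional tors" by (rule E_ext[OF evE])
    fix v assume v: "v \<in> tors"
    have "S.ev f v + act p0 v = frob_pow (r * n) v"
      using fun_cong[OF eq, of v] v tors_frob[OF v, of n]
      by (simp only: ev_monom[OF c] ev_monom[OF K_set_id]) (simp add: En_simps)
    then show "S.ev f v = (\<lambda>v\<in>tors. 0) v" using v act_p0[of v] by (simp add: mult.commute)
  qed simp
qed

lemma quotient_to_R_coset:
  assumes g: "g \<in> upK"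
  shows "quotient_to_R \<phi> p r m (relation_ideal \<phi> p p0 r m n +>\<^bsub>K_skew_polys \<phi> p r m\<^esub> g) = S.ev g"
proof -
  have "eval_at_frob \<phi> p r m = S.ev" by (rule ext) (simp add: ev_eq_eval)
  moreover have "S.ev ` (relation_ideal \<phi> p p0 r m n +>\<^bsub>K_skew_polys \<phi> p r m\<^esub> g) = {S.ev g}"
    unfolding relation_ideal_def
    using S.ev_coset[OF relation_evaluates_to_0(1)[unfolded K_ring_eq] _ g[unfolded K_ring_eq]] relation_evaluates_to_0(2)
    unfolding K_ring_eq by (simp add: En_simps)
  ultimately show ?thesis by (simp add: quotient_to_R_def)
qed

lemma monic_with_class_in_iff:
  "monic_in C g \<longleftrightarrow>
    g \<in> upK \<and> g (deg K g) = (\<lambda>v\<in>tors. v) \<and> S.ev g \<in> C"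
proof -
  have "\<one>\<^bsub>K\<^esub> = (\<lambda>v\<in>tors. v)" by (simp add: K_ring_eq En_simps)
  then show ?thesis unfolding monic_with_class_in_def using quotient_to_R_coset by auto
qed

text \<open>
  The element \<open>k\<^sub>0 + k\<^sub>1 \<pi> + \<dots> + k\<^sub>N\<^sub>-\<^sub>1 \<pi>\<^sup>N\<^sup>-\<^sup>1\<close> of \<open>R\<close>.
\<close>

definition pi_poly :: "nat \<Rightarrow> (nat \<Rightarrow> 'a alg_closure \<Rightarrow> 'a alg_closure) \<Rightarrow> 'a alg_closure \<Rightarrow> 'a alg_closure" where
  "pi_poly N k = (\<lambda>v\<in>tors. \<Sum>i<N. k i (frob_pow (r * i) v))"

definition pi_polys :: "nat \<Rightarrow> ('a alg_closure \<Rightarrow> 'a alg_closure) set" where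
  "pi_polys N = {pi_poly N k | k. \<forall>i. k i \<in> K_set}"

lemma K_set_frob_R_set: "k \<in> K_set \<Longrightarrow> (\<lambda>v\<in>tors. k (frob_pow (r * i) v)) \<in> R_set"
proof -
  assume k: "k \<in> K_set"
  have "(\<lambda>v\<in>tors. frob_pow (r * i) v) \<in> R_set"
    using frob_restrict_mem[of i] E_mem[OF gamma_mem]
    by (simp add: R_set_def tors_frob gamma_def frob_pow_comp add.commute)
  from R_set_compose[OF subsetD[OF K_set_R_set k] this] show ?thesis
    by (simp add: compose_def cong: restrict_cong)
qed

lemma pi_polys_add: "x \<in> pi_polys N \<Longrightarrow> y \<in> pi_polys N \<Longrightarrow> (\<lambda>v\<in>tors. x v + y v) \<in> pi_polys N"
proof -
  assume "x \<in> pi_polys N" "y \<in> pi_polys N"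
  then obtain k l where k: "x = pi_poly N k" "\<forall>i. k i \<in> K_set"
    and l: "y = pi_poly N l" "\<forall>i. l i \<in> K_set"
    by (auto simp: pi_polys_def)
  have "(\<lambda>v\<in>tors. x v + y v) = pi_poly N (\<lambda>i. \<lambda>v\<in>tors. k i v + l i v)"
    unfolding pi_poly_def by (intro restrict_ext) (simp add: k l pi_poly_def tors_frob sum.distrib)
  moreover have "\<forall>i. (\<lambda>v\<in>tors. k i v + l i v) \<in> K_set" using k l K_set_add by blast
  ultimately show ?thesis unfolding pi_polys_def by blast
qed

lemma pi_polys_uminus: "x \<in> pi_polys N \<Longrightarrow> (\<lambda>v\<in>tors. - x v) \<in> pi_polys N"
proof -
  assume "x \<in> pi_polys N"
  then obtain k where k: "x = pi_poly N k" "\<forall>i. k i \<in> K_set"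
    by (auto simp: pi_polys_def)
  have "(\<lambda>v\<in>tors. - x v) = pi_poly N (\<lambda>i. \<lambda>v\<in>tors. - k i v)"
    unfolding pi_poly_def by (intro restrict_ext) (simp add: k pi_poly_def tors_frob sum_negf)
  moreover have "\<forall>i. (\<lambda>v\<in>tors. - k i v) \<in> K_set" using k K_set_uminus by blast
  ultimately show ?thesis unfolding pi_polys_def by blast
qed

lemma pi_polys_term:
  assumes k: "k \<in> K_set" and j: "j < N"
  shows "(\<lambda>v\<in>tors. k (frob_pow (r * j) v)) \<in> pi_polys N"
proof -
  let ?k = "\<lambda>i. if i = j then k else (\<lambda>v\<in>tors. 0)"
  have "(\<Sum>i<N. ?k i (frob_pow (r * i) v)) = k (frob_pow (r * j) v)" if v: "v \<in> tors" for v
  proof -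
    have "(\<Sum>i<N. ?k i (frob_pow (r * i) v)) = (\<Sum>i<N. if i = j then k (frob_pow (r * i) v) else 0)"
      by (intro sum.cong refl) (simp add: tors_frob[OF v])
    then show ?thesis using j by simp
  qed
  then have "(\<lambda>v\<in>tors. k (frob_pow (r * j) v)) = pi_poly N ?k"
    unfolding pi_poly_def by (intro restrict_ext) simp
  moreover have "\<forall>i. ?k i \<in> K_set" using k K_set_null by simp
  ultimately show ?thesis unfolding pi_polys_def by blast
qed

lemma pi_polys_null: "(\<lambda>v\<in>tors. 0) \<in> pi_polys N"
proof -
  have "(\<lambda>v\<in>tors. 0) = pi_poly N (\<lambda>_. \<lambda>v\<in>tors. 0)"
    unfolding pi_poly_def by (intro restrict_ext) (simp add: tors_frob)
  then show ?thesis unfolding pi_polys_def using K_set_null by blast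
qed

lemma pi_polys_sum: "(\<And>i. i \<in> I \<Longrightarrow> f i \<in> pi_polys N) \<Longrightarrow> (\<lambda>v\<in>tors. \<Sum>i\<in>I. f i v) \<in> pi_polys N"
proof (induction I rule: infinite_finite_induct)
  case (insert i I)
  then have "(\<lambda>v\<in>tors. f i v + (\<lambda>v\<in>tors. \<Sum>i\<in>I. f i v) v) \<in> pi_polys N" by (intro pi_polys_add) auto
  moreover have "(\<lambda>v\<in>tors. f i v + (\<lambda>v\<in>tors. \<Sum>i\<in>I. f i v) v) = (\<lambda>v\<in>tors. \<Sum>i\<in>insert i I. f i v)"
    using insert.hyps by (intro restrict_ext) simp
  ultimately show ?case by (simp only:)
qed (use pi_polys_null in simp_all)

lemma pi_polys_R_set: "pi_polys N \<subseteq> R_set"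
proof
  fix x assume "x \<in> pi_polys N"
  then obtain k where k: "x = pi_poly N k" "\<forall>i. k i \<in> K_set" by (auto simp: pi_polys_def)
  have "(\<lambda>v\<in>tors. \<Sum>i\<in>I. k i (frob_pow (r * i) v)) \<in> R_set" if "finite I" for I
    using that
  proof (induction I rule: finite_induct)
    case empty
    then show ?case using R_set_null by (simp only: sum.empty)
  next
    case (insert i I)
    have "(\<lambda>v\<in>tors. (\<lambda>v\<in>tors. k i (frob_pow (r * i) v)) v + (\<lambda>v\<in>tors. \<Sum>i\<in>I. k i (frob_pow (r * i) v)) v) =
        (\<lambda>v\<in>tors. \<Sum>i\<in>insert i I. k i (frob_pow (r * i) v))"
      using insert.hyps by (intro restrict_ext) simp
    then show ?case using R_set_plus[OF K_set_frob_R_set[OF k(2)[rule_format, of i], of i] insert.IH] by (simp only:)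
  qed
  then show "x \<in> R_set" unfolding k(1) pi_poly_def by blast
qed

text \<open>
  Dedekind's argument. Inserting \<open>\<theta>\<^sup>l v\<close> for \<open>v\<close> multiplies the \<open>i\<close>-th term by the \<open>i\<close>-th conjugate of
  \<open>\<theta>\<^sup>l\<close>, as \<open>K\<close> commutes with the scalars. The combination of these relations with the dual basis
  \<open>b\<^sub>l\<close> isolates the term \<open>i = 0\<close>. Then \<open>\<pi>\<close> can be cancelled on the right, and induction applies.
\<close>

lemma frobenius_independent:
  assumes "N \<le> n" "\<And>i. i < N \<Longrightarrow> k i \<in> K_set" "\<And>v. v \<in> tors \<Longrightarrow> (\<Sum>i<N. k i (frob_pow (r * i) v)) = 0"
    "i < N" "v \<in> tors"
  shows "k i v = 0"
  using assms
proof (induction N arbitrary: k i v)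
  case (Suc N)
  obtain \<theta> :: "'a alg_closure" and b where \<theta>: "frob_pow n \<theta> = \<theta>" and "\<forall>k. frob_pow n (b k) = b k"
    and "\<forall>j<n. (\<Sum>l<n. b l * frob_pow (r * 1 * j) (\<theta> ^ l)) = (if j = 0 then 1 else 0)"
    and "\<forall>i<n. \<forall>l<n. (\<Sum>j<n. frob_pow (r * 1 * j) (\<theta> ^ i * b l)) = (if i = l then 1 else 0)"
    by (rule cyclic_dual_bases[of 1 n]) simp
  then have G: "(\<Sum>l<n. b l * frob_pow (r * j) (\<theta> ^ l)) = (if j = 0 then 1 else 0)" if "j < n" for j
    using that by simp
  have th: "frob_pow n (\<theta> ^ l) = \<theta> ^ l" for l by (simp add: frob_pow_power \<theta>)
  have k0: "k 0 v = 0" if v: "v \<in> tors" for v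
  proof -
    let ?w = "\<lambda>i. k i (frob_pow (r * i) v)"
    have "(\<Sum>i<Suc N. frob_pow (r * i) (\<theta> ^ l) * ?w i) = 0" for l
    proof -
      have "k i (frob_pow (r * i) (\<theta> ^ l * v)) = frob_pow (r * i) (\<theta> ^ l) * ?w i" if "i < Suc N" for i
      proof -
        have "frob_pow n (frob_pow (r * i) (\<theta> ^ l)) = frob_pow (r * i) (frob_pow n (\<theta> ^ l))"
          by (simp add: frob_pow_comp add.commute)
        then have "frob_pow n (frob_pow (r * i) (\<theta> ^ l)) = frob_pow (r * i) (\<theta> ^ l)" by (simp only: th)
        then show ?thesis using K_set_scalar[OF Suc.prems(2)[OF that]] tors_frob[OF v] by (simp add: frob_pow_mult)
      qed
      then have "(\<Sum>i<Suc N. frob_pow (r * i) (\<theta> ^ l) * ?w i) = (\<Sum>i<Suc N. k i (frob_pow (r * i) (\<theta> ^ l * v)))"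
        by (intro sum.cong refl) simp
      also have "\<dots> = 0" by (rule Suc.prems(3)[OF tors_scalar[OF th v]])
      finally show ?thesis .
    qed
    then have "0 = (\<Sum>l<n. b l * (\<Sum>i<Suc N. frob_pow (r * i) (\<theta> ^ l) * ?w i))" by simp
    also have "\<dots> = (\<Sum>l<n. \<Sum>i<Suc N. (b l * frob_pow (r * i) (\<theta> ^ l)) * ?w i)"
      by (intro sum.cong refl) (simp add: sum_distrib_left mult.assoc del: sum.lessThan_Suc)
    also have "\<dots> = (\<Sum>i<Suc N. (\<Sum>l<n. b l * frob_pow (r * i) (\<theta> ^ l)) * ?w i)"
      by (subst sum.swap) (simp add: sum_distrib_right del: sum.lessThan_Suc)
    also have "\<dots> = (\<Sum>i<Suc N. if i = 0 then ?w i else 0)"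
      using Suc.prems(1) by (intro sum.cong refl) (simp add: G)
    also have "\<dots> = ?w 0" by (subst sum.delta) auto
    finally show ?thesis by simp
  qed
  have shift: "(\<Sum>i<N. k (Suc i) (frob_pow (r * i) u)) = 0" if u: "u \<in> tors" for u
  proof -
    let ?v = "pi_inv u"
    have v: "?v \<in> tors" by (rule pi_inv_tors[OF u])
    have fr: "frob_pow (r * Suc i) ?v = frob_pow (r * i) u" for i
    proof -
      have "frob_pow (r * Suc i) ?v = frob_pow (r * i) (frob_pow r ?v)" by (simp add: frob_pow_comp add.commute)
      then show ?thesis using pi_pi_inv[OF u] by simp
    qed
    have "0 = (\<Sum>i<Suc N. k i (frob_pow (r * i) ?v))" using Suc.prems(3)[OF v] by simp
    also have "\<dots> = k 0 (frob_pow (r * 0) ?v) + (\<Sum>i<N. k (Suc i) (frob_pow (r * Suc i) ?v))"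
      by (rule sum.lessThan_Suc_shift)
    also have "\<dots> = (\<Sum>i<N. k (Suc i) (frob_pow (r * i) u))" using k0[OF v] by (simp only: fr) simp
    finally show ?thesis by simp
  qed
  show ?case
  proof (cases i)
    case 0
    then show ?thesis using k0[OF Suc.prems(5)] by simp
  next
    case (Suc j)
    have "k (Suc j) v = 0"
      by (rule Suc.IH[of "\<lambda>i. k (Suc i)"]) (use Suc.prems shift Suc in auto)
    then show ?thesis using Suc by simp
  qed
qed simp

lemma card_pi_polys: "N \<le> n \<Longrightarrow> card (pi_polys N) = card K_set ^ N"
proof -
  assume N: "N \<le> n"
  let ?f = "pi_poly N"
  have "inj_on ?f ({..<N} \<rightarrow>\<^sub>E K_set)"
  proof (rule inj_onI)
    fix k l assume k: "k \<in> {..<N} \<rightarrow>\<^sub>E K_set" and l: "l \<in> {..<N} \<rightarrow>\<^sub>E K_set" and eq: "?f k = ?f l"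
    let ?d = "\<lambda>i. \<lambda>v\<in>tors. k i v + (\<lambda>v\<in>tors. - l i v) v"
    have kK: "k i \<in> K_set" and lK: "l i \<in> K_set" if "i < N" for i using that k l by auto
    have dK: "?d i \<in> K_set" if "i < N" for i by (intro K_set_add K_set_uminus kK lK that)
    have "(\<Sum>i<N. ?d i (frob_pow (r * i) v)) = 0" if v: "v \<in> tors" for v
      using fun_cong[OF eq, of v] v by (simp add: pi_poly_def tors_frob sum_subtractf)
    then have "?d i v = 0" if "i < N" "v \<in> tors" for i v
      using frobenius_independent[of N ?d] N dK that by blast
    then have "k i v = l i v" if "i < N" "v \<in> tors" for i v using that by fastforce
    then have "k i = l i" if "i < N" for i
      using that E_ext[OF K_set_E[OF kK]] E_ext[OF K_set_E[OF lK]] by (intro extensionalityI[of _ tors]) auto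
    then show "k = l" using k l by (intro extensionalityI[of _ "{..<N}"]) (auto simp: PiE_iff)
  qed
  moreover have "?f ` ({..<N} \<rightarrow>\<^sub>E K_set) = pi_polys N"
  proof
    show "?f ` ({..<N} \<rightarrow>\<^sub>E K_set) \<subseteq> pi_polys N"
    proof
      fix x assume "x \<in> ?f ` ({..<N} \<rightarrow>\<^sub>E K_set)"
      then obtain k where k: "k \<in> {..<N} \<rightarrow>\<^sub>E K_set" "x = ?f k" by blast
      let ?k = "\<lambda>i. if i < N then k i else (\<lambda>v\<in>tors. 0)"
      have "x = ?f ?k" unfolding k(2) pi_poly_def by (intro restrict_ext sum.cong) auto
      moreover have "\<forall>i. ?k i \<in> K_set" using k(1) K_set_null by auto
      ultimately show "x \<in> pi_polys N" unfolding pi_polys_def by blast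
    qed
    show "pi_polys N \<subseteq> ?f ` ({..<N} \<rightarrow>\<^sub>E K_set)"
    proof
      fix x assume "x \<in> pi_polys N"
      then obtain k where k: "x = ?f k" "\<forall>i. k i \<in> K_set" by (auto simp: pi_polys_def)
      have "x = ?f (restrict k {..<N})" unfolding k(1) pi_poly_def by (intro restrict_ext sum.cong) auto
      moreover have "restrict k {..<N} \<in> {..<N} \<rightarrow>\<^sub>E K_set" using k(2) by simp
      ultimately show "x \<in> ?f ` ({..<N} \<rightarrow>\<^sub>E K_set)" by blast
    qed
  qed
  ultimately have "card (pi_polys N) = card ({..<N} \<rightarrow>\<^sub>E K_set)" by (metis card_image)
  then show ?thesis by (simp add: card_funcsetE)
qed

lemma stable_zero: "stable {0}"
  using L.endo_zero[OF gamma_mem] by (simp add: subspace_stable_iff tors_0)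

lemma card_R_set: "card R_set = CARD('a) ^ (m * d * n)"
proof -
  have "CARD('a) ^ (d * dim_kappa_M \<phi> p {0}) = CARD('a) ^ 0" using card_dim_kappa_M[OF stable_zero] by simp
  then have "dim_kappa_M \<phi> p {0} = 0" unfolding q_power_inj using d_pos by simp
  moreover have "Ann {0} = R_set" using L.endo_zero[OF R_set_E] by (auto simp: annihilator_eq)
  ultimately show ?thesis using card_annihilator_dim(2)[OF stable_zero] by (simp add: mult_ac)
qed

text \<open>
  The powers \<open>1, \<dots>, \<pi>\<^sup>n\<^sup>-\<^sup>1\<close> are independent over \<open>K\<close>, so they yield \<open>q\<^sup>m\<^sup>d\<^sup>n\<close> elements, as many as \<open>R\<close> has.
\<close>

lemma pi_polys_n_eq_R_set: "coprime m d \<Longrightarrow> pi_polys n = R_set"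
proof -
  assume md: "coprime m d"
  have "card (pi_polys n) = card R_set"
    using card_pi_polys[of n] card_K_set[OF md] card_R_set by (simp add: power_mult)
  then show ?thesis using card_subset_eq[OF finite_R_set pi_polys_R_set] by blast
qed

text \<open>
  Multiply \<open>x\<close> on the left by the inverse of its leading coefficient.
\<close>

lemma monic_in_left_ideal:
  assumes md: "coprime m d" and C: "left_ideal C R"
    and x: "x \<in> C" "x \<in> pi_polys N" "x \<noteq> (\<lambda>v\<in>tors. 0)"
  obtains h where "monic_in C h" "deg K h < N"
proof -
  let ?z = "\<lambda>v\<in>tors. 0 :: 'a alg_closure"
  obtain k where k: "x = pi_poly N k" "\<forall>i. k i \<in> K_set"
    using x(2) by (auto simp: pi_polys_def)
  define J where "J = {i. i < N \<and> k i \<noteq> ?z}"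
  have "J \<noteq> {}"
  proof
    assume "J = {}"
    then have "k i = ?z" if "i < N" for i using that by (auto simp: J_def)
    then have "x = ?z" unfolding k(1) pi_poly_def by (intro restrict_ext sum.neutral) (simp add: tors_frob)
    then show False using x(3) by simp
  qed
  moreover have fJ: "finite J" by (simp add: J_def)
  ultimately have e: "Max J \<in> J" by (intro Max_in)
  define e where "e = Max J"
  have eN: "e < N" "k e \<noteq> ?z" using e by (auto simp: J_def e_def)
  have above: "k i = ?z" if "e < i" "i < N" for i
  proof (rule ccontr)
    assume "k i \<noteq> ?z"
    then have "i \<in> J" using that by (simp add: J_def)
    then have "i \<le> e" unfolding e_def by (rule Max_ge[OF fJ])
    then show False using that by simp
  qed
  obtain u where u: "u \<in> K_set" "compose tors u (k e) = (\<lambda>v\<in>tors. v)"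
    using K_set_inverse[OF md k(2)[rule_format] eN(2)] by blast
  define h where "h i = (if i \<le> e then compose tors u (k i) else ?z)" for i
  have hK: "h i \<in> K_set" for i using K_set_mult[OF u(1)] k(2) K_set_null by (simp add: h_def)
  have hu: "h \<in> upK"
    by (auto simp: up_def bound_def K_carrier hK K_ring_eq En_simps intro!: exI[of _ e]) (auto simp: h_def)
  have he: "h e = (\<lambda>v\<in>tors. v)" by (simp add: h_def u(2))
  have dh: "deg K h = e"
  proof -
    interpret K: cring "K" by (rule cring_K)
    interpret U: UP_cring "K" "UP K" by unfold_locales
    have co: "up_ring.coeff (UP K) h i = h i" for i by (simp add: UP_def hu)
    have zK: "\<zero>\<^bsub>K\<^esub> = ?z" by (simp add: K_ring_eq En_simps)
    show ?thesis
    proof (rule antisym)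
      have hP: "h \<in> carrier (UP K)" by (simp add: UP_def hu)
      show "deg K h \<le> e"
        by (rule U.deg_aboveI[OF _ hP]) (simp add: co zK, simp add: h_def)
      have "up_ring.coeff (UP K) h e \<noteq> \<zero>\<^bsub>K\<^esub>"
        unfolding co zK he by (rule id_neq_null)
      then show "e \<le> deg K h" by (rule U.deg_belowI[OF _ hP])
    qed
  qed
  have "S.ev h = compose tors u x"
  proof -
    have "S.ev h = (\<lambda>v\<in>tors. \<Sum>i\<le>e. h i (frob_pow (r * i) v))"
      by (rule ev_apply[OF hu]) (simp add: h_def)
    also have "\<dots> = compose tors u x"
    proof (rule extensionalityI[of _ tors])
      fix v assume v: "v \<in> tors"
      have "u (x v) = u (\<Sum>i<N. k i (frob_pow (r * i) v))" using v by (simp add: k(1) pi_poly_def)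
      also have "(\<Sum>i<N. k i (frob_pow (r * i) v)) = (\<Sum>i\<le>e. k i (frob_pow (r * i) v))"
        using eN(1) above by (intro sum.mono_neutral_right) (auto simp: tors_frob[OF v] not_le)
      also have "u \<dots> = (\<Sum>i\<le>e. u (k i (frob_pow (r * i) v)))"
        by (rule L.endo_sum[OF K_set_E[OF u(1)]]) (simp add: K_set_apply[OF k(2)[rule_format]] tors_frob[OF v])
      also have "\<dots> = (\<Sum>i\<le>e. h i (frob_pow (r * i) v))"
        by (intro sum.cong refl) (simp add: h_def compose_eq tors_frob[OF v])
      finally show "(\<lambda>v\<in>tors. \<Sum>i\<le>e. h i (frob_pow (r * i) v)) v = compose tors u x v"
        using v by (simp add: compose_eq)
    qed auto
    finally show ?thesis .
  qed
  then have "S.ev h \<in> C" using left_idealD_R(4)[OF C subsetD[OF K_set_R_set u(1)] x(1)] by simp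
  then have "monic_in C h" using hu he dh by (simp add: monic_with_class_in_iff)
  then show thesis using that dh eN(1) by simp
qed

text \<open>
  Every element of \<open>R\<close> is uniquely the sum of an element of \<open>C\<close> and a polynomial in \<open>\<pi>\<close> of degree less
  than \<open>\<delta>\<close>. Existence is division by the monic \<open>g\<close>; uniqueness holds because a nonzero polynomial in
  \<open>C\<close> of degree less than \<open>\<delta>\<close> would give a monic one, against minimality. So
  \<open>|R| = |C| q\<^sup>m\<^sup>d\<^sup>\<delta>\<close>. The order of \<open>C\<close> is also \<open>q\<^sup>m\<^sup>d\<close> to the power \<open>dim\<^sub>K C\<close>, and \<open>C = Ann(Z C)\<close>
  gives it in terms of \<open>dim\<^sub>\<kappa> Z(C)\<close>.
\<close>

lemma minimal_generator_dims:
  assumes md: "coprime m d" and C: "left_ideal C R" and C0: "C \<noteq> {\<lambda>v\<in>tors. 0}"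
    and g: "minimal_monic_generator \<phi> p p0 r m n C g"
  defines "\<delta> \<equiv> deg K g"
  shows "dim_K_R \<phi> p m C + \<delta> = n" "dim_kappa_M \<phi> p (Z C) = \<delta>"
proof -
  let ?z = "\<lambda>v\<in>tors. 0 :: 'a alg_closure"
  note CD = left_idealD_R[OF C]
  have g1: "g \<in> upK" "g \<delta> = (\<lambda>v\<in>tors. v)" "S.ev g \<in> C"
    and gmin: "\<And>h. monic_in C h \<Longrightarrow> \<delta> \<le> deg K h"
    using g by (auto simp: minimal_monic_generator_def monic_with_class_in_iff \<delta>_def)
  have small: "x = ?z" if xC: "x \<in> C" "x \<in> pi_polys \<delta>" for x
  proof (rule ccontr)
    assume "x \<noteq> ?z"
    then obtain h where "monic_in C h" "deg K h < \<delta>"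
      by (rule monic_in_left_ideal[OF md C xC])
    then show False using gmin by fastforce
  qed
  obtain x0 where x0: "x0 \<in> C" "x0 \<noteq> ?z" using C0 CD(2) by blast
  then have "x0 \<in> pi_polys n" using CD(1) pi_polys_n_eq_R_set[OF md] by blast
  then obtain h where "monic_in C h" "deg K h < n"
    by (rule monic_in_left_ideal[OF md C x0(1) _ x0(2)])
  then have dn: "\<delta> < n" using gmin by fastforce
  have evg: "S.ev g = (\<lambda>v\<in>tors. \<Sum>i\<le>\<delta>. g i (frob_pow (r * i) v))"
  proof (rule ev_apply[OF g1(1)])
    fix i assume i: "\<delta> < i"
    have "g i = \<zero>\<^bsub>En\<^esub>"
      using g1(1) i unfolding \<delta>_def K_ring_eq by (intro S.deg_vanish)
    then show "g i = ?z" by (simp add: En_simps)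
  qed
  \<comment> \<open>division with remainder: subtract the multiple \<open>k\<^sub>N \<pi>\<^sup>N\<^sup>-\<^sup>\<delta> g\<close> of \<open>g\<close>, which has the same leading
    term; it lies in \<open>C\<close>\<close>
  have gen: "\<exists>c\<in>C. \<exists>y\<in>pi_polys \<delta>. x = (\<lambda>v\<in>tors. c v + y v)" if "x \<in> pi_polys N" "\<delta> \<le> N" for x N
    using that(2,1)
  proof (induction N arbitrary: x rule: dec_induct)
    case base
    have "x = (\<lambda>v\<in>tors. ?z v + x v)"
      using base E_ext[OF R_set_E[OF subsetD[OF pi_polys_R_set base]]] by (intro extensionalityI[of _ tors]) auto
    then show ?case using base CD(2) by blast
  next
    case (step N)
    obtain k where k: "x = pi_poly (Suc N) k" "\<forall>i. k i \<in> K_set" using step.prems by (auto simp: pi_polys_def)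
    let ?j = "N - \<delta>"
    let ?u = "\<lambda>v\<in>tors. k N (frob_pow (r * ?j) v)"
    define z where "z = compose tors ?u (S.ev g)"
    have zC: "z \<in> C" unfolding z_def by (rule CD(4)[OF K_set_frob_R_set[OF k(2)[rule_format]] g1(3)])
    let ?c = "\<lambda>i. compose tors (k N) ((\<sigma> ^^ ?j) (g i))"
    have cK: "?c i \<in> K_set" for i
      by (intro K_set_mult k(2)[rule_format] S.sigma_pow_A up_K_set[OF g1(1)])
    have conj: "frob_pow (r * j) (x v) = (\<sigma> ^^ j) x (frob_pow (r * j) v)"
      if x: "x \<in> K_set" and v: "v \<in> tors" for x j v
    proof -
      have "(\<pi> [^]\<^bsub>En\<^esub> j \<otimes>\<^bsub>En\<^esub> x) v = ((\<sigma> ^^ j) x \<otimes>\<^bsub>En\<^esub> \<pi> [^]\<^bsub>En\<^esub> j) v"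
        by (simp only: S.y_pow_commute[OF x])
      then show ?thesis using v K_set_apply[OF x v] by (simp add: frob_endo_pow En_simps compose_eq)
    qed
    have zv: "z v = (\<Sum>i\<le>\<delta>. ?c i (frob_pow (r * (?j + i)) v))" if v: "v \<in> tors" for v
    proof -
      have gi: "g i (frob_pow (r * i) v) \<in> tors" for i by (rule K_set_apply[OF up_K_set[OF g1(1)] tors_frob[OF v]])
      have u: "?u \<in> L.E" by (rule R_set_E[OF K_set_frob_R_set[OF k(2)[rule_format]]])
      have "z v = ?u (\<Sum>i\<le>\<delta>. g i (frob_pow (r * i) v))" using v by (simp add: z_def compose_eq evg)
      also have "\<dots> = (\<Sum>i\<le>\<delta>. ?u (g i (frob_pow (r * i) v)))"
        by (rule L.endo_sum[OF u]) (simp add: gi)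
      also have "\<dots> = (\<Sum>i\<le>\<delta>. ?c i (frob_pow (r * (?j + i)) v))"
      proof (intro sum.cong refl)
        fix i
        have "frob_pow (r * ?j) (g i (frob_pow (r * i) v)) =
            (\<sigma> ^^ ?j) (g i) (frob_pow (r * (?j + i)) v)"
          by (simp add: conj[OF up_K_set[OF g1(1)] tors_frob[OF v]] frob_pow_comp add_mult_distrib2)
        then show "?u (g i (frob_pow (r * i) v)) = ?c i (frob_pow (r * (?j + i)) v)"
          using gi[of i] tors_frob[OF v, of "?j + i"] by (simp add: compose_eq)
      qed
      finally show ?thesis .
    qed
    have c\<delta>: "?c \<delta> = k N"
    proof -
      have "(\<sigma> ^^ j) (\<lambda>v\<in>tors. v) = (\<lambda>v\<in>tors. v)" for j
        using S.sigma_pow_one[of j] by (simp add: En_simps)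
      then show ?thesis unfolding g1(2) using K_set_apply[OF k(2)[rule_format, of N]] E_ext[OF K_set_E[OF k(2)[rule_format, of N]]]
        by (intro extensionalityI[of _ tors]) (auto simp: compose_eq)
    qed
    let ?lower = "\<lambda>v\<in>tors. \<Sum>i\<in>{..<\<delta>}. (\<lambda>v\<in>tors. ?c i (frob_pow (r * (?j + i)) v)) v"
    have low: "?lower \<in> pi_polys N"
      using step.hyps by (intro pi_polys_sum pi_polys_term cK) auto
    have zl: "z v = ?lower v + k N (frob_pow (r * N) v)" if v: "v \<in> tors" for v
    proof -
      have "z v = (\<Sum>i<Suc \<delta>. ?c i (frob_pow (r * (?j + i)) v))" by (simp only: zv[OF v] lessThan_Suc_atMost)
      also have "\<dots> = (\<Sum>i<\<delta>. ?c i (frob_pow (r * (?j + i)) v)) + ?c \<delta> (frob_pow (r * (?j + \<delta>)) v)"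
        by (rule sum.lessThan_Suc)
      finally show ?thesis using v step.hyps(1) by (simp only: c\<delta>) simp
    qed
    let ?x' = "\<lambda>v\<in>tors. pi_poly N k v + (\<lambda>v\<in>tors. - ?lower v) v"
    have "?x' \<in> pi_polys N"
      using k(2) by (intro pi_polys_add pi_polys_uminus low) (auto simp: pi_polys_def)
    then obtain c y where cy: "c \<in> C" "y \<in> pi_polys \<delta>" "?x' = (\<lambda>v\<in>tors. c v + y v)" using step.IH by blast
    have "x = (\<lambda>v\<in>tors. (\<lambda>v\<in>tors. z v + c v) v + y v)"
    proof (rule extensionalityI[of _ tors])
      show "x \<in> extensional tors" unfolding k(1) pi_poly_def by simp
      fix v assume v: "v \<in> tors"
      have "x v = pi_poly N k v + k N (frob_pow (r * N) v)" using v by (simp add: k(1) pi_poly_def)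
      moreover have "pi_poly N k v - ?lower v = c v + y v" using fun_cong[OF cy(3), of v] v by simp
      ultimately have "x v = z v + c v + y v" using zl[OF v] by (simp add: algebra_simps)
      then show "x v = (\<lambda>v\<in>tors. (\<lambda>v\<in>tors. z v + c v) v + y v) v" using v by simp
    qed simp
    moreover have "(\<lambda>v\<in>tors. z v + c v) \<in> C" by (rule CD(3)[OF zC cy(1)])
    ultimately show ?case using cy(2) by blast
  qed
  let ?sum = "\<lambda>(c, y). \<lambda>v\<in>tors. c v + y v"
  have Cneg: "(\<lambda>v\<in>tors. - f v) \<in> C" if f: "f \<in> C" for f
    using additive_subgroup.a_inv_closed[OF left_ideal_En[OF C] f] En_a_inv[OF R_set_E[OF subsetD[OF CD(1) f]]] by simp
  have inj: "inj_on ?sum (C \<times> pi_polys \<delta>)"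
  proof (rule inj_onI, clarify)
    fix c y c' y' assume cy: "c \<in> C" "y \<in> pi_polys \<delta>" "c' \<in> C" "y' \<in> pi_polys \<delta>"
      and eq: "(\<lambda>v\<in>tors. c v + y v) = (\<lambda>v\<in>tors. c' v + y' v)"
    have eqv: "c v + y v = c' v + y' v" if "v \<in> tors" for v using fun_cong[OF eq, of v] that by simp
    let ?d = "\<lambda>v\<in>tors. c v + (\<lambda>v\<in>tors. - c' v) v"
    have dC: "?d \<in> C" by (rule CD(3)[OF cy(1) Cneg[OF cy(3)]])
    have "?d = (\<lambda>v\<in>tors. y' v + (\<lambda>v\<in>tors. - y v) v)"
    proof (intro restrict_ext)
      fix v assume v: "v \<in> tors"
      have "c v = c' v + y' v - y v" using eqv[OF v] by (simp add: eq_diff_eq)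
      then show "c v + (\<lambda>v\<in>tors. - c' v) v = y' v + (\<lambda>v\<in>tors. - y v) v" using v by simp
    qed
    moreover have "\<dots> \<in> pi_polys \<delta>" by (rule pi_polys_add[OF cy(4) pi_polys_uminus[OF cy(2)]])
    ultimately have dz: "?d = ?z" using small[OF dC] by simp
    have cc: "c v = c' v" if v: "v \<in> tors" for v
    proof -
      have "?d v = ?z v" by (rule fun_cong[OF dz])
      then show ?thesis using v by simp
    qed
    have ext: "c \<in> extensional tors" "c' \<in> extensional tors" "y \<in> extensional tors" "y' \<in> extensional tors"
      using cy CD(1) pi_polys_R_set E_ext R_set_E by blast+
    show "c = c' \<and> y = y'"
      using cc eqv ext by (auto intro!: extensionalityI[of _ tors])
  qed
  have im: "?sum ` (C \<times> pi_polys \<delta>) = R_set"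
  proof
    show "?sum ` (C \<times> pi_polys \<delta>) \<subseteq> R_set"
      using R_set_plus[OF subsetD[OF CD(1)] subsetD[OF pi_polys_R_set]] by auto
    show "R_set \<subseteq> ?sum ` (C \<times> pi_polys \<delta>)"
    proof
      fix x assume "x \<in> R_set"
      then obtain c y where cy: "c \<in> C" "y \<in> pi_polys \<delta>" "x = (\<lambda>v\<in>tors. c v + y v)"
        using gen[of x n] pi_polys_n_eq_R_set[OF md] dn by auto
      show "x \<in> ?sum ` (C \<times> pi_polys \<delta>)" using cy by (intro image_eqI[of _ _ "(c, y)"]) auto
    qed
  qed
  have "card R_set = card (C \<times> pi_polys \<delta>)" using card_image[OF inj] unfolding im .
  then have cnt: "CARD('a) ^ (m * d * n) = card C * CARD('a) ^ (m * d * \<delta>)"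
    using card_R_set card_pi_polys[of \<delta>] dn card_K_set[OF md] by (simp add: card_cartesian_product power_mult)
  have md0: "m * d > 0" using m_pos d_pos by simp
  show "dim_K_R \<phi> p m C + \<delta> = n"
  proof -
    have idh: "(\<lambda>x. x) \<in> ring_hom K En"
      by (rule ring_hom_memI) (auto simp: K_carrier K_ring_eq En_simps K_set_E)
    have "vectorspace K (left_mult_module En (\<lambda>x. x) C)"
      using CD(4) K_set_R_set
      by (intro left_mult_vectorspace[OF ring_En field_K[OF md] idh left_ideal_En[OF C]])
        (auto simp: K_carrier En_simps)
    then interpret W: vectorspace "K" "left_mult_module En (\<lambda>x. x) C" .
    have "finite C" using finite_subset[OF CD(1) finite_R_set] .
    then have "card C = CARD('a) ^ (m * d * dim_K_R \<phi> p m C)"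
      using W.card_carrier_eq_power_dim
      by (simp add: left_mult_module_def[of En] dim_K_R_def K_carrier card_K_set[OF md] power_mult)
    then have "CARD('a) ^ (m * d * n) = CARD('a) ^ (m * d * (dim_K_R \<phi> p m C + \<delta>))"
      using cnt by (simp add: power_add distrib_left)
    then show ?thesis unfolding q_power_inj using md0 by simp
  qed
  show "dim_kappa_M \<phi> p (Z C) = \<delta>"
  proof -
    let ?e = "dim_kappa_M \<phi> p (Z C)"
    have W: "stable (Z C)" by (rule zero_set_stable[OF C])
    have "card C = CARD('a) ^ (d * (m * (n - ?e)))"
      using card_annihilator_dim(2)[OF W] by (simp add: annihilator_zero[OF C])
    then have "CARD('a) ^ (m * d * n) = CARD('a) ^ (m * d * (n - ?e + \<delta>))"
      using cnt by (simp add: power_add distrib_left mult_ac)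
    then have "n = n - ?e + \<delta>" unfolding q_power_inj using md0 by simp
    then show ?thesis using card_annihilator_dim(1)[OF W] dn by linarith
  qed
qed

end

section \<open>The correspondence and the dimension formulas\<close>

theorem corollary4p3:
  fixes p0 p :: "'a::{finite,field} poly"
    and t :: "'a alg_closure"
    and \<phi> :: "'a poly \<Rightarrow> (nat \<Rightarrow> 'a alg_closure)"
    and n r d m :: nat
  assumes "n \<ge> 1"
    and "Polynomial.lead_coeff p0 = 1" and "Factorial_Ring.irreducible p0"
    and "Polynomial.degree p0 = r"
    and "coprime n r"
    and "t \<in> carrier (Fq_ext r)" and "poly (map_poly to_ac p0) t = 0"
    and "drinfeld_module r n t \<phi>"
    and "Polynomial.lead_coeff p = 1" and "Factorial_Ring.irreducible p"
    and "Polynomial.degree p = d"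
    and "p \<noteq> p0"
    and "m dvd n"
  shows
    "bij_betw (zero_set \<phi> p) {C. left_ideal C (R_ring \<phi> p r m)} {W. R0_submodule \<phi> p r m W} \<and>
     bij_betw (annihilator \<phi> p r m) {W. R0_submodule \<phi> p r m W} {C. left_ideal C (R_ring \<phi> p r m)} \<and>
     (\<forall>C1 C2. left_ideal C1 (R_ring \<phi> p r m) \<longrightarrow> left_ideal C2 (R_ring \<phi> p r m) \<longrightarrow>
        zero_set \<phi> p (C1 <+>\<^bsub>R_ring \<phi> p r m\<^esub> C2) = zero_set \<phi> p C1 \<inter> zero_set \<phi> p C2 \<and>
        zero_set \<phi> p (C1 \<inter> C2) = {v + w | v w. v \<in> zero_set \<phi> p C1 \<and> w \<in> zero_set \<phi> p C2}) \<and>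
     (\<forall>W1 W2. R0_submodule \<phi> p r m W1 \<longrightarrow> R0_submodule \<phi> p r m W2 \<longrightarrow>
        annihilator \<phi> p r m {v + w | v w. v \<in> W1 \<and> w \<in> W2} =
          annihilator \<phi> p r m W1 \<inter> annihilator \<phi> p r m W2 \<and>
        annihilator \<phi> p r m (W1 \<inter> W2) =
          annihilator \<phi> p r m W1 <+>\<^bsub>R_ring \<phi> p r m\<^esub> annihilator \<phi> p r m W2) \<and>
     (\<forall>W. R0_submodule \<phi> p r m W \<longrightarrow>
        int (dim_kappa_R \<phi> p (annihilator \<phi> p r m W)) = int m * (int n - int (dim_kappa_M \<phi> p W))) \<and>
     (coprime m d \<longrightarrow>
        (\<forall>C g. left_ideal C (R_ring \<phi> p r m) \<longrightarrow> C \<noteq> {\<zero>\<^bsub>R_ring \<phi> p r m\<^esub>} \<longrightarrow>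
           minimal_monic_generator \<phi> p p0 r m n C g \<longrightarrow>
           dim_kappa_M \<phi> p (zero_set \<phi> p C) = deg (K_ring \<phi> p m) g \<and>
           int (deg (K_ring \<phi> p m) g) = int n - int (dim_K_R \<phi> p m C)))"
proof -
  interpret drinfeld_torsion p0 p t \<phi> n r d m
    by (rule drinfeld_torsion.intro) (fact assms)+
  have dims: "int (dim_kappa_R \<phi> p (annihilator \<phi> p r m W)) = int m * (int n - int (dim_kappa_M \<phi> p W))"
    if "R0_submodule \<phi> p r m W" for W
    using card_annihilator_dim(1,3)[of W] that by (simp add: R0_submodule_iff of_nat_diff)
  have R0_gens: "dim_kappa_M \<phi> p (zero_set \<phi> p C) = deg (K_ring \<phi> p m) g \<and>
      int (deg (K_ring \<phi> p m) g) = int n - int (dim_K_R \<phi> p m C)"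
    if "coprime m d" "left_ideal C (R_ring \<phi> p r m)" "C \<noteq> {\<zero>\<^bsub>R_ring \<phi> p r m\<^esub>}"
      "minimal_monic_generator \<phi> p p0 r m n C g" for C g
    using minimal_generator_dims[OF that(1,2) _ that(4)] that(3) by (simp add: R_simps flip: of_nat_add)
  show ?thesis
    by (intro conjI allI impI galois_bijections zero_set_add zero_set_inter annihilator_sum annihilator_inter dims)
      (use R0_gens in \<open>simp_all add: R0_submodule_iff\<close>)
qed

end
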